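(* Assume: (i) $\sqrt{k}(\hat p-p)=\mathcal O(\sqrt{\log\log k})$ for some $p\in(0,1]$; (ii) $G$ is continuous and $\tau=\sup\{t:G(t)<1\}<\infty$; (iii) there exists $\alpha_0>2$ such that $\lim_{x\downarrow0}G(x)/x^{\alpha_0}<\infty$; (iv) there exists $\beta>0$ such that $\lim_{x\downarrow0}[1-G(\tau-x)]/x^{\beta}\in(0,\infty)$; (v) $G$ has a density $g$ that is differentiable. Fix $\alpha\in(1,\alpha_0/2)$, let $\gamma_{m,n}=k^{-1/(2\alpha)}$ (the truncation point used in the definition of $\hat G$), $r(\alpha)=\min\left(\frac14,\frac{\alpha-1}{2\alpha}\right)$ and $\varepsilon_{m,n}=k^{-r(\alpha)/(\beta+1)}$. Let $h_{m,n}$ be a sequence of positive bandwidths tending to $0$ as $k\to\infty$ such that $mh_{m,n}\to\infty$, $\log h_{m,n}/\log\log m\to-\infty$, $\sqrt{\log n}\,h_{m,n}\to0$, $\sqrt{\log m}\,h_{m,n}\to0$ as $m,n\to\infty$, and $$\lim_{k\to\infty}\frac{\varepsilon_{m,n}(\log k)^{3/2}\sqrt{\log\log k}}{\sqrt k\,h_{m,n}}=0.$$ Let $K$ be a kernel function that has finite total variation, is supported on $(-1,1)$, is continuous, and satisfies $\int K(u)\,du=1$. Then, for any $\eta\in(0,\tau)$, $$\lim_{k\to\infty}\|\hat g_{m,n}-g\|_{[0,\tau-\eta]}=0\quad\text{almost surely},$$ where $\hat g_{m,n}(t)=\frac1{h_{m,n}}\int_0^\infty K\left(\frac{t-s}{h_{m,n}}\right)d\hat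 G(s)$.
   Context: Multiplicative censoring setting. $G$ is a distribution function on $(0,\infty)$ with $\int_0^\infty z^{-1}\,dG(z)<\infty$. $X_1,\dots,X_m$ and $Z_1,\dots,Z_n$ are independent i.i.d. samples from $G$, $U_1,\dots,U_n$ is an independent i.i.d. standard uniform sample, and $Y_j=U_jZ_j$. One observes $X_1,\dots,X_m,Y_1,\dots,Y_n$. Put $k=m+n$, $\hat p=m/k$. The pairs $(m,n)$ run over a sequence indexed by $k=m+n$ with $m,n\to\infty$ jointly and $\hat p\to p\in(0,1]$; all asymptotic statements are along this sequence. $G_m$ and $F_n$ are the empirical distribution functions of $X_1,\dots,X_m$ and of $Y_1,\dots,Y_n$. All observations are taken to be distinct, with ordered values $t_1<\dots<t_k$. Estimator. $\hat G$ denotes any distribution function with masses $d\hat G(t_j)\ge0$, $\sum_{j=1}^k d\hat G(t_j)=1$, solving the nonparametric score equation: for all $t\ge0$, $$d\hat G(t)=\hat p\,dG_m(t)+(1-\hat p)\left[\int_{0<y\le t}\frac{dF_n(y)}{\int_{y\le z}z^{-1}\,d\hat G(z)}\right]t^{-1}\,d\hat G(t),$$ and satisfying $\hat G(u)=0$ for all $u<\gamma_{m,n}$ (such solutions exist, almost surely, for all large $m,n$). Notation: $\|u\|_B=\sup_{t\in B}|u(t)|$. *)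

theory Defs
  imports "HOL-Probability.Probability" "HOL-Library.Landau_Symbols"
begin

definition sup_norm_on :: "real set \<Rightarrow> (real \<Rightarrow> real) \<Rightarrow> ereal" where
  "sup_norm_on B u = (SUP t\<in>B. ereal \<bar>u t\<bar>)"

definition total_variation :: "(real \<Rightarrow> real) \<Rightarrow> ereal" where
  "total_variation f =
     Sup {ereal (\<Sum>i<N. \<bar>f (s (Suc i)) - f (s i)\<bar>) | (N::nat) (s::nat \<Rightarrow> real). mono s}"

text \<open>
  The law whose distribution function is the empirical distribution function of
  \<open>x 0, \<dots>, x (N - 1)\<close>; meaningful only for \<open>N > 0\<close>.
\<close>
definition empirical :: "nat \<Rightarrow> (nat \<Rightarrow> real) \<Rightarrow> real pmf" where
  "empirical N x = map_pmf x (pmf_of_set {..<N})"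

text \<open>
  The discrete distribution function \<open>Ghat\<close> is represented by its law \<open>P\<close>, so
  \<open>dGhat(t)\<close> is \<open>pmf P t\<close> and \<open>Ghat\<close> is \<open>cdf P\<close>.  For positive observations and \<open>m, n > 0\<close>
  the convention \<open>1 / 0 = 0\<close> admits no spurious solutions: summing the score equation over all
  observations, the right-hand side totals \<open>m/k + (n/k) q\<close>, where \<open>q\<close> is the proportion of
  the \<open>y j\<close> whose inner integral is nonzero, and since the masses sum to 1 this
  forces \<open>q = 1\<close>.
\<close>
definition score_solution ::
    "nat \<Rightarrow> nat \<Rightarrow> (nat \<Rightarrow> real) \<Rightarrow> (nat \<Rightarrow> real) \<Rightarrow> real \<Rightarrow> real pmf \<Rightarrow> bool" where
  "score_solution m n x y \<gamma> P \<longleftrightarrow>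
     (let p\<^sub>k = real m / real (m + n) in
       set_pmf P \<subseteq> x ` {..<m} \<union> y ` {..<n} \<and>
       (\<forall>t\<ge>0. pmf P t =
          p\<^sub>k * pmf (empirical m x) t
          + (1 - p\<^sub>k)
            * (LINT v:{0<..t}|measure_pmf (empirical n y).
                 1 / (LINT z:{v..}|measure_pmf P. 1 / z))
            * (1 / t) * pmf P t) \<and>
       (\<forall>u<\<gamma>. cdf (measure_pmf P) u = 0))"

definition kernel_estimate :: "(real \<Rightarrow> real) \<Rightarrow> real \<Rightarrow> real pmf \<Rightarrow> real \<Rightarrow> real" where
  "kernel_estimate K h P t = 1 / h * (LINT s:{0<..}|measure_pmf P. K ((t - s) / h))"

end

theory Submission
  imports Defs "HOL-Real_Asymp.Real_Asymp"
begin

text \<open>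
  Write \<open>E\<close> and \<open>F\<^sub>n\<close> for the empirical laws of the \<open>X\<close>'s and the \<open>Y\<close>'s, \<open>P\<close> for the law with distribution
  function \<open>Ghat\<close>, \<open>a = m/k\<close>, \<open>S(y) = \<integral>\<^bsub>z\<ge>y\<^esub> z\<^sup>-\<^sup>1 dP(z)\<close>, \<open>f(y) = \<integral>\<^bsub>z\<ge>y\<^esub> z\<^sup>-\<^sup>1 dG(z)\<close> (the density of the \<open>Y\<close>'s) and
  \<open>A(t) = (1 - a) \<integral>\<^bsub>(0,t]\<^esub> dF\<^sub>n/S\<close>. The score equation reads \<open>P{t} (1 - A(t)/t) = a E{t}\<close>. No rate of
  convergence of \<open>P\<close> is needed: it suffices that \<open>P{t} = (1 + o(1)) E{t}\<close> uniformly in \<open>t \<le> c\<close> for every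
  \<open>c < \<tau>\<close>, since \<open>E\<close> is an ordinary empirical measure, whose increments over intervals of length of
  order \<open>h\<close> are controlled by a Bernstein bound.

  Averaging the score equation over \<open>E\<close> gives
  \<open>a \<integral>(dE/dP) dE + (1 - a) \<integral>(S\<^sub>E/S) dF\<^sub>n = 1\<close>, where \<open>S\<^sub>E\<close> is the analogue of \<open>S\<close> for \<open>E\<close>. Both integrals are at
  least \<open>1 - o(1)\<close>, the second because \<open>x \<ge> 2 - 1/x\<close> and \<open>\<integral>(S/f) dF\<^sub>n \<approx> \<integral>S dy = 1\<close>; the truncation
  \<open>S \<le> 1/\<gamma>\<close> makes the last approximation legitimate, as the discrepancy of \<open>F\<^sub>n\<close> is \<open>o(\<gamma>)\<close>. Hence the
  chi-square distance between \<open>E\<close> and \<open>P\<close> vanishes, which yields \<open>S \<rightarrow> f\<close> uniformly away from the origin and,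
  with the score equation, up to the origin. Consequently \<open>A(t)/t \<rightarrow> 1 - p\<close> uniformly on \<open>[\<gamma>, c]\<close>, so the
  score equation becomes \<open>P{t} = (1 + o(1)) E{t}\<close>.
\<close>

section \<open>Uniform deviations of interval counts\<close>

text \<open>Randomness enters only through counts of sample points in intervals: off one null set
  these obey uniform bounds at the scales \<open>\<gamma>\<close> and \<open>h\<close>, and the rest
  is deterministic for a fixed sample. Intervals suffice because each integrand to be compared is
  monotone on an interval and zero elsewhere, or a difference of two such functions, so superlevel
  sets are intervals. At scale \<open>\<gamma>\<close> the bounds require
  \<open>k * \<gamma>^2 = k powr (1 - 1 / \<alpha>)\<close> to outgrow \<open>ln k\<close>, hence
  \<alpha> > 1. At scale \<open>h\<close> the variance of a count must be taken proportional to the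
  mass of the interval, since the conditions admit bandwidths of smaller order than
  \<open>1 / sqrt k\<close>. At the left end of the range, the decay of \<open>G\<close> forces
  \<open>g 0 = 0\<close>, so windows reaching below 0 cause no boundary bias.\<close>

lemma exp_le_quadratic:
  fixes x :: real
  assumes "\<bar>x\<bar> \<le> 1"
  shows "exp x \<le> 1 + x + x\<^sup>2"
proof (cases "0 \<le> x")
  case True
  then show ?thesis using assms by (intro exp_bound) auto
next
  case False
  define y where "y = - x"
  have y: "0 < y" "y \<le> 1" using False assms by (auto simp: y_def)
  have "exp (- y) \<le> 1 / (1 + y)"
    using exp_ge_add_one_self[of y] y by (simp add: exp_minus field_simps)
  also have "\<dots> \<le> 1 - y + y\<^sup>2"
    using y by (simp add: field_simps power2_eq_square)
  finally show ?thesis by (simp add: y_def)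
qed

text \<open>The exponent carries the mass \<open>measure \<mu> B\<close> where a Hoeffding bound
  would carry a constant; this makes counts in intervals of mass of order \<open>h\<close> precise
  enough. Each factor is a Bernoulli transform, bounded through \<open>1 + x \<le> exp x\<close> and
  \<open>exp x - 1 - x \<le> x^2\<close>.\<close>

lemma (in prob_space) count_mgf_bound:
  fixes V :: "nat \<Rightarrow> 'a \<Rightarrow> real" and N :: nat
  assumes indep: "indep_vars (\<lambda>_. borel) V UNIV"
    and law: "\<And>i. distr M borel (V i) = \<mu>"
    and B: "B \<in> sets borel" and \<sigma>: "\<bar>\<sigma>\<bar> \<le> 1"
  defines "T \<equiv> \<lambda>\<omega>. (\<Sum>i<N. indicator B (V i \<omega>) - measure \<mu> B)"
  shows "integrable M (\<lambda>\<omega>. exp (\<sigma> * T \<omega>))"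
    and "(\<integral>\<omega>. exp (\<sigma> * T \<omega>) \<partial>M) \<le> exp (real N * \<sigma>\<^sup>2 * measure \<mu> B)"
proof -
  define q where "q = measure \<mu> B"
  have rv[measurable]: "V i \<in> borel_measurable M" for i
    using indep by (auto simp: indep_vars_def)
  note B[measurable]
  define W where "W = (\<lambda>i \<omega>. exp (\<sigma> * (indicator B (V i \<omega>) - q)))"
  have Wind: "indep_vars (\<lambda>_. borel) W {..<N}"
    unfolding W_def
    by (rule indep_vars_compose2[OF indep_vars_subset[OF indep]]) auto
  have eq: "exp (\<sigma> * T \<omega>) = (\<Prod>i<N. W i \<omega>)" for \<omega>
    by (simp add: T_def W_def q_def sum_distrib_left exp_sum)
  have Wsplit: "W i \<omega> = exp (- \<sigma> * q) * (1 + (exp \<sigma> - 1) * indicator (V i -` B \<inter> space M) \<omega>)"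
    if "\<omega> \<in> space M" for i \<omega>
    using that by (auto simp: W_def indicator_def exp_minus exp_diff algebra_simps divide_inverse)
  have prob_eq: "prob (V i -` B \<inter> space M) = q" for i
    unfolding q_def law[symmetric, of i] by (simp add: measure_distr)
  have int1: "integrable M (\<lambda>\<omega>. exp (- \<sigma> * q) * (1 + (exp \<sigma> - 1) * indicator (V i -` B \<inter> space M) \<omega>))" for i
    by (intro integrable_mult_right Bochner_Integration.integrable_add integrable_real_indicator)
       (auto simp: emeasure_eq_measure)
  have Wint: "integrable M (W i)" for i
    using int1[of i] by (subst Bochner_Integration.integrable_cong[OF refl Wsplit]) auto
  have W_eq: "(\<integral>\<omega>. W i \<omega> \<partial>M) = exp (- \<sigma> * q) * (1 + (exp \<sigma> - 1) * q)" for i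
  proof -
    have "(\<integral>\<omega>. W i \<omega> \<partial>M) = (\<integral>\<omega>. exp (- \<sigma> * q) * (1 + (exp \<sigma> - 1) * indicator (V i -` B \<inter> space M) \<omega>) \<partial>M)"
      by (rule Bochner_Integration.integral_cong[OF refl Wsplit])
    also have "\<dots> = exp (- \<sigma> * q) * (1 + (exp \<sigma> - 1) * q)"
      by (subst Bochner_Integration.integral_mult_right_zero, subst Bochner_Integration.integral_add)
         (auto intro!: integrable_mult_right integrable_real_indicator
            simp: prob_space emeasure_eq_measure prob_eq[of i, symmetric])
    finally show ?thesis .
  qed
  have q0: "0 \<le> q" by (simp add: q_def)
  have "exp (- \<sigma> * q) * (1 + (exp \<sigma> - 1) * q) \<le> exp (- \<sigma> * q) * exp ((exp \<sigma> - 1) * q)"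
    using exp_ge_add_one_self[of "(exp \<sigma> - 1) * q"] by (intro mult_left_mono) auto
  also have "\<dots> = exp ((exp \<sigma> - 1 - \<sigma>) * q)"
    by (simp add: exp_add[symmetric] algebra_simps)
  also have "\<dots> \<le> exp (\<sigma>\<^sup>2 * q)"
    using exp_le_quadratic[OF \<sigma>] q0 by (simp add: mult_right_mono)
  finally have W_le: "(\<integral>\<omega>. W i \<omega> \<partial>M) \<le> exp (\<sigma>\<^sup>2 * q)" for i
    by (simp add: W_eq)
  show "integrable M (\<lambda>\<omega>. exp (\<sigma> * T \<omega>))"
    unfolding eq by (rule indep_vars_integrable[OF _ Wind Wint]) auto
  have "(\<integral>\<omega>. exp (\<sigma> * T \<omega>) \<partial>M) = (\<Prod>i<N. \<integral>\<omega>. W i \<omega> \<partial>M)"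
    unfolding eq by (rule indep_vars_lebesgue_integral[OF _ Wind Wint]) auto
  also have "\<dots> \<le> (\<Prod>i<N. exp (\<sigma>\<^sup>2 * q))"
    by (intro prod_mono conjI W_le Bochner_Integration.integral_nonneg) (auto simp: W_def)
  also have "\<dots> = exp (real N * \<sigma>\<^sup>2 * q)"
    by (simp add: exp_of_nat_mult[symmetric] mult.assoc)
  finally show "(\<integral>\<omega>. exp (\<sigma> * T \<omega>) \<partial>M) \<le> exp (real N * \<sigma>\<^sup>2 * measure \<mu> B)"
    by (simp add: q_def)
qed

text \<open>Chernoff's bound with the exponents \<sigma> and -\<sigma>, where \<sigma> stays free to
  be optimised later. Deviations are measured in units of \<open>k\<close>, not of \<open>N\<close>,
  so that one form serves both samples, whose sizes add up to \<open>k\<close>.\<close>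

lemma (in prob_space) count_deviation_prob:
  fixes V :: "nat \<Rightarrow> 'a \<Rightarrow> real"
  assumes indep: "indep_vars (\<lambda>_. borel) V UNIV"
    and law: "\<And>i. distr M borel (V i) = \<mu>"
    and B: "B \<in> sets borel" and \<sigma>: "0 \<le> \<sigma>" "\<sigma> \<le> 1" and u: "measure \<mu> B \<le> u" and N: "N \<le> k"
  shows "prob {\<omega> \<in> space M. real k * s \<le> \<bar>\<Sum>i<N. indicator B (V i \<omega>) - measure \<mu> B\<bar>}
    \<le> 2 * exp (real k * (\<sigma>\<^sup>2 * u - \<sigma> * s))"
proof -
  define T where "T = (\<lambda>\<omega>. (\<Sum>i<N. indicator B (V i \<omega>) - measure \<mu> B))"
  have rv[measurable]: "V i \<in> borel_measurable M" for i
    using indep by (auto simp: indep_vars_def)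
  note B[measurable]
  have T[measurable]: "T \<in> borel_measurable M" unfolding T_def by measurable
  have one: "prob {\<omega> \<in> space M. exp (\<sigma> * (real k * s)) \<le> exp (\<rho> * T \<omega>)} \<le> exp (real k * (\<sigma>\<^sup>2 * u - \<sigma> * s))"
    if \<rho>: "\<bar>\<rho>\<bar> = \<sigma>" for \<rho>
  proof -
    have r1: "\<bar>\<rho>\<bar> \<le> 1" and r2: "\<rho>\<^sup>2 = \<sigma>\<^sup>2" using \<rho> \<sigma> by auto
    have "prob {\<omega> \<in> space M. exp (\<sigma> * (real k * s)) \<le> exp (\<rho> * T \<omega>)}
        \<le> (\<integral>\<omega>. exp (\<rho> * T \<omega>) \<partial>M) / exp (\<sigma> * (real k * s))"
      using count_mgf_bound(1)[OF indep law B r1]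
      by (intro integral_Markov_inequality_measure[where A = "{}"]) (auto simp: T_def)
    also have "\<dots> \<le> exp (real N * \<sigma>\<^sup>2 * measure \<mu> B) / exp (\<sigma> * (real k * s))"
      using count_mgf_bound(2)[OF indep law B r1] by (intro divide_right_mono) (auto simp: T_def r2)
    also have "\<dots> \<le> exp (real k * \<sigma>\<^sup>2 * u) / exp (\<sigma> * (real k * s))"
      using N u by (intro divide_right_mono) (auto intro!: mult_mono)
    also have "\<dots> = exp (real k * (\<sigma>\<^sup>2 * u - \<sigma> * s))"
      by (simp add: exp_diff[symmetric] algebra_simps)
    finally show ?thesis .
  qed
  have "prob {\<omega> \<in> space M. real k * s \<le> \<bar>T \<omega>\<bar>} \<le>
    prob ({\<omega> \<in> space M. exp (\<sigma> * (real k * s)) \<le> exp (\<sigma> * T \<omega>)} \<union>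
          {\<omega> \<in> space M. exp (\<sigma> * (real k * s)) \<le> exp (- \<sigma> * T \<omega>)})"
  proof (rule finite_measure_mono)
    show "{\<omega> \<in> space M. real k * s \<le> \<bar>T \<omega>\<bar>} \<subseteq>
       {\<omega> \<in> space M. exp (\<sigma> * (real k * s)) \<le> exp (\<sigma> * T \<omega>)} \<union>
          {\<omega> \<in> space M. exp (\<sigma> * (real k * s)) \<le> exp (- \<sigma> * T \<omega>)}"
    proof
      fix \<omega> assume "\<omega> \<in> {\<omega> \<in> space M. real k * s \<le> \<bar>T \<omega>\<bar>}"
      then have w: "\<omega> \<in> space M" and h: "real k * s \<le> \<bar>T \<omega>\<bar>" by auto
      have "\<sigma> * (real k * s) \<le> \<sigma> * \<bar>T \<omega>\<bar>" using h \<sigma> by (intro mult_left_mono)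
      then have "\<sigma> * (real k * s) \<le> \<sigma> * T \<omega> \<or> \<sigma> * (real k * s) \<le> - \<sigma> * T \<omega>"
        by (cases "T \<omega> \<ge> 0") auto
      then show "\<omega> \<in> {\<omega> \<in> space M. exp (\<sigma> * (real k * s)) \<le> exp (\<sigma> * T \<omega>)} \<union>
          {\<omega> \<in> space M. exp (\<sigma> * (real k * s)) \<le> exp (- \<sigma> * T \<omega>)}"
        using w by auto
    qed
  qed measurable
  also have "\<dots> \<le> prob {\<omega> \<in> space M. exp (\<sigma> * (real k * s)) \<le> exp (\<sigma> * T \<omega>)} +
          prob {\<omega> \<in> space M. exp (\<sigma> * (real k * s)) \<le> exp (- \<sigma> * T \<omega>)}"
    by (rule measure_Un_le) measurable
  also have "\<dots> \<le> 2 * exp (real k * (\<sigma>\<^sup>2 * u - \<sigma> * s))"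
    using one[of \<sigma>] one[of "- \<sigma>"] \<sigma> by simp
  finally show ?thesis by (simp add: T_def)
qed

section \<open>The probability integral transform and cells in the quantile scale\<close>

lemma (in real_distribution) cdf_attains:
  assumes "continuous_on UNIV (cdf M)" "0 < u" "u < 1"
  obtains x where "cdf M x = u"
proof -
  obtain a where a: "cdf M a < u"
    using order_tendstoD(2)[OF cdf_lim_at_bot \<open>0 < u\<close>] by (auto simp: eventually_at_bot_linorder)
  obtain b where b: "u < cdf M b"
    using order_tendstoD(1)[OF cdf_lim_at_top_prob \<open>u < 1\<close>] by (auto simp: eventually_at_top_linorder)
  have "a \<le> b" using a b cdf_nondecreasing[of b a] by linarith
  then obtain x where "a \<le> x" "x \<le> b" "cdf M x = u"
    using IVT'[of "cdf M" a u b] a b continuous_on_subset[OF assms(1)] by (auto simp: less_imp_le)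
  then show ?thesis using that by blast
qed

lemma (in real_distribution) cdf_measurable[measurable]: "cdf M \<in> borel_measurable borel"
  by (intro borel_measurable_mono monoI cdf_nondecreasing)

text \<open>A continuous distribution function maps its law to the uniform law. For the upper bound,
  a point at a level \<open>w > u\<close> dominates the whole sublevel set, so flat stretches of the
  distribution function need no separate treatment.\<close>

lemma (in real_distribution) prob_cdf_le:
  assumes cont: "continuous_on UNIV (cdf M)" and u: "0 \<le> u" "u \<le> 1"
  shows "prob {x. cdf M x \<le> u} = u"
proof (rule antisym)
  have meas: "{x. cdf M x \<le> v} \<in> sets M" for v by measurable
  show "prob {x. cdf M x \<le> u} \<le> u"
  proof (rule dense_ge)
    fix w assume w: "u < w"
    show "prob {x. cdf M x \<le> u} \<le> w"
    proof (cases "w < 1")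
      case True
      then obtain x where x: "cdf M x = w" using cdf_attains[OF cont, of w] u w by auto
      have "{y. cdf M y \<le> u} \<subseteq> {..x}"
      proof safe
        fix y assume "cdf M y \<le> u"
        then have "cdf M y < cdf M x" using w x by simp
        then show "y \<le> x" using cdf_nondecreasing[of x y] by linarith
      qed
      then have "prob {y. cdf M y \<le> u} \<le> prob {..x}" by (intro finite_measure_mono) auto
      then show ?thesis using x by (simp add: cdf_def)
    next
      case False
      then show ?thesis using prob_le_1[of "{x. cdf M x \<le> u}"] by linarith
    qed
  qed
  show "u \<le> prob {x. cdf M x \<le> u}"
  proof (cases "u = 0 \<or> u = 1")
    case True
    then show ?thesis
    proof
      assume "u = 1"
      then have "{x. cdf M x \<le> u} = space M" using cdf_bounded_prob by auto
      then have "prob {x. cdf M x \<le> u} = 1" using prob_space by simp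
      then show ?thesis using u by simp
    qed simp
  next
    case False
    then obtain x where x: "cdf M x = u" using cdf_attains[OF cont, of u] u by auto
    have "{..x} \<subseteq> {y. cdf M y \<le> u}" using x cdf_nondecreasing by auto
    then have "prob {..x} \<le> prob {y. cdf M y \<le> u}" by (intro finite_measure_mono meas)
    then show ?thesis using x by (simp add: cdf_def)
  qed
qed

lemma (in real_distribution) prob_cdf_less:
  assumes cont: "continuous_on UNIV (cdf M)" and u: "0 \<le> u" "u \<le> 1"
  shows "prob {x. cdf M x < u} = u"
proof (rule antisym)
  show "prob {x. cdf M x < u} \<le> u"
  proof -
    have "prob {x. cdf M x < u} \<le> prob {x. cdf M x \<le> u}"
      by (intro finite_measure_mono) auto
    then show ?thesis using prob_cdf_le[OF assms] by simp
  qed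
  show "u \<le> prob {x. cdf M x < u}"
  proof (rule dense_le)
    fix w assume w: "w < u"
    show "w \<le> prob {x. cdf M x < u}"
    proof (cases "0 \<le> w")
      case True
      have "prob {x. cdf M x \<le> w} \<le> prob {x. cdf M x < u}"
        using w by (intro finite_measure_mono) auto
      then show ?thesis using prob_cdf_le[OF cont, of w] True w u by simp
    next
      case False
      then show ?thesis using measure_nonneg[of M "{x. cdf M x < u}"] by linarith
    qed
  qed
qed

text \<open>Cutting in the quantile scale makes the masses multiples of \<open>1 / L\<close> for
  every continuous law. Indices are integers because \<open>i = -1\<close> must be available: the
  left inequality is strict, and only a negative bound admits points where the distribution function
  is 0.\<close>

definition cdf_cell :: "real measure \<Rightarrow> nat \<Rightarrow> int \<Rightarrow> int \<Rightarrow> real set" where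
  "cdf_cell \<mu> L i j = {x. of_int i / real L < cdf \<mu> x \<and> cdf \<mu> x \<le> of_int j / real L}"

lemma (in real_distribution) cdf_cell_measurable[measurable]: "cdf_cell M L i j \<in> sets borel"
  unfolding cdf_cell_def by measurable

lemma (in real_distribution) prob_cdf_cell:
  assumes cont: "continuous_on UNIV (cdf M)" and L: "0 < L" and ij: "0 \<le> i" "i \<le> j" "j \<le> int L"
  shows "prob (cdf_cell M L i j) = (of_int j - of_int i) / real L"
proof -
  have le: "of_int i / real L \<le> of_int j / real L" "0 \<le> of_int i / real L" "of_int j / real L \<le> 1"
    using L ij by (auto simp: divide_simps)
  have "cdf_cell M L i j = {x. cdf M x \<le> of_int j / real L} - {x. cdf M x \<le> of_int i / real L}"
    by (auto simp: cdf_cell_def)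
  then have "prob (cdf_cell M L i j) = prob {x. cdf M x \<le> of_int j / real L} - prob {x. cdf M x \<le> of_int i / real L}"
    using le by (simp only:) (intro finite_measure_Diff; force)
  also have "\<dots> = of_int j / real L - of_int i / real L"
    using le by (simp add: prob_cdf_le[OF cont])
  finally show ?thesis by (simp add: diff_divide_distrib)
qed

lemma (in real_distribution) prob_cdf_cell_le:
  assumes cont: "continuous_on UNIV (cdf M)" and L: "0 < L" and ij: "-1 \<le> i" "i \<le> j" "0 \<le> j" "j \<le> int L"
  shows "prob (cdf_cell M L i j) \<le> (of_int j - of_int i) / real L"
proof (cases "i = -1")
  case True
  have "prob (cdf_cell M L i j) \<le> prob {x. cdf M x \<le> of_int j / real L}"
    by (rule finite_measure_mono) (auto simp: cdf_cell_def)
  also have "\<dots> = of_int j / real L"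
    using L ij by (intro prob_cdf_le cont) (auto simp: divide_simps)
  also have "\<dots> \<le> (of_int j - of_int i) / real L"
    using L True by (intro divide_right_mono) auto
  finally show ?thesis .
next
  case False
  then show ?thesis using prob_cdf_cell[OF cont L, of i j] ij by simp
qed

lemma (in real_distribution) prob_cdf_cell_ge:
  assumes cont: "continuous_on UNIV (cdf M)" and L: "0 < L" and ij: "0 \<le> i" "j \<le> int L"
  shows "(of_int j - of_int i) / real L \<le> prob (cdf_cell M L i j)"
proof (cases "i \<le> j")
  case True
  then show ?thesis using prob_cdf_cell[OF cont L, of i j] ij by simp
next
  case False
  then have "(of_int j - of_int i) / real L \<le> (0::real)" using L by (simp add: divide_le_0_iff)
  then show ?thesis using measure_nonneg[of M "cdf_cell M L i j"] by linarith
qed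

text \<open>The infimum and supremum of the distribution function over \<open>I\<close> replace the
  endpoints of \<open>I\<close>, which treats open, closed and unbounded intervals alike. Passing to
  the grid then costs at most \<open>1 / L\<close> of mass at each end.\<close>

lemma (in real_distribution) interval_cdf_cell_sandwich:
  assumes cont: "continuous_on UNIV (cdf M)" and L: "0 < L" and I: "is_interval I"
  obtains i j i' j' where "{i, j, i', j'} \<subseteq> {-1..int L}"
    "cdf_cell M L i j \<subseteq> I" "I \<subseteq> cdf_cell M L i' j'"
    "prob I - 2 / real L \<le> prob (cdf_cell M L i j)"
    "prob (cdf_cell M L i' j') \<le> prob I + 2 / real L"
proof (cases "I = {}")
  case True
  have e: "cdf_cell M L 0 0 = {}" by (auto simp: cdf_cell_def)
  show ?thesis by (rule that[of 0 0 0 0]) (use True e in auto)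
next
  case False
  have Im[measurable]: "I \<in> sets borel" using I by (rule real_interval_borel_measurable)
  have bd: "0 \<le> cdf M x" "cdf M x \<le> 1" for x
    using cdf_nonneg cdf_bounded_prob by auto
  define \<alpha> \<beta> where "\<alpha> = Inf (cdf M ` I)" and "\<beta> = Sup (cdf M ` I)"
  have bb: "bdd_below (cdf M ` I)" "bdd_above (cdf M ` I)"
    using bd by (auto intro!: bdd_belowI bdd_aboveI)
  have lo: "\<alpha> \<le> cdf M x" and up: "cdf M x \<le> \<beta>" if "x \<in> I" for x
    using that bb by (auto simp: \<alpha>_def \<beta>_def intro: cInf_lower cSup_upper)
  have ab: "0 \<le> \<alpha>" "\<beta> \<le> 1"
    using False bd by (auto simp: \<alpha>_def \<beta>_def intro!: cInf_greatest cSup_least)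
  have "\<alpha> \<le> \<beta>" using False lo up by (meson all_not_in_conv order.trans)
  have sub: "{x. \<alpha> < cdf M x \<and> cdf M x < \<beta>} \<subseteq> I"
  proof safe
    fix x assume "\<alpha> < cdf M x" "cdf M x < \<beta>"
    then have "\<exists>z\<in>cdf M ` I. z < cdf M x" "\<exists>z\<in>cdf M ` I. cdf M x < z"
      unfolding \<alpha>_def \<beta>_def using False bb by (simp_all only: cInf_less_iff less_cSup_iff image_is_empty not_False_eq_True)
    then obtain y1 y2 where y: "y1 \<in> I" "cdf M y1 < cdf M x" "y2 \<in> I" "cdf M x < cdf M y2"
      by blast
    then have "y1 \<le> x" "x \<le> y2" using cdf_nondecreasing[of x y1] cdf_nondecreasing[of y2 x] by linarith+
    then show "x \<in> I" using I y(1,3) unfolding is_interval_1 by blast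
  qed
  have pI_ge: "\<beta> - \<alpha> \<le> prob I"
  proof -
    have "\<beta> = prob {x. cdf M x < \<beta>}" using ab \<open>\<alpha> \<le> \<beta>\<close> by (simp add: prob_cdf_less[OF cont])
    also have "\<dots> \<le> prob ({x. cdf M x \<le> \<alpha>} \<union> I)"
      using sub by (intro finite_measure_mono) force+
    also have "\<dots> \<le> prob {x. cdf M x \<le> \<alpha>} + prob I"
      by (intro measure_Un_le) auto
    also have "prob {x. cdf M x \<le> \<alpha>} = \<alpha>" using ab \<open>\<alpha> \<le> \<beta>\<close> by (simp add: prob_cdf_le[OF cont])
    finally show ?thesis by simp
  qed
  have pI_le: "prob I \<le> \<beta> - \<alpha>"
  proof -
    have "prob I \<le> prob ({x. cdf M x \<le> \<beta>} - {x. cdf M x < \<alpha>})"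
      using lo up by (intro finite_measure_mono) (auto simp: not_less[symmetric] dest: leD)
    also have "\<dots> = prob {x. cdf M x \<le> \<beta>} - prob {x. cdf M x < \<alpha>}"
      using \<open>\<alpha> \<le> \<beta>\<close> by (intro finite_measure_Diff) auto
    also have "\<dots> = \<beta> - \<alpha>"
      using ab \<open>\<alpha> \<le> \<beta>\<close> by (simp add: prob_cdf_le[OF cont] prob_cdf_less[OF cont])
    finally show ?thesis .
  qed
  define a b where "a = \<lceil>real L * \<alpha>\<rceil>" and "b = \<lceil>real L * \<beta>\<rceil>"
  have La: "real L * \<alpha> \<le> of_int a" "of_int a < real L * \<alpha> + 1" unfolding a_def by linarith+
  have Lb: "real L * \<beta> \<le> of_int b" "of_int b < real L * \<beta> + 1" unfolding b_def by linarith+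
  have a0: "0 \<le> a" and abi: "a \<le> b" and bL: "b \<le> int L"
  proof -
    show "0 \<le> a" using ab by (simp add: a_def) (smt (verit) L mult_nonneg_nonneg of_nat_0_le_iff)
    show "a \<le> b" unfolding a_def b_def using \<open>\<alpha> \<le> \<beta>\<close> by (intro ceiling_mono mult_left_mono) auto
    have "real L * \<beta> \<le> real L" using ab by (simp add: mult_left_le)
    then show "b \<le> int L" by (simp add: b_def ceiling_le_iff)
  qed
  show ?thesis
  \<comment> \<open>As \<open>a\<close> and \<open>b\<close> are ceilings, \<open>a - 1\<close> and
    \<open>b - 1\<close> are the last grid indices strictly below \<open>L * \<alpha>\<close> and
    \<open>L * \<beta>\<close>. Strictness matters on both sides: a point at level \<beta> may lie
    outside \<open>I\<close>, and a point at level \<alpha> may lie inside.\<close>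
  proof (rule that[of a "b - 1" "a - 1" b])
    show "{a, b - 1, a - 1, b} \<subseteq> {- 1..int L}" using a0 abi bL by auto
    show "cdf_cell M L a (b - 1) \<subseteq> I"
    proof
      fix x assume x: "x \<in> cdf_cell M L a (b - 1)"
      have "\<alpha> \<le> of_int a / real L" "of_int (b - 1) / real L < \<beta>"
        using La Lb L by (auto simp: field_simps)
      then show "x \<in> I" using x sub by (auto simp: cdf_cell_def)
    qed
    show "I \<subseteq> cdf_cell M L (a - 1) b"
    proof
      fix x assume x: "x \<in> I"
      have "\<beta> \<le> of_int b / real L" "of_int (a - 1) / real L < \<alpha>"
        using La Lb L by (auto simp: field_simps)
      then show "x \<in> cdf_cell M L (a - 1) b" using lo[OF x] up[OF x] by (auto simp: cdf_cell_def)
    qed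
    have LI: "real L * prob I = real L * \<beta> - real L * \<alpha>"
      using pI_le pI_ge by (simp add: right_diff_distrib[symmetric])
    have "prob I - 2 / real L = (real L * prob I - 2) / real L"
      using L by (simp add: diff_divide_distrib)
    also have "\<dots> \<le> (of_int (b - 1) - of_int a) / real L"
      using LI La Lb by (intro divide_right_mono) auto
    also have "\<dots> \<le> prob (cdf_cell M L a (b - 1))"
      using a0 abi bL L by (intro prob_cdf_cell_ge cont) auto
    finally show "prob I - 2 / real L \<le> prob (cdf_cell M L a (b - 1))" .
    have "prob (cdf_cell M L (a - 1) b) \<le> (of_int b - of_int (a - 1)) / real L"
      using a0 abi bL L by (intro prob_cdf_cell_le cont) auto
    also have "\<dots> \<le> (real L * prob I + 2) / real L"
      using LI La Lb by (intro divide_right_mono) auto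
    also have "\<dots> = prob I + 2 / real L"
      using L by (simp add: add_divide_distrib)
    finally show "prob (cdf_cell M L (a - 1) b) \<le> prob I + 2 / real L" .
  qed
qed

lemma count_near_of_sandwich:
  fixes x :: "nat \<Rightarrow> real"
  assumes sub: "B \<subseteq> I" "I \<subseteq> B'"
    and meas: "measure \<mu> I - d \<le> measure \<mu> B" "measure \<mu> B' \<le> measure \<mu> I + d"
    and dev: "\<bar>\<Sum>i<N. indicator B (x i) - measure \<mu> B\<bar> \<le> e"
             "\<bar>\<Sum>i<N. indicator B' (x i) - measure \<mu> B'\<bar> \<le> e"
  shows "\<bar>(\<Sum>i<N. indicator I (x i)) - real N * measure \<mu> I\<bar> \<le> e + real N * d"
proof -
  have 1: "(\<Sum>i<N. indicator B (x i) :: real) \<le> (\<Sum>i<N. indicator I (x i))"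
    using sub by (intro sum_mono) (auto simp: indicator_def)
  have 2: "(\<Sum>i<N. indicator I (x i) :: real) \<le> (\<Sum>i<N. indicator B' (x i))"
    using sub by (intro sum_mono) (auto simp: indicator_def)
  have 3: "real N * (measure \<mu> I - d) \<le> real N * measure \<mu> B"
    using meas by (intro mult_left_mono) auto
  have 4: "real N * measure \<mu> B' \<le> real N * (measure \<mu> I + d)"
    using meas by (intro mult_left_mono) auto
  show ?thesis using 1 2 3 4 dev by (simp add: sum_subtractf algebra_simps)
qed

text \<open>A union bound over polynomially many cells, followed by Borel-Cantelli. The bad event
  refers to finitely many cells, so it is measurable, and the sandwich carries the bound over to all
  intervals. The cap \<open>v\<close> on the mass is what bounds the variance.\<close>

theorem (in prob_space) AE_uniform_interval_count:
  fixes V :: "nat \<Rightarrow> 'a \<Rightarrow> real" and N :: "nat \<Rightarrow> nat" and s v :: "nat \<Rightarrow> real"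
  assumes indep: "indep_vars (\<lambda>_. borel) V UNIV"
    and law: "\<And>i. distr M borel (V i) = \<mu>"
    and mu: "real_distribution \<mu>" "continuous_on UNIV (cdf \<mu>)"
    and N: "\<And>k. N k \<le> k"
    and s: "\<forall>\<^sub>F k in sequentially. 0 < s k" and v: "\<And>k. 0 \<le> v k"
    and large: "\<forall>\<^sub>F k in sequentially. 20 * ln (real k) * (v k + 2 * s k) \<le> real k * (s k)\<^sup>2"
  shows "AE \<omega> in M. \<forall>\<^sub>F k in sequentially. \<forall>I. is_interval I \<longrightarrow> measure \<mu> I \<le> v k \<longrightarrow>
    \<bar>(\<Sum>i<N k. indicator I (V i \<omega>)) - real (N k) * measure \<mu> I\<bar> \<le> 3 * real k * s k"
proof -
  interpret \<mu>: real_distribution \<mu> by fact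
  have rv[measurable]: "V i \<in> borel_measurable M" for i
    using indep by (auto simp: indep_vars_def)
  \<comment> \<open>One cell has mass at most \<open>s k\<close>, so the sandwich error is at most
    \<open>2 * s k\<close>. With the deviation \<open>s k\<close> of the cell counts this makes the
    factor 3 of the conclusion.\<close>
  define L where "L k = nat \<lceil>1 / s k\<rceil>" for k
  define dev where "dev k B = {\<omega> \<in> space M. real k * s k \<le> \<bar>\<Sum>i<N k. indicator B (V i \<omega>) - measure \<mu> B\<bar>}" for k B
  define J where "J k = {(i, j). (i, j) \<in> {-1..int (L k)} \<times> {-1..int (L k)} \<and>
       measure \<mu> (cdf_cell \<mu> (L k) i j) \<le> v k + 2 * s k}" for k
  define Bad where "Bad k = (\<Union>(i, j)\<in>J k. dev k (cdf_cell \<mu> (L k) i j))" for k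
  have J: "finite (J k)" "card (J k) \<le> (L k + 2)\<^sup>2" for k
  proof -
    have sub: "J k \<subseteq> {-1..int (L k)} \<times> {-1..int (L k)}" unfolding J_def by blast
    have fin: "finite ({-1..int (L k)} \<times> {-1..int (L k)})" by blast
    show "finite (J k)" using sub fin by (rule finite_subset)
    have "card (J k) \<le> card ({-1..int (L k)} \<times> {-1..int (L k)})" by (rule card_mono[OF fin sub])
    also have "\<dots> = (L k + 2)\<^sup>2"
    proof -
      have "card {-1..int (L k)} = L k + 2" by simp
      then show ?thesis by (simp only: card_cartesian_product power2_eq_square)
    qed
    finally show "card (J k) \<le> (L k + 2)\<^sup>2" .
  qed
  have dev_meas[measurable]: "dev k (cdf_cell \<mu> l i j) \<in> sets M" for k l i j
    unfolding dev_def by measurable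
  have Bad_meas: "Bad k \<in> sets M" for k
    unfolding Bad_def using J(1) by (intro sets.finite_UN) auto
  have good: "\<forall>\<^sub>F k in sequentially. 0 < s k \<and> 0 < k \<and> 1 \<le> real k * s k \<and> 20 * ln (real k) * (v k + 2 * s k) \<le> real k * (s k)\<^sup>2"
    using s large eventually_ge_at_top[of 4]
  proof eventually_elim
    case (elim k)
    have e1: "exp 1 < real k" using elim exp_le by linarith
    have "1 < ln (real k)" using ln_less_cancel_iff[of "exp 1" "real k"] e1 elim by simp
    then have "20 * 1 * (2 * s k) \<le> 20 * ln (real k) * (v k + 2 * s k)"
      using elim v[of k] by (intro mult_mono) auto
    moreover have "real k * (s k)\<^sup>2 = real k * s k * s k" by (simp add: power2_eq_square)
    ultimately have "40 * s k \<le> real k * s k * s k" using elim by linarith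
    then have "40 \<le> real k * s k" using elim(1) by (metis mult_le_cancel_right_pos)
    then show ?case using elim by auto
  qed
  have bound: "\<forall>\<^sub>F k in sequentially. norm (measure M (Bad k)) \<le> (real k + 4)\<^sup>2 * 2 * real k powr (- 5)"
    using good
  proof eventually_elim
    case (elim k)
    then have sk: "0 < s k" and k0: "0 < k" by auto
    define u where "u = v k + 2 * s k"
    have u: "0 < u" using v[of k] sk by (simp add: u_def)
    \<comment> \<open>The minimiser of \<open>\<sigma>^2 * u - \<sigma> * s k\<close>, with minimum
      \<open>- (s k)^2 / (4 * u)\<close>. The constant 20 = 4 * 5 of the hypothesis turns this into
      probability \<open>k powr (- 5)\<close> per cell, up to a factor 2, against about
      \<open>k^2\<close> cells. The summand \<open>2 * s k\<close> in \<open>u\<close> keeps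
      \<sigma> below 1.\<close>
    define \<sigma> where "\<sigma> = s k / (2 * u)"
    have \<sigma>: "0 \<le> \<sigma>" "\<sigma> \<le> 1" using u sk v[of k] by (auto simp: \<sigma>_def u_def field_simps)
    have ex: "exp (real k * (\<sigma>\<^sup>2 * u - \<sigma> * s k)) \<le> real k powr (- 5)"
    proof -
      have "\<sigma>\<^sup>2 * u - \<sigma> * s k = - ((s k)\<^sup>2 / (4 * u))"
        using u by (simp add: \<sigma>_def field_simps power2_eq_square)
      moreover have "5 * ln (real k) \<le> real k * ((s k)\<^sup>2 / (4 * u))"
      proof -
        have "5 * ln (real k) * (4 * u) \<le> real k * (s k)\<^sup>2" using elim by (simp add: u_def algebra_simps)
        then show ?thesis using u by (simp add: pos_le_divide_eq)
      qed
      ultimately have "real k * (\<sigma>\<^sup>2 * u - \<sigma> * s k) \<le> - 5 * ln (real k)" by simp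
      then show ?thesis using k0 by (simp add: powr_def)
    qed
    have "measure M (Bad k) \<le> (\<Sum>ij\<in>J k. measure M (case ij of (i, j) \<Rightarrow> dev k (cdf_cell \<mu> (L k) i j)))"
      unfolding Bad_def using J(1) by (intro measure_UNION_le) auto
    also have "\<dots> \<le> (\<Sum>ij\<in>J k. 2 * real k powr (- 5))"
    proof (rule sum_mono, clarify)
      fix i j assume "(i, j) \<in> J k"
      then have "measure \<mu> (cdf_cell \<mu> (L k) i j) \<le> u" by (simp add: J_def u_def)
      then have "measure M (dev k (cdf_cell \<mu> (L k) i j)) \<le> 2 * exp (real k * (\<sigma>\<^sup>2 * u - \<sigma> * s k))"
        unfolding dev_def
        by (intro count_deviation_prob[OF indep law _ \<sigma> _ N]) auto
      then show "measure M (dev k (cdf_cell \<mu> (L k) i j)) \<le> 2 * real k powr (- 5)"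
        using ex by simp
    qed
    also have "\<dots> = real (card (J k)) * (2 * real k powr (- 5))" by simp
    also have "\<dots> \<le> (real k + 4)\<^sup>2 * (2 * real k powr (- 5))"
    proof (rule mult_right_mono)
      have "1 / s k \<le> real k" using elim sk by (simp add: field_simps)
      then have "L k \<le> k + 2" unfolding L_def by linarith
      have "real (card (J k)) \<le> real ((L k + 2)\<^sup>2)" using J(2)[of k] by (simp only: of_nat_le_iff)
      also have "\<dots> = (real (L k) + 2)\<^sup>2" by (simp add: add.commute)
      also have "\<dots> \<le> (real k + 4)\<^sup>2" using \<open>L k \<le> k + 2\<close> by (intro power_mono) auto
      finally show "real (card (J k)) \<le> (real k + 4)\<^sup>2" .
    qed simp
    finally show ?case by (simp add: mult.assoc)
  qed
  have "summable (\<lambda>k. measure M (Bad k))"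
  proof (rule summable_comparison_test_ev[OF bound])
    have "(\<lambda>k. (real k + 4)\<^sup>2 * 2 * real k powr (- 5)) \<in> O(\<lambda>k. real k powr (- 2))" by real_asymp
    moreover have "summable (\<lambda>k. norm (real k powr (- 2)))"
      by (simp add: summable_real_powr_iff)
    ultimately show "summable (\<lambda>k. (real k + 4)\<^sup>2 * 2 * real k powr (- 5))"
      by (rule summable_comparison_test_bigo[rotated])
  qed
  then have "AE \<omega> in M. \<forall>\<^sub>F k in sequentially. \<omega> \<in> space M - Bad k"
    using Bad_meas by (intro borel_cantelli_AE1) (auto simp: emeasure_eq_measure)
  then show ?thesis
  proof (rule AE_mp, intro AE_I2 impI)
    fix \<omega> assume "\<forall>\<^sub>F k in sequentially. \<omega> \<in> space M - Bad k"
    then show "\<forall>\<^sub>F k in sequentially. \<forall>I. is_interval I \<longrightarrow> measure \<mu> I \<le> v k \<longrightarrow>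
      \<bar>(\<Sum>i<N k. indicator I (V i \<omega>)) - real (N k) * measure \<mu> I\<bar> \<le> 3 * real k * s k"
      using good
    proof eventually_elim
      case (elim k)
      show ?case
      proof (intro allI impI)
        fix I :: "real set" assume I: "is_interval I" and Iv: "measure \<mu> I \<le> v k"
        have sk: "0 < s k" using elim by auto
        have L0: "0 < L k" using sk by (simp add: L_def)
        have Ls: "1 / real (L k) \<le> s k"
        proof -
          have "1 / s k \<le> real (L k)" unfolding L_def by linarith
          then show ?thesis using sk L0 by (simp add: field_simps)
        qed
        obtain i j i' j' where ij: "{i, j, i', j'} \<subseteq> {-1..int (L k)}"
          and sub: "cdf_cell \<mu> (L k) i j \<subseteq> I" "I \<subseteq> cdf_cell \<mu> (L k) i' j'"
          and me: "measure \<mu> I - 2 / real (L k) \<le> measure \<mu> (cdf_cell \<mu> (L k) i j)"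
                  "measure \<mu> (cdf_cell \<mu> (L k) i' j') \<le> measure \<mu> I + 2 / real (L k)"
          by (rule \<mu>.interval_cdf_cell_sandwich[OF mu(2) L0 I])
        have 2: "2 / real (L k) \<le> 2 * s k" using Ls by simp
        have "measure \<mu> (cdf_cell \<mu> (L k) i j) \<le> measure \<mu> I"
          using sub real_interval_borel_measurable[OF I] by (intro \<mu>.finite_measure_mono) auto
        then have inJ: "(i, j) \<in> J k" "(i', j') \<in> J k"
          using ij me 2 Iv sk by (auto simp: J_def)
        have notdev: "\<omega> \<notin> dev k (cdf_cell \<mu> (L k) i j)" "\<omega> \<notin> dev k (cdf_cell \<mu> (L k) i' j')"
          using elim(1) inJ by (auto simp: Bad_def)
        have "\<bar>(\<Sum>i<N k. indicator I (V i \<omega>)) - real (N k) * measure \<mu> I\<bar> \<le> real k * s k + real (N k) * (2 / real (L k))"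
          using notdev elim(1) by (intro count_near_of_sandwich[OF sub me]) (auto simp: dev_def)
        also have "\<dots> \<le> real k * s k + real k * (2 * s k)"
          using N[of k] 2 by (intro add_left_mono mult_mono) auto
        finally show "\<bar>(\<Sum>i<N k. indicator I (V i \<omega>)) - real (N k) * measure \<mu> I\<bar> \<le> 3 * real k * s k"
          by simp
      qed
    qed
  qed
qed

section \<open>Integrals and interval discrepancies\<close>

text \<open>The layer-cake formula. Levels stop at the bound \<open>B\<close>, so a uniform bound on
  the discrepancy of superlevel sets is integrated over a range of length \<open>B\<close>.\<close>

lemma (in finite_measure) nn_integral_superlevel:
  fixes \<phi> :: "'a \<Rightarrow> real"
  assumes [measurable]: "\<phi> \<in> borel_measurable M" and \<phi>: "\<And>x. x \<in> space M \<Longrightarrow> 0 \<le> \<phi> x" "\<And>x. x \<in> space M \<Longrightarrow> \<phi> x \<le> B"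
  shows "(\<integral>\<^sup>+x. ennreal (\<phi> x) \<partial>M) = (\<integral>\<^sup>+u. indicator {0..<B} u * ennreal (measure M {x \<in> space M. u < \<phi> x}) \<partial>lborel)"
proof -
  interpret P: pair_sigma_finite M lborel ..
  have "(\<integral>\<^sup>+x. ennreal (\<phi> x) \<partial>M) = (\<integral>\<^sup>+x. \<integral>\<^sup>+u. indicator {z. 0 \<le> snd z \<and> snd z < \<phi> (fst z)} (x, u) \<partial>lborel \<partial>M)"
  proof (rule nn_integral_cong)
    fix x assume x: "x \<in> space M"
    have "(\<integral>\<^sup>+u. indicator {z. 0 \<le> snd z \<and> snd z < \<phi> (fst z)} (x, u) \<partial>lborel) = (\<integral>\<^sup>+u. indicator {0..<\<phi> x} u \<partial>lborel)"
      by (intro nn_integral_cong) (auto simp: indicator_def)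
    also have "\<dots> = ennreal (\<phi> x)" using \<phi>(1)[OF x] by (simp add: emeasure_lborel_Ico)
    finally show "ennreal (\<phi> x) = (\<integral>\<^sup>+u. indicator {z. 0 \<le> snd z \<and> snd z < \<phi> (fst z)} (x, u) \<partial>lborel)" ..
  qed
  also have "\<dots> = (\<integral>\<^sup>+u. \<integral>\<^sup>+x. indicator {z \<in> space (M \<Otimes>\<^sub>M lborel). 0 \<le> snd z \<and> snd z < \<phi> (fst z)} (x, u) \<partial>M \<partial>lborel)"
    by (subst P.Fubini') (auto simp: space_pair_measure intro!: nn_integral_cong split: split_indicator)
  also have "\<dots> = (\<integral>\<^sup>+u. indicator {0..<B} u * ennreal (measure M {x \<in> space M. u < \<phi> x}) \<partial>lborel)"
  proof (rule nn_integral_cong)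
    fix u :: real
    have "(\<integral>\<^sup>+x. indicator {z \<in> space (M \<Otimes>\<^sub>M lborel). 0 \<le> snd z \<and> snd z < \<phi> (fst z)} (x, u) \<partial>M)
       = (\<integral>\<^sup>+x. indicator {0..<B} u * indicator {x \<in> space M. u < \<phi> x} x \<partial>M)"
      using \<phi> by (intro nn_integral_cong) (fastforce simp: space_pair_measure split: split_indicator)
    also have "\<dots> = indicator {0..<B} u * ennreal (measure M {x \<in> space M. u < \<phi> x})"
      by (subst nn_integral_cmult) (auto simp: emeasure_eq_measure)
    finally show "(\<integral>\<^sup>+x. indicator {z \<in> space (M \<Otimes>\<^sub>M lborel). 0 \<le> snd z \<and> snd z < \<phi> (fst z)} (x, u) \<partial>M)
       = indicator {0..<B} u * ennreal (measure M {x \<in> space M. u < \<phi> x})" .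
  qed
  finally show ?thesis .
qed

lemma (in finite_measure) integral_superlevel:
  fixes \<phi> :: "'a \<Rightarrow> real"
  assumes [measurable]: "\<phi> \<in> borel_measurable M" and \<phi>: "\<And>x. x \<in> space M \<Longrightarrow> 0 \<le> \<phi> x" "\<And>x. x \<in> space M \<Longrightarrow> \<phi> x \<le> B"
  shows "integrable lborel (\<lambda>u. indicator {0..<B} u * measure M {x \<in> space M. u < \<phi> x})"
    and "(\<integral>x. \<phi> x \<partial>M) = (\<integral>u. indicator {0..<B} u * measure M {x \<in> space M. u < \<phi> x} \<partial>lborel)"
proof -
  let ?h = "\<lambda>u. measure M {x \<in> space M. u < \<phi> x}"
  have "antimono ?h"
    by (intro antimonoI finite_measure_mono) auto
  then have [measurable]: "?h \<in> borel_measurable borel"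
    using borel_measurable_mono[of "\<lambda>u. - ?h u"] by (simp add: monotone_def)
  have eq: "(\<integral>\<^sup>+u. ennreal (indicator {0..<B} u * ?h u) \<partial>lborel) = (\<integral>\<^sup>+x. ennreal (\<phi> x) \<partial>M)"
    by (subst nn_integral_superlevel[OF assms]) (auto intro!: nn_integral_cong split: split_indicator)
  have "(\<integral>\<^sup>+x. ennreal (\<phi> x) \<partial>M) \<le> (\<integral>\<^sup>+x. ennreal B \<partial>M)"
    using \<phi> by (intro nn_integral_mono) (auto simp: ennreal_leI)
  also have "\<dots> < \<infinity>" by (simp add: emeasure_eq_measure ennreal_mult_less_top)
  finally have fin: "(\<integral>\<^sup>+x. ennreal (\<phi> x) \<partial>M) < \<infinity>" .
  show "integrable lborel (\<lambda>u. indicator {0..<B} u * ?h u)"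
    by (rule integrableI_nonneg) (use eq fin in auto)
  show "(\<integral>x. \<phi> x \<partial>M) = (\<integral>u. indicator {0..<B} u * ?h u \<partial>lborel)"
    using \<phi> by (subst (1 2) integral_eq_nn_integral) (auto simp: eq)
qed

lemma integral_diff_le_superlevel:
  fixes \<phi> :: "real \<Rightarrow> real"
  assumes fin: "finite_measure \<mu>" "finite_measure \<nu>" and sp: "space \<mu> = UNIV" "space \<nu> = UNIV"
    and meas: "\<phi> \<in> borel_measurable \<mu>" "\<phi> \<in> borel_measurable \<nu>"
    and \<phi>: "\<And>x. 0 \<le> \<phi> x" "\<And>x. \<phi> x \<le> B"
    and dev: "\<And>u. 0 \<le> u \<Longrightarrow> \<bar>measure \<mu> {x. u < \<phi> x} - measure \<nu> {x. u < \<phi> x}\<bar> \<le> D"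
  shows "\<bar>(\<integral>x. \<phi> x \<partial>\<mu>) - (\<integral>x. \<phi> x \<partial>\<nu>)\<bar> \<le> B * D"
proof -
  have B: "0 \<le> B" using \<phi> order.trans by blast
  note 1 = finite_measure.integral_superlevel[OF fin(1) meas(1), of B]
  note 2 = finite_measure.integral_superlevel[OF fin(2) meas(2), of B]
  have "\<bar>(\<integral>x. \<phi> x \<partial>\<mu>) - (\<integral>x. \<phi> x \<partial>\<nu>)\<bar>
    = norm (\<integral>u. indicator {0..<B} u * measure \<mu> {x. u < \<phi> x} - indicator {0..<B} u * measure \<nu> {x. u < \<phi> x} \<partial>lborel)"
    using 1 2 \<phi> sp by simp
  also have "\<dots> \<le> (\<integral>u. indicator {0..<B} u * D \<partial>lborel)"
  proof (rule order.trans[OF integral_norm_bound integral_mono])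
    have "integrable lborel (\<lambda>u. indicator {0..<B} u * measure \<mu> {x. u < \<phi> x} - indicator {0..<B} u * measure \<nu> {x. u < \<phi> x})"
      using 1(1) 2(1) \<phi> sp by (intro Bochner_Integration.integrable_diff) auto
    then show "integrable lborel (\<lambda>u. norm (indicator {0..<B} u * measure \<mu> {x. u < \<phi> x} - indicator {0..<B} u * measure \<nu> {x. u < \<phi> x}))"
      by (rule integrable_norm)
    show "integrable lborel (\<lambda>u. indicator {0..<B} u * D :: real)"
      by (intro integrable_mult_left integrable_real_indicator) (auto simp: emeasure_lborel_Ico[OF B])
    show "norm (indicator {0..<B} u * measure \<mu> {x. u < \<phi> x} - indicator {0..<B} u * measure \<nu> {x. u < \<phi> x}) \<le> indicator {0..<B} u * D" for u
      using dev[of u] by (auto split: split_indicator)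
  qed
  also have "\<dots> = B * D" using B by (simp add: measure_lborel_Ico)
  finally show ?thesis .
qed

text \<open>The weight \<open>w\<close> is 1 for the uncensored sample and \<open>1 - a k\<close>
  for the censored one. It stays inside the hypothesis because it may tend to 0.\<close>

corollary integral_diff_le_interval_discrepancy:
  fixes \<phi> :: "real \<Rightarrow> real"
  assumes fin: "finite_measure \<mu>" "finite_measure \<nu>" and sp: "space \<mu> = UNIV" "space \<nu> = UNIV"
    and meas: "\<phi> \<in> borel_measurable \<mu>" "\<phi> \<in> borel_measurable \<nu>"
    and \<phi>: "\<And>x. 0 \<le> \<phi> x" "\<And>x. \<phi> x \<le> B" "\<And>u. 0 \<le> u \<Longrightarrow> is_interval {x. u < \<phi> x}"
    and w: "0 \<le> w" and dev: "\<And>I. is_interval I \<Longrightarrow> w * \<bar>measure \<mu> I - measure \<nu> I\<bar> \<le> D"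
  shows "w * \<bar>(\<integral>x. \<phi> x \<partial>\<mu>) - (\<integral>x. \<phi> x \<partial>\<nu>)\<bar> \<le> B * D"
proof (cases "w = 0")
  case True
  have "0 \<le> B" using \<phi>(1,2) order.trans by blast
  moreover have "0 \<le> D" using dev[of "{}"] True by simp
  ultimately show ?thesis using True by simp
next
  case False
  then have w0: "0 < w" using w by simp
  have "\<bar>(\<integral>x. \<phi> x \<partial>\<mu>) - (\<integral>x. \<phi> x \<partial>\<nu>)\<bar> \<le> B * (D / w)"
    using dev w0 by (intro integral_diff_le_superlevel[OF fin sp meas \<phi>(1,2)])
      (auto simp: pos_le_divide_eq mult.commute \<phi>(3))
  then show ?thesis using w0 by (simp add: field_simps)
qed

text \<open>For a level \<open>u \<ge> 0\<close> the superlevel set lies inside \<open>T\<close>,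
  where monotonicity applies; at negative levels it would contain the complement of
  \<open>T\<close>.\<close>

lemma is_interval_superlevel_antimono:
  fixes \<psi> :: "real \<Rightarrow> real"
  assumes T: "is_interval T" and \<psi>: "\<And>x y. x \<in> T \<Longrightarrow> y \<in> T \<Longrightarrow> x \<le> y \<Longrightarrow> \<psi> y \<le> \<psi> x" and u: "0 \<le> u"
  shows "is_interval {x. u < indicator T x * \<psi> x}"
  unfolding is_interval_1
proof clarify
  fix a b x assume h: "u < indicator T a * \<psi> a" "u < indicator T b * \<psi> b" "a \<le> x" "x \<le> b"
  then have "a \<in> T" "b \<in> T" using u by (auto intro: ccontr)
  moreover from this have "x \<in> T" using T h(3,4) unfolding is_interval_1 by blast
  ultimately show "u < indicator T x * \<psi> x" using h \<psi>[of x b] by simp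
qed

lemma is_interval_superlevel_mono:
  fixes \<psi> :: "real \<Rightarrow> real"
  assumes T: "is_interval T" and \<psi>: "\<And>x y. x \<in> T \<Longrightarrow> y \<in> T \<Longrightarrow> x \<le> y \<Longrightarrow> \<psi> x \<le> \<psi> y" and u: "0 \<le> u"
  shows "is_interval {x. u < indicator T x * \<psi> x}"
  unfolding is_interval_1
proof clarify
  fix a b x assume h: "u < indicator T a * \<psi> a" "u < indicator T b * \<psi> b" "a \<le> x" "x \<le> b"
  then have "a \<in> T" "b \<in> T" using u by (auto intro: ccontr)
  moreover from this have "x \<in> T" using T h(3,4) unfolding is_interval_1 by blast
  ultimately show "u < indicator T x * \<psi> x" using h \<psi>[of a x] by simp
qed

section \<open>Uniform multiplicative censoring\<close>

definition inv_tail :: "real measure \<Rightarrow> real \<Rightarrow> real" where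
  "inv_tail \<mu> y = (LINT z:{y..}|\<mu>. 1 / z)"

lemma inv_tail_integrable:
  assumes s: "sets \<mu> = sets borel" and int: "integrable \<mu> (\<lambda>z. 1 / z :: real)"
  shows "integrable \<mu> (\<lambda>z. indicat_real {y..} z / z)"
  using integrable_mult_indicator[OF _ int, of "{y..}"] s by simp

lemma inv_tail_antimono:
  assumes [simp]: "sets \<mu> = sets borel" and int: "integrable \<mu> (\<lambda>z. 1 / z :: real)" and pos: "AE z in \<mu>. 0 < z" and le: "x \<le> y"
  shows "inv_tail \<mu> y \<le> inv_tail \<mu> x"
  unfolding inv_tail_def set_lebesgue_integral_def
  by (rule integral_mono_AE)
     (use pos le in \<open>auto intro!: inv_tail_integrable int elim!: eventually_mono split: split_indicator\<close>)

lemma inv_tail_nonneg: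
  assumes pos: "AE z in \<mu>. 0 < z"
  shows "0 \<le> inv_tail \<mu> y"
  unfolding inv_tail_def set_lebesgue_integral_def
  by (rule integral_nonneg_AE) (use pos in \<open>auto elim!: eventually_mono split: split_indicator\<close>)

lemma nn_integral_inv_tail_section:
  assumes [measurable_cong, simp]: "sets \<mu> = sets borel" and int: "integrable \<mu> (\<lambda>z. 1 / z :: real)" and pos: "AE z in \<mu>. 0 < z" and y: "0 \<le> y"
  shows "(\<integral>\<^sup>+z. indicator {0..z} y * ennreal (1 / z) \<partial>\<mu>) = ennreal (inv_tail \<mu> y)"
proof -
  have "(\<integral>\<^sup>+z. indicator {0..z} y * ennreal (1 / z) \<partial>\<mu>) = (\<integral>\<^sup>+z. ennreal (indicator {y..} z *\<^sub>R (1 / z)) \<partial>\<mu>)"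
    using y by (intro nn_integral_cong) (auto split: split_indicator)
  also have "\<dots> = ennreal (inv_tail \<mu> y)"
    unfolding inv_tail_def set_lebesgue_integral_def
    by (rule nn_integral_eq_integral)
       (use pos in \<open>auto intro!: inv_tail_integrable int elim!: eventually_mono split: split_indicator\<close>)
  finally show ?thesis .
qed

text \<open>Given \<open>Z = z\<close> the product is uniform on \<open>{0..z}\<close>, with density
  \<open>1 / z\<close>. Averaging over \<open>z\<close> and exchanging the integrals leaves at
  \<open>y\<close> the integral of \<open>1 / z\<close> over \<open>z \<ge> y\<close>.\<close>

lemma (in prob_space) distr_uniform_times:
  fixes U Z :: "'a \<Rightarrow> real"
  assumes ind: "indep_var borel U borel Z"
    and U: "distr M borel U = uniform_measure lborel {0..1}"
    and Z: "distr M borel Z = \<mu>" and int: "integrable \<mu> (\<lambda>z. 1 / z)" and pos: "AE z in \<mu>. 0 < z"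
  shows "distr M borel (\<lambda>\<omega>. U \<omega> * Z \<omega>) = density lborel (\<lambda>y. ennreal (indicator {0..} y * inv_tail \<mu> y))"
proof (rule measure_eqI)
  have [measurable]: "U \<in> borel_measurable M" "Z \<in> borel_measurable M"
    using indep_var_rv1[OF ind] indep_var_rv2[OF ind] by auto
  have s[measurable_cong, simp]: "sets \<mu> = sets borel" using Z by auto
  have anti: "antimono (inv_tail \<mu>)" by (intro antimonoI inv_tail_antimono s int pos)
  have [measurable]: "inv_tail \<mu> \<in> borel_measurable borel"
    using borel_measurable_mono[of "\<lambda>u. - inv_tail \<mu> u"] anti by (simp add: monotone_def)
  have spmu: "space \<mu> = UNIV" using sets_eq_imp_space_eq[OF s] by simp
  interpret \<mu>: prob_space \<mu> unfolding Z[symmetric] by (rule prob_space_distr) simp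
  interpret W: prob_space "uniform_measure lborel {0..1::real}"
    by (rule prob_space_uniform_measure) auto
  interpret P: pair_sigma_finite "uniform_measure lborel {0..1::real}" \<mu> ..
  interpret P2: pair_sigma_finite \<mu> "lborel :: real measure" ..
  fix A assume A': "A \<in> sets (distr M borel (\<lambda>\<omega>. U \<omega> * Z \<omega>))"
  then have A[measurable]: "A \<in> sets borel" by simp
  have "emeasure (distr M borel (\<lambda>\<omega>. U \<omega> * Z \<omega>)) A = (\<integral>\<^sup>+\<omega>. indicator A (U \<omega> * Z \<omega>) \<partial>M)"
    by (simp add: nn_integral_indicator[symmetric] nn_integral_distr del: nn_integral_indicator)
  also have "\<dots> = (\<integral>\<^sup>+x. indicator A (fst x * snd x) \<partial>distr M (borel \<Otimes>\<^sub>M borel) (\<lambda>\<omega>. (U \<omega>, Z \<omega>)))"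
    by (subst nn_integral_distr) auto
  also have "distr M (borel \<Otimes>\<^sub>M borel) (\<lambda>\<omega>. (U \<omega>, Z \<omega>)) = uniform_measure lborel {0..1} \<Otimes>\<^sub>M \<mu>"
    using ind U Z by (simp add: indep_var_distribution_eq)
  also have "(\<integral>\<^sup>+x. indicator A (fst x * snd x) \<partial>(uniform_measure lborel {0..1} \<Otimes>\<^sub>M \<mu>))
     = (\<integral>\<^sup>+z. \<integral>\<^sup>+u. indicator A (u * z) \<partial>uniform_measure lborel {0..1} \<partial>\<mu>)"
    by (subst P.nn_integral_snd[symmetric]) auto
  also have "\<dots> = (\<integral>\<^sup>+z. \<integral>\<^sup>+y. indicator A y * (indicator {0..z} y * ennreal (1 / z)) \<partial>lborel \<partial>\<mu>)"
  proof (rule nn_integral_cong_AE, use pos in eventually_elim)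
    fix z :: real assume z: "0 < z"
    have "(\<integral>\<^sup>+u. indicator A (u * z) \<partial>uniform_measure lborel {0..1}) = (\<integral>\<^sup>+u. indicator A (u * z) * indicator {0..1} u \<partial>lborel)"
      by (subst nn_integral_uniform_measure) (auto simp: divide_ennreal_def)
    also have "\<dots> = ennreal (1 / z) * (ennreal \<bar>z\<bar> * (\<integral>\<^sup>+u. indicator A (0 + z * u) * indicator {0..z} (0 + z * u) \<partial>lborel))"
    proof -
      have "(\<integral>\<^sup>+u. indicator A (u * z) * indicator {0..1} u \<partial>lborel) = (\<integral>\<^sup>+u. indicator A (0 + z * u) * indicator {0..z} (0 + z * u) \<partial>lborel)"
        using z by (intro nn_integral_cong) (auto simp: mult.commute zero_le_mult_iff split: split_indicator)
      moreover have "ennreal (1 / z) * ennreal \<bar>z\<bar> = 1" using z by (simp add: ennreal_mult[symmetric])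
      ultimately show ?thesis by (simp add: mult.assoc[symmetric])
    qed
    also have "ennreal \<bar>z\<bar> * (\<integral>\<^sup>+u. indicator A (0 + z * u) * indicator {0..z} (0 + z * u) \<partial>lborel) = (\<integral>\<^sup>+y. indicator A y * indicator {0..z} y \<partial>lborel)"
      using z by (subst nn_integral_real_affine[where c = z and t = 0]) auto
    also have "ennreal (1 / z) * \<dots> = (\<integral>\<^sup>+y. indicator A y * (indicator {0..z} y * ennreal (1 / z)) \<partial>lborel)"
      by (subst nn_integral_cmult[symmetric]) (auto simp: mult_ac)
    finally show "(\<integral>\<^sup>+u. indicator A (u * z) \<partial>uniform_measure lborel {0..1}) = (\<integral>\<^sup>+y. indicator A y * (indicator {0..z} y * ennreal (1 / z)) \<partial>lborel)" .
  qed
  also have "\<dots> = (\<integral>\<^sup>+y. \<integral>\<^sup>+z. indicator A y * (indicator {0..z} y * ennreal (1 / z)) \<partial>\<mu> \<partial>lborel)"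
  proof -
    \<comment> \<open>The moving interval \<open>{0..z}\<close> is rewritten as a fixed set of
      pairs, for which joint measurability can be derived.\<close>
    have "(\<lambda>x. indicator A (snd x) * (indicator {x. 0 \<le> snd x \<and> snd x \<le> fst x} x * ennreal (1 / fst x))) \<in> borel_measurable (\<mu> \<Otimes>\<^sub>M lborel)"
      by (subst measurable_cong_sets[OF sets_pair_measure_cong[OF s sets_lborel] refl]) measurable
    then have m: "(\<lambda>(z, y). indicator A y * (indicator {0..z} y * ennreal (1 / z))) \<in> borel_measurable (\<mu> \<Otimes>\<^sub>M lborel)"
      by (rule measurable_cong[THEN iffD1, rotated]) (auto split: split_indicator)
    show ?thesis using P2.Fubini'[OF m] by simp
  qed
  also have "\<dots> = (\<integral>\<^sup>+y. ennreal (indicator {0..} y * inv_tail \<mu> y) * indicator A y \<partial>lborel)"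
  proof (rule nn_integral_cong)
    fix y :: real
    have "(\<integral>\<^sup>+z. indicator A y * (indicator {0..z} y * ennreal (1 / z)) \<partial>\<mu>) = indicator A y * (\<integral>\<^sup>+z. indicator {0..z} y * ennreal (1 / z) \<partial>\<mu>)"
    proof (rule nn_integral_cmult)
      have "(\<lambda>z. indicator {z. 0 \<le> y \<and> y \<le> z} z * ennreal (1 / z)) \<in> borel_measurable \<mu>" by measurable
      then show "(\<lambda>z. indicator {0..z} y * ennreal (1 / z)) \<in> borel_measurable \<mu>"
        by (rule measurable_cong[THEN iffD1, rotated]) (auto split: split_indicator)
    qed
    also have "\<dots> = ennreal (indicator {0..} y * inv_tail \<mu> y) * indicator A y"
      using nn_integral_inv_tail_section[OF s int pos, of y]
      by (cases "0 \<le> y") (auto simp: mult.commute split: split_indicator)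
    finally show "(\<integral>\<^sup>+z. indicator A y * (indicator {0..z} y * ennreal (1 / z)) \<partial>\<mu>) = ennreal (indicator {0..} y * inv_tail \<mu> y) * indicator A y" .
  qed
  also have "\<dots> = emeasure (density lborel (\<lambda>y. ennreal (indicator {0..} y * inv_tail \<mu> y))) A"
    by (simp add: emeasure_density)
  finally show "emeasure (distr M borel (\<lambda>\<omega>. U \<omega> * Z \<omega>)) A = emeasure (density lborel (\<lambda>y. ennreal (indicator {0..} y * inv_tail \<mu> y))) A" .
qed simp

section \<open>The score equation\<close>

lemma set_integral_pmf_finite:
  fixes f :: "real \<Rightarrow> real"
  assumes "finite (set_pmf P)"
  shows "(LINT z:B|measure_pmf P. f z) = (\<Sum>z\<in>set_pmf P. indicator B z * f z * pmf P z)"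
  unfolding set_lebesgue_integral_def
  by (subst integral_measure_pmf_real[OF assms]) (auto simp: set_pmf_iff)

lemma integral_pmf_finite:
  fixes f :: "real \<Rightarrow> real"
  assumes "finite (set_pmf P)"
  shows "(\<integral>z. f z \<partial>measure_pmf P) = (\<Sum>z\<in>set_pmf P. f z * pmf P z)"
  by (subst integral_measure_pmf_real[OF assms]) (auto simp: set_pmf_iff)

text \<open>One fixed sample at one fixed size, so every integral against \<open>E\<close>,
  \<open>F\<close> or \<open>P\<close> is a finite sum. \<open>P\<close> may also charge censored
  observations, that is, points outside the support of \<open>E\<close>. The bound
  \<open>Pge\<close> is the truncation of the estimator.\<close>

locale score_equation =
  fixes E F P :: "real pmf" and a \<gamma> :: real
  assumes finE: "finite (set_pmf E)" and finF: "finite (set_pmf F)" and finP: "finite (set_pmf P)"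
    and Epos: "\<And>t. t \<in> set_pmf E \<Longrightarrow> 0 < t"
    and a: "0 < a" "a \<le> 1" and \<gamma>: "0 < \<gamma>"
    and Pge: "\<And>t. t \<in> set_pmf P \<Longrightarrow> \<gamma> \<le> t"
    and score: "\<And>t. 0 \<le> t \<Longrightarrow> pmf P t = a * pmf E t
      + (1 - a) * (LINT v:{0<..t}|measure_pmf F. 1 / inv_tail (measure_pmf P) v) * (1 / t) * pmf P t"
begin

abbreviation "S \<equiv> inv_tail (measure_pmf P)"
abbreviation "SE \<equiv> inv_tail (measure_pmf E)"

definition A :: "real \<Rightarrow> real" where
  "A t = (1 - a) * (LINT v:{0<..t}|measure_pmf F. 1 / S v)"

text \<open>The chi-square distance of \<open>E\<close> from \<open>P\<close> when \<open>P\<close> is restricted to the support of \<open>E\<close>.\<close>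
definition \<kappa> :: real where
  "\<kappa> = (\<Sum>t\<in>set_pmf E. (pmf E t)\<^sup>2 / pmf P t) - 1"

lemma Ppos: "t \<in> set_pmf P \<Longrightarrow> 0 < t"
  using Pge \<gamma> by force

lemma S_eq: "S y = (\<Sum>z\<in>set_pmf P. indicator {y..} z * (1 / z) * pmf P z)"
  unfolding inv_tail_def by (rule set_integral_pmf_finite[OF finP])

lemma SE_eq: "SE y = (\<Sum>z\<in>set_pmf E. indicator {y..} z * (1 / z) * pmf E z)"
  unfolding inv_tail_def by (rule set_integral_pmf_finite[OF finE])

lemma S_nonneg: "0 \<le> S y"
  unfolding S_eq using Ppos by (intro sum_nonneg) (auto split: split_indicator intro!: mult_nonneg_nonneg divide_nonneg_pos)

lemma SE_nonneg: "0 \<le> SE y"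
  unfolding SE_eq using Epos by (intro sum_nonneg) (auto split: split_indicator intro!: mult_nonneg_nonneg divide_nonneg_pos)

lemma S_antimono: "x \<le> y \<Longrightarrow> S y \<le> S x"
  unfolding S_eq using Ppos by (intro sum_mono mult_right_mono) (auto split: split_indicator dest: less_imp_le)

lemma S_le: "S y \<le> 1 / \<gamma>"
proof -
  have "S y \<le> (\<Sum>z\<in>set_pmf P. (1 / \<gamma>) * pmf P z)"
    unfolding S_eq using Ppos Pge \<gamma>
    by (intro sum_mono mult_right_mono) (auto split: split_indicator intro!: divide_left_mono)
  also have "\<dots> = 1 / \<gamma>"
    using sum_pmf_eq_1[OF finP subset_refl] by (simp add: sum_divide_distrib[symmetric])
  finally show ?thesis .
qed

lemma A_eq: "A t = (1 - a) * (\<Sum>v\<in>set_pmf F. indicator {0<..t} v * (1 / S v) * pmf F v)"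
  unfolding A_def by (subst set_integral_pmf_finite[OF finF]) simp

lemma score_A: "0 < t \<Longrightarrow> pmf P t * (1 - A t / t) = a * pmf E t"
  using score[of t] by (simp add: A_def algebra_simps diff_divide_distrib)

text \<open>The right-hand side \<open>a * pmf E t\<close> is positive, hence so is
  \<open>pmf P t\<close>. Uncensored observations therefore all lie at or above
  \<open>\<gamma>\<close>, and cutting integrals against \<open>E\<close> at \<open>\<gamma>\<close>
  changes nothing.\<close>

lemma score_on_E:
  assumes "t \<in> set_pmf E"
  shows "\<gamma> \<le> t" "0 < pmf P t"
proof -
  have t: "0 < t" using assms by (rule Epos)
  have "0 < pmf P t * (1 - A t / t)" using score_A[OF t] a assms by (simp add: pmf_positive)
  then show "0 < pmf P t" using pmf_nonneg[of P t] by (auto simp: zero_less_mult_iff)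
  then show "\<gamma> \<le> t" by (intro Pge) (simp add: set_pmf_iff)
qed

text \<open>Multiply \<open>score_A\<close> by \<open>pmf E t / pmf P t\<close> and sum over the
  support of \<open>E\<close>. Exchanging the sums in the term with \<open>A\<close> collects the
  weights \<open>pmf E t / t\<close> over \<open>t \<ge> v\<close>, which add up to
  \<open>SE v\<close>.\<close>

lemma averaged_score:
  "a * (1 + \<kappa>) + (1 - a) * (LINT v:{0<..}|measure_pmf F. SE v / S v) = 1"
proof -
  have "a * ((pmf E t)\<^sup>2 / pmf P t) = pmf E t - pmf E t * (A t / t)" if t: "t \<in> set_pmf E" for t
  proof -
    have "a * (pmf E t)\<^sup>2 = pmf E t * (pmf P t * (1 - A t / t))"
      using score_A[OF Epos[OF t]] by (simp add: power2_eq_square mult_ac)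
    then show ?thesis using score_on_E(2)[OF t] by (simp add: field_simps)
  qed
  then have "a * (1 + \<kappa>) = (\<Sum>t\<in>set_pmf E. pmf E t - pmf E t * (A t / t))"
    by (simp add: \<kappa>_def sum_distrib_left)
  also have "\<dots> = 1 - (\<Sum>t\<in>set_pmf E. pmf E t * (A t / t))"
    using sum_pmf_eq_1[OF finE subset_refl] by (simp add: sum_subtractf)
  also have "(\<Sum>t\<in>set_pmf E. pmf E t * (A t / t)) = (1 - a) * (LINT v:{0<..}|measure_pmf F. SE v / S v)"
  proof -
    have "(\<Sum>t\<in>set_pmf E. pmf E t * (A t / t)) =
      (1 - a) * (\<Sum>t\<in>set_pmf E. \<Sum>v\<in>set_pmf F. pmf E t / t * (indicator {0<..t} v * (1 / S v) * pmf F v))"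
      by (simp add: A_eq sum_distrib_left sum_divide_distrib mult_ac)
    also have "(\<Sum>t\<in>set_pmf E. \<Sum>v\<in>set_pmf F. pmf E t / t * (indicator {0<..t} v * (1 / S v) * pmf F v))
      = (\<Sum>v\<in>set_pmf F. \<Sum>t\<in>set_pmf E. pmf E t / t * (indicator {0<..t} v * (1 / S v) * pmf F v))"
      by (rule sum.swap)
    also have "\<dots> = (\<Sum>v\<in>set_pmf F. indicator {0<..} v * (SE v / S v) * pmf F v)"
    proof (rule sum.cong[OF refl])
      fix v
      have "pmf E t / t * (indicator {0<..t} v * (1 / S v) * pmf F v) =
        indicator {v..} t * (1 / t) * pmf E t * (indicator {0<..} v * (1 / S v) * pmf F v)" for t
        by (auto split: split_indicator)
      then have "(\<Sum>t\<in>set_pmf E. pmf E t / t * (indicator {0<..t} v * (1 / S v) * pmf F v))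
        = SE v * (indicator {0<..} v * (1 / S v) * pmf F v)"
        by (simp only: SE_eq sum_distrib_right)
      then show "(\<Sum>t\<in>set_pmf E. pmf E t / t * (indicator {0<..t} v * (1 / S v) * pmf F v)) = indicator {0<..} v * (SE v / S v) * pmf F v"
        by simp
    qed
    also have "\<dots> = (LINT v:{0<..}|measure_pmf F. SE v / S v)"
      by (simp add: set_integral_pmf_finite[OF finF])
    finally show ?thesis .
  qed
  finally show ?thesis by simp
qed

lemma sum_E_P_le: "(\<Sum>t\<in>set_pmf E. pmf P t) \<le> 1"
  by (subst measure_measure_pmf_finite[OF finE, symmetric]) simp

text \<open>Chi-square closeness implies closeness in total variation. The support of
  \<open>E\<close> contributes \<theta>. Since both laws have mass 1, what \<open>P\<close> places
  outside that support equals what it lacks on it, which contributes another \<theta>.\<close>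

lemma integral_P_near_E:
  assumes \<theta>: "0 < \<theta>" "\<kappa> \<le> \<theta>\<^sup>2" and \<phi>: "\<And>x. 0 \<le> \<phi> x" "\<And>x. \<phi> x \<le> (B::real)"
  shows "\<bar>(\<integral>x. \<phi> x \<partial>measure_pmf P) - (\<integral>x. \<phi> x \<partial>measure_pmf E)\<bar> \<le> 2 * \<theta> * B"
proof -
  have B: "0 \<le> B" using \<phi> order.trans by blast
  have tv: "(\<Sum>t\<in>set_pmf E. \<bar>pmf P t - pmf E t\<bar>) \<le> \<theta>"
  proof -
    \<comment> \<open>The inequality
      \<open>d \<le> \<theta> / 2 * q + d^2 / (2 * \<theta> * q)\<close> with
      \<open>q = pmf P t\<close>. In the sum the squares combine to at most \<kappa>, because
      \<open>P\<close> has at most mass 1 on the support of \<open>E\<close>. A free positive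
      \<theta> avoids square roots and a case distinction at \<kappa> = 0.\<close>
    have "\<bar>pmf P t - pmf E t\<bar> \<le> \<theta> / 2 * pmf P t + ((pmf E t)\<^sup>2 / pmf P t - 2 * pmf E t + pmf P t) / (2 * \<theta>)"
      if "t \<in> set_pmf E" for t
    proof -
      let ?d = "\<bar>pmf P t - pmf E t\<bar>" and ?p = "pmf P t"
      have p: "0 < ?p" using score_on_E(2)[OF that] .
      have "0 \<le> (?d - \<theta> * ?p)\<^sup>2 / (2 * \<theta> * ?p)" using p \<theta> by simp
      also have "\<dots> = ?d\<^sup>2 / (2 * \<theta> * ?p) + \<theta> / 2 * ?p - ?d"
        using p \<theta> by (simp add: field_simps power2_eq_square)
      also have "?d\<^sup>2 / (2 * \<theta> * ?p) = ((pmf E t)\<^sup>2 / ?p - 2 * pmf E t + ?p) / (2 * \<theta>)"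
        using p \<theta> by (simp add: field_simps power2_eq_square)
      finally show ?thesis by simp
    qed
    then have "(\<Sum>t\<in>set_pmf E. \<bar>pmf P t - pmf E t\<bar>) \<le>
      (\<Sum>t\<in>set_pmf E. \<theta> / 2 * pmf P t + ((pmf E t)\<^sup>2 / pmf P t - 2 * pmf E t + pmf P t) / (2 * \<theta>))"
      by (rule sum_mono)
    also have "\<dots> = \<theta> / 2 * (\<Sum>t\<in>set_pmf E. pmf P t) + ((1 + \<kappa>) - 2 + (\<Sum>t\<in>set_pmf E. pmf P t)) / (2 * \<theta>)"
      using sum_pmf_eq_1[OF finE subset_refl]
      by (simp add: \<kappa>_def sum.distrib sum_subtractf sum_distrib_left[symmetric] sum_divide_distrib[symmetric])
    also have "\<dots> \<le> \<theta> / 2 * 1 + \<theta>\<^sup>2 / (2 * \<theta>)"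
      using \<theta> sum_E_P_le by (intro add_mono mult_left_mono divide_right_mono) auto
    also have "\<dots> = \<theta>" using \<theta> by (simp add: power2_eq_square)
    finally show ?thesis .
  qed
  have subE: "set_pmf E \<subseteq> set_pmf P" using score_on_E(2) by (fastforce simp: set_pmf_iff)
  have "(\<Sum>t\<in>set_pmf P. pmf P t) = (\<Sum>t\<in>set_pmf E. pmf P t) + (\<Sum>t\<in>set_pmf P - set_pmf E. pmf P t)"
    using sum.subset_diff[OF subE finP, of "pmf P"] by simp
  then have "(\<Sum>t\<in>set_pmf P - set_pmf E. pmf P t) = (\<Sum>t\<in>set_pmf E. pmf E t - pmf P t)"
    using sum_pmf_eq_1[OF finE subset_refl] sum_pmf_eq_1[OF finP subset_refl] by (simp add: sum_subtractf)
  also have "\<dots> \<le> (\<Sum>t\<in>set_pmf E. \<bar>pmf P t - pmf E t\<bar>)" by (intro sum_mono) auto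
  finally have out: "(\<Sum>t\<in>set_pmf P - set_pmf E. pmf P t) \<le> \<theta>" using tv by simp
  have "(\<integral>x. \<phi> x \<partial>measure_pmf P) - (\<integral>x. \<phi> x \<partial>measure_pmf E)
     = (\<Sum>t\<in>set_pmf E. \<phi> t * (pmf P t - pmf E t)) + (\<Sum>t\<in>set_pmf P - set_pmf E. \<phi> t * pmf P t)"
    using sum.subset_diff[OF subE finP, of "\<lambda>t. \<phi> t * pmf P t"]
    by (simp add: integral_pmf_finite[OF finP] integral_pmf_finite[OF finE] sum_subtractf right_diff_distrib)
  then have "\<bar>(\<integral>x. \<phi> x \<partial>measure_pmf P) - (\<integral>x. \<phi> x \<partial>measure_pmf E)\<bar>
     \<le> \<bar>\<Sum>t\<in>set_pmf E. \<phi> t * (pmf P t - pmf E t)\<bar> + \<bar>\<Sum>t\<in>set_pmf P - set_pmf E. \<phi> t * pmf P t\<bar>"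
    by simp
  also have "\<bar>\<Sum>t\<in>set_pmf E. \<phi> t * (pmf P t - pmf E t)\<bar> \<le> (\<Sum>t\<in>set_pmf E. B * \<bar>pmf P t - pmf E t\<bar>)"
    using \<phi> by (intro order.trans[OF sum_abs] sum_mono) (auto simp: abs_mult intro!: mult_right_mono)
  also have "\<dots> \<le> B * \<theta>" using tv B by (simp add: sum_distrib_left[symmetric] mult_left_mono)
  also have "\<bar>\<Sum>t\<in>set_pmf P - set_pmf E. \<phi> t * pmf P t\<bar> \<le> (\<Sum>t\<in>set_pmf P - set_pmf E. B * pmf P t)"
    using \<phi> by (intro order.trans[OF sum_abs] sum_mono) (auto simp: abs_mult intro!: mult_right_mono)
  also have "\<dots> \<le> B * \<theta>" using out B by (simp add: sum_distrib_left[symmetric] mult_left_mono)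
  finally show ?thesis by (simp add: mult_ac)
qed

text \<open>On the half-line \<open>S\<close> is the density of a uniform variable times an
  independent one with law \<open>P\<close>: each atom \<open>z\<close> contributes
  \<open>pmf P z / z\<close> over a length \<open>z\<close>.\<close>

lemma nn_integral_S_le: "(\<integral>\<^sup>+y. indicator {0..} y * ennreal (S y) \<partial>lborel) \<le> 1"
proof -
  have "(\<integral>\<^sup>+y. indicator {0..} y * ennreal (S y) \<partial>lborel) =
     (\<integral>\<^sup>+y. (\<Sum>z\<in>set_pmf P. ennreal (pmf P z / z) * indicator {0..z} y) \<partial>lborel)"
  proof (rule nn_integral_cong)
    fix y :: real
    have "indicator {0..} y * ennreal (S y) = ennreal (\<Sum>z\<in>set_pmf P. pmf P z / z * indicator {0..z} y)"
      by (cases "0 \<le> y") (auto simp: S_eq intro!: arg_cong[where f = ennreal] sum.cong split: split_indicator)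
    also have "\<dots> = (\<Sum>z\<in>set_pmf P. ennreal (pmf P z / z) * indicator {0..z} y)"
    proof (subst sum_ennreal[symmetric])
      show "0 \<le> pmf P z / z * indicator {0..z} y" if "z \<in> set_pmf P" for z
        using Ppos[OF that] by simp
      show "(\<Sum>z\<in>set_pmf P. ennreal (pmf P z / z * indicator {0..z} y)) = (\<Sum>z\<in>set_pmf P. ennreal (pmf P z / z) * indicator {0..z} y)"
        by (intro sum.cong refl) (auto split: split_indicator)
    qed
    finally show "indicator {0..} y * ennreal (S y) = (\<Sum>z\<in>set_pmf P. ennreal (pmf P z / z) * indicator {0..z} y)" .
  qed
  also have "\<dots> = (\<Sum>z\<in>set_pmf P. ennreal (pmf P z / z) * ennreal z)"
    using Ppos by (subst nn_integral_sum)
      (auto simp: nn_integral_cmult_indicator less_imp_le intro!: sum.cong)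
  also have "\<dots> = (\<Sum>z\<in>set_pmf P. ennreal (pmf P z))"
    using Ppos by (intro sum.cong refl) (force simp: ennreal_mult[symmetric])
  also have "\<dots> = 1" using sum_pmf_eq_1[OF finP subset_refl] by simp
  finally show ?thesis by simp
qed

end

section \<open>Consistency of the estimator\<close>

text \<open>A fixed sample path along which the sizes grow. Discrepancies are required to be of
  smaller order than \<open>\<gamma>\<close> because the integrands reach the order
  \<open>1 / \<gamma>\<close>.\<close>

locale censoring_limit =
  fixes Q FL :: "real measure" and \<tau> p :: real
    and E F P :: "nat \<Rightarrow> real pmf" and a \<gamma> :: "nat \<Rightarrow> real"
  assumes Q: "real_distribution Q" and intQ: "integrable Q (\<lambda>z. 1 / z)" and posQ: "AE z in Q. 0 < z"
    and FL: "FL = density lborel (\<lambda>y. ennreal (indicator {0..} y * inv_tail Q y))"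
    and FLprob: "prob_space FL"
    and f_pos: "\<And>c. c < \<tau> \<Longrightarrow> 0 < inv_tail Q c"
    and FL_exhaust: "\<And>\<rho>. \<rho> < 1 \<Longrightarrow> \<exists>c. 0 < c \<and> c < \<tau> \<and> \<rho> < measure FL {0<..c}"
    and \<tau>: "0 < \<tau>"
    and score: "\<forall>\<^sub>F k in sequentially. score_equation (E k) (F k) (P k) (a k) (\<gamma> k)"
    and a: "a \<longlonglongrightarrow> p" and p: "0 < p" and \<gamma>: "\<gamma> \<longlonglongrightarrow> 0"
    and devE: "\<And>\<delta>. 0 < \<delta> \<Longrightarrow> \<forall>\<^sub>F k in sequentially. \<forall>I. is_interval I \<longrightarrow>
        \<bar>measure (measure_pmf (E k)) I - measure Q I\<bar> \<le> \<delta> * \<gamma> k"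
    and devF: "\<And>\<delta>. 0 < \<delta> \<Longrightarrow> \<forall>\<^sub>F k in sequentially. \<forall>I. is_interval I \<longrightarrow>
        (1 - a k) * \<bar>measure (measure_pmf (F k)) I - measure FL I\<bar> \<le> \<delta> * \<gamma> k"
begin

sublocale Q: real_distribution Q by (rule Q)
sublocale FL: prob_space FL by (rule FLprob)

abbreviation "f \<equiv> inv_tail Q"
abbreviation "S k \<equiv> inv_tail (measure_pmf (P k))"
abbreviation "SE k \<equiv> inv_tail (measure_pmf (E k))"

lemma f_antimono: "x \<le> y \<Longrightarrow> f y \<le> f x"
  by (rule inv_tail_antimono) (auto intro: intQ posQ)

lemma f_nonneg: "0 \<le> f y"
  by (rule inv_tail_nonneg[OF posQ])

lemma f_measurable[measurable]: "f \<in> borel_measurable borel"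
  using borel_measurable_mono[of "\<lambda>u. - f u"] f_antimono by (simp add: monotone_def)

lemma sets_FL[measurable_cong, simp]: "sets FL = sets borel" by (simp add: FL)
lemma space_FL[simp]: "space FL = UNIV" by (simp add: FL)

lemma f_near_0:
  assumes "0 < \<epsilon>" obtains \<delta> where "0 < \<delta>" "f 0 - f \<delta> < \<epsilon>"
proof -
  have "(\<lambda>n. \<integral>z. indicator {1 / real (Suc n)..} z *\<^sub>R (1 / z) \<partial>Q) \<longlonglongrightarrow> (\<integral>z. indicator {0..} z *\<^sub>R (1 / z) \<partial>Q)"
  proof (rule integral_dominated_convergence[where w = "\<lambda>z. norm (1 / z)"])
    show "AE z in Q. (\<lambda>n. indicator {1 / real (Suc n)..} z *\<^sub>R (1 / z)) \<longlonglongrightarrow> indicator {0..} z *\<^sub>R (1 / z)"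
      using posQ
    proof eventually_elim
      case (elim z)
      have "(\<lambda>n. 1 / real (Suc n)) \<longlonglongrightarrow> 0" by (rule LIMSEQ_Suc[OF lim_1_over_n])
      then have "\<forall>\<^sub>F n in sequentially. 1 / real (Suc n) < z" using elim by (rule order_tendstoD)
      then have "\<forall>\<^sub>F n in sequentially. indicator {1 / real (Suc n)..} z *\<^sub>R (1 / z) = indicator {0..} z *\<^sub>R (1 / z)"
        by eventually_elim (use elim in \<open>auto split: split_indicator\<close>)
      then show ?case by (rule tendsto_eventually)
    qed
    show "integrable Q (\<lambda>z. norm (1 / z))" using intQ by (rule integrable_norm)
  qed (auto split: split_indicator)
  then have "(\<lambda>n. f (1 / real (Suc n))) \<longlonglongrightarrow> f 0" by (simp add: inv_tail_def set_lebesgue_integral_def)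
  then have "\<forall>\<^sub>F n in sequentially. f 0 - \<epsilon> < f (1 / real (Suc n))"
    using assms by (intro order_tendstoD) auto
  then obtain n where "f 0 - \<epsilon> < f (1 / real (Suc n))" by (auto simp: eventually_sequentially)
  then show ?thesis by (intro that[of "1 / real (Suc n)"]) auto
qed

lemma f_pos_le: "y \<le> c \<Longrightarrow> c < \<tau> \<Longrightarrow> 0 < f y"
  using f_pos[of y] by simp

text \<open>Dividing by \<open>f\<close> undoes the density of \<open>FL\<close> and leaves Lebesgue
  measure; \<open>c < \<tau>\<close> keeps \<open>f\<close> positive on the range of
  integration.\<close>

lemma nn_integral_FL_div_f:
  fixes \<psi> :: "real \<Rightarrow> real"
  assumes c: "c < \<tau>" and [measurable]: "\<psi> \<in> borel_measurable borel" and \<psi>: "\<And>v. 0 \<le> \<psi> v"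
  shows "(\<integral>\<^sup>+v. ennreal (indicator {0<..c} v * (\<psi> v / f v)) \<partial>FL) = (\<integral>\<^sup>+v. indicator {0<..c} v * ennreal (\<psi> v) \<partial>lborel)"
  unfolding FL
proof (subst nn_integral_density)
  show "(\<integral>\<^sup>+v. ennreal (indicator {0..} v * f v) * ennreal (indicator {0<..c} v * (\<psi> v / f v)) \<partial>lborel) =
    (\<integral>\<^sup>+v. indicator {0<..c} v * ennreal (\<psi> v) \<partial>lborel)"
  proof (rule nn_integral_cong)
    fix v :: real
    show "ennreal (indicator {0..} v * f v) * ennreal (indicator {0<..c} v * (\<psi> v / f v)) = indicator {0<..c} v * ennreal (\<psi> v)"
    proof (cases "v \<in> {0<..c}")
      case True
      then have "0 < f v" using c by (auto intro: f_pos_le)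
      then show ?thesis using True \<psi>[of v] by (simp add: ennreal_mult[symmetric])
    qed simp
  qed
qed auto

lemma integral_FL_div_f:
  assumes c: "c < \<tau>" and t: "0 \<le> t" "t \<le> c"
  shows "(\<integral>v. indicator {0<..t} v * (1 / f v) \<partial>FL) = t"
proof -
  have "(\<integral>\<^sup>+v. ennreal (indicator {0<..t} v * (1 / f v)) \<partial>FL) = (\<integral>\<^sup>+v. indicator {0<..t} v * ennreal 1 \<partial>lborel)"
    using c t by (intro nn_integral_FL_div_f) auto
  also have "\<dots> = ennreal t" using t by simp
  finally show ?thesis
    using t f_nonneg by (subst integral_eq_nn_integral) (auto simp: enn2real_eq_posreal_iff)
qed

lemma FL_interval_le: "0 \<le> z \<Longrightarrow> measure FL {0<..z} \<le> z * f 0"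
proof -
  assume z: "0 \<le> z"
  have "emeasure FL {0<..z} = (\<integral>\<^sup>+v. ennreal (indicator {0..} v * f v) * indicator {0<..z} v \<partial>lborel)"
    unfolding FL by (subst emeasure_density) auto
  also have "\<dots> \<le> (\<integral>\<^sup>+v. ennreal (f 0) * indicator {0<..z} v \<partial>lborel)"
    using f_antimono[of 0] by (intro nn_integral_mono) (auto split: split_indicator intro!: ennreal_leI)
  also have "\<dots> = ennreal (z * f 0)" using z f_nonneg by (simp add: nn_integral_cmult_indicator ennreal_mult mult.commute)
  finally show ?thesis using z f_nonneg[of 0] by (simp add: FL.emeasure_eq_measure)
qed

lemma S_measurable: "score_equation (E k) (F k) (P k) (a k) (\<gamma> k) \<Longrightarrow> S k \<in> borel_measurable borel"
  using borel_measurable_mono[of "\<lambda>u. - S k u"] score_equation.S_antimono by (fastforce simp: monotone_def)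

text \<open>\<open>E\<close> lives on \<open>[\<gamma> k, \<infinity>)\<close>, so replacing
  \<open>y\<close> by \<open>max y (\<gamma> k)\<close> leaves \<open>SE k y\<close> unchanged while
  bounding the integrand by \<open>1 / \<gamma> k\<close>, which the discrepancy absorbs. The same
  replacement changes \<open>f\<close> little, by its right-continuity at 0.\<close>

lemma SE_near_f:
  assumes "0 < \<epsilon>"
  shows "\<forall>\<^sub>F k in sequentially. \<forall>y\<ge>0. \<bar>SE k y - f y\<bar> \<le> \<epsilon>"
proof -
  obtain \<delta> where \<delta>: "0 < \<delta>" "f 0 - f \<delta> < \<epsilon> / 2" using f_near_0[of "\<epsilon> / 2"] assms by auto
  have "\<forall>\<^sub>F k in sequentially. \<gamma> k < \<delta>" using \<gamma> \<delta>(1) by (rule order_tendstoD)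
  moreover have "\<forall>\<^sub>F k in sequentially. \<forall>I. is_interval I \<longrightarrow>
        \<bar>measure (measure_pmf (E k)) I - measure Q I\<bar> \<le> \<epsilon> / 2 * \<gamma> k" by (rule devE) (use assms in simp)
  ultimately show ?thesis using score
  proof eventually_elim
    case (elim k)
    interpret s: score_equation "E k" "F k" "P k" "a k" "\<gamma> k" by (rule elim(3))
    show ?case
    proof (intro allI impI)
      fix y :: real assume y: "0 \<le> y"
      define m where "m = max y (\<gamma> k)"
      define \<phi> where "\<phi> z = indicator {m..} z * (1 / z)" for z :: real
      have m: "\<gamma> k \<le> m" "y \<le> m" "0 < m" using s.\<gamma> by (auto simp: m_def)
      have \<phi>m[measurable]: "\<phi> \<in> borel_measurable borel" unfolding \<phi>_def by measurable
      have "1 * \<bar>(\<integral>x. \<phi> x \<partial>measure_pmf (E k)) - (\<integral>x. \<phi> x \<partial>Q)\<bar> \<le> (1 / \<gamma> k) * (\<epsilon> / 2 * \<gamma> k)"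
      proof (rule integral_diff_le_interval_discrepancy)
        show "finite_measure (measure_pmf (E k))" "finite_measure Q" by unfold_locales
        show "0 \<le> \<phi> x" "\<phi> x \<le> 1 / \<gamma> k" for x
          using m s.\<gamma> by (auto simp: \<phi>_def split: split_indicator intro!: divide_left_mono)
        show "is_interval {x. u < \<phi> x}" if "0 \<le> u" for u
          unfolding \<phi>_def using m that
          by (intro is_interval_superlevel_antimono) (auto simp: is_interval_ci intro!: divide_left_mono)
      qed (use elim(2) in auto)
      then have 1: "\<bar>(\<integral>x. \<phi> x \<partial>measure_pmf (E k)) - (\<integral>x. \<phi> x \<partial>Q)\<bar> \<le> \<epsilon> / 2" using s.\<gamma> by simp
      have 2: "(\<integral>x. \<phi> x \<partial>measure_pmf (E k)) = SE k y"
        unfolding s.SE_eq integral_pmf_finite[OF s.finE] \<phi>_def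
        using s.score_on_E(1) by (intro sum.cong) (auto simp: m_def split: split_indicator)
      have 3: "(\<integral>x. \<phi> x \<partial>Q) = f m" by (simp add: \<phi>_def inv_tail_def set_lebesgue_integral_def)
      have "f y - f m \<le> \<epsilon> / 2"
      proof (cases "y \<le> \<gamma> k")
        case True
        then have "m = \<gamma> k" by (simp add: m_def)
        then show ?thesis using f_antimono[of m \<delta>] f_antimono[of 0 y] y \<delta> elim(1) by simp
      qed (use assms in \<open>simp add: m_def\<close>)
      moreover have "f m \<le> f y" using m by (intro f_antimono)
      ultimately show "\<bar>SE k y - f y\<bar> \<le> \<epsilon>" using 1 2 3 by linarith
    qed
  qed
qed

text \<open>The pointwise inequality \<open>x \<ge> 2 - 1 / x\<close>, applied to \<open>x = f / S\<close>, replaces a Cauchy--Schwarz argument.\<close>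
lemma \<kappa>_bound:
  assumes s: "score_equation (E k) (F k) (P k) (a k) (\<gamma> k)" and c: "0 < c" "c < \<tau>"
    and \<epsilon>: "0 \<le> \<epsilon>" "\<epsilon> < 1" and SE: "\<And>v. 0 < v \<Longrightarrow> v \<le> c \<Longrightarrow> (1 - \<epsilon>) * f v \<le> SE k v"
    and dev: "\<And>I. is_interval I \<Longrightarrow> (1 - a k) * \<bar>measure (measure_pmf (F k)) I - measure FL I\<bar> \<le> \<delta> * \<gamma> k"
  shows "a k * score_equation.\<kappa> (E k) (P k) \<le> (1 - a k)
     - (1 - \<epsilon>) * ((1 - a k) * (2 * measure FL {0<..c} - 1) - 2 * \<delta> * \<gamma> k - 2 * \<delta> / f c)"
proof -
  interpret s: score_equation "E k" "F k" "P k" "a k" "\<gamma> k" by (rule s)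
  let ?F = "measure_pmf (F k)" and ?C = "1 / f c" and ?I = "indicator {0<..c} :: real \<Rightarrow> real"
  note Sm[measurable] = S_measurable[OF s]
  have fc: "0 < f c" using c by (intro f_pos)
  have fv: "f c \<le> f v" "0 < f v" if "v \<le> c" for v using that c by (auto intro: f_antimono f_pos_le)
  have a1: "0 \<le> 1 - a k" using s.a by simp
  \<comment> \<open>\<open>S k / f\<close> is a quotient of two decreasing functions and need not be
    monotone. With \<open>?C\<close> the largest value of \<open>1 / f\<close> on the interval, it
    is the difference of the decreasing functions \<open>S k * ?C\<close> and
    \<open>S k * (?C - 1 / f)\<close>, both at most \<open>?C / \<gamma> k\<close>.\<close>
  define \<phi>1 \<phi>2 where "\<phi>1 v = ?I v * (S k v * ?C)" and "\<phi>2 v = ?I v * (S k v * (?C - 1 / f v))" for v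
  have inv: "1 / f v \<le> ?C" "0 < 1 / f v" if "v \<le> c" for v
    using fv[OF that] fc by (auto intro!: divide_left_mono)
  have [measurable]: "\<phi>1 \<in> borel_measurable borel" "\<phi>2 \<in> borel_measurable borel" unfolding \<phi>1_def \<phi>2_def by measurable
  have b1: "0 \<le> \<phi>1 v" "\<phi>1 v \<le> 1 / \<gamma> k * ?C" for v
  proof -
    have "0 \<le> S k v * ?C" "S k v * ?C \<le> 1 / \<gamma> k * ?C"
      using s.S_nonneg[of v] mult_right_mono[OF s.S_le[of v], of ?C] fc by auto
    then show "0 \<le> \<phi>1 v" "\<phi>1 v \<le> 1 / \<gamma> k * ?C" using s.\<gamma> fc by (auto simp: \<phi>1_def split: split_indicator)
  qed
  have b2: "0 \<le> \<phi>2 v" "\<phi>2 v \<le> 1 / \<gamma> k * ?C" for v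
  proof -
    have "0 \<le> S k v * (?C - 1 / f v)" "S k v * (?C - 1 / f v) \<le> 1 / \<gamma> k * ?C" if "v \<le> c"
      using inv[OF that] s.S_nonneg[of v] s.S_le[of v] s.\<gamma> by (auto intro!: mult_nonneg_nonneg mult_mono simp del: times_divide_eq_right times_divide_eq_left)
    then show "0 \<le> \<phi>2 v" "\<phi>2 v \<le> 1 / \<gamma> k * ?C" using s.\<gamma> fc by (auto simp: \<phi>2_def split: split_indicator)
  qed
  have anti: "S k v * ?C \<le> S k u * ?C" "S k v * (?C - 1 / f v) \<le> S k u * (?C - 1 / f u)" if "u \<le> v" "v \<le> c" for u v
  proof -
    show "S k v * ?C \<le> S k u * ?C" using s.S_antimono[OF that(1)] fc by (intro mult_right_mono) auto
    have "1 / f u \<le> 1 / f v" using f_antimono[OF that(1)] fv[of u] fv[of v] that by (intro divide_left_mono) auto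
    then show "S k v * (?C - 1 / f v) \<le> S k u * (?C - 1 / f u)"
      using s.S_antimono[OF that(1)] s.S_nonneg inv[of v] that by (intro mult_mono) auto
  qed
  have int: "is_interval {x. u < \<phi>1 x}" "is_interval {x. u < \<phi>2 x}" if "0 \<le> u" for u
    unfolding \<phi>1_def \<phi>2_def using that anti by (intro is_interval_superlevel_antimono; auto simp: is_interval_oc)+
  have d: "(1 - a k) * \<bar>(\<integral>x. \<phi> x \<partial>?F) - (\<integral>x. \<phi> x \<partial>FL)\<bar> \<le> \<delta> * ?C"
    if \<phi>: "\<phi> \<in> borel_measurable borel" "\<And>v. 0 \<le> \<phi> v" "\<And>v. \<phi> v \<le> 1 / \<gamma> k * ?C" "\<And>u. 0 \<le> u \<Longrightarrow> is_interval {x. u < \<phi> x}" for \<phi>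
  proof -
    have "(1 - a k) * \<bar>(\<integral>x. \<phi> x \<partial>?F) - (\<integral>x. \<phi> x \<partial>FL)\<bar> \<le> (1 / \<gamma> k * ?C) * (\<delta> * \<gamma> k)"
      using \<phi> a1 dev by (intro integral_diff_le_interval_discrepancy) (auto simp: measure_pmf.finite_measure_axioms FL.finite_measure_axioms)
    also have "\<dots> = \<delta> * ?C" using s.\<gamma> by simp
    finally show ?thesis .
  qed
  have d1: "(1 - a k) * \<bar>(\<integral>x. \<phi>1 x \<partial>?F) - (\<integral>x. \<phi>1 x \<partial>FL)\<bar> \<le> \<delta> * ?C"
    by (rule d) (use b1 int in auto)
  have d2: "(1 - a k) * \<bar>(\<integral>x. \<phi>2 x \<partial>?F) - (\<integral>x. \<phi>2 x \<partial>FL)\<bar> \<le> \<delta> * ?C"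
    by (rule d) (use b2 int in auto)
  have i1: "integrable FL \<phi>1" by (rule FL.integrable_const_bound[where B = "1 / \<gamma> k * ?C"]) (use b1 in auto)
  have i2: "integrable FL \<phi>2" by (rule FL.integrable_const_bound[where B = "1 / \<gamma> k * ?C"]) (use b2 in auto)
  have split: "\<phi>1 v - \<phi>2 v = ?I v * (S k v / f v)" for v
    by (auto simp: \<phi>1_def \<phi>2_def algebra_simps split: split_indicator)
  have FLle: "(\<integral>x. \<phi>1 x \<partial>FL) - (\<integral>x. \<phi>2 x \<partial>FL) \<le> 1"
  proof -
    have "(\<integral>x. \<phi>1 x \<partial>FL) - (\<integral>x. \<phi>2 x \<partial>FL) = (\<integral>v. ?I v * (S k v / f v) \<partial>FL)"
      using i1 i2 by (simp add: Bochner_Integration.integral_diff[symmetric] split)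
    also have "\<dots> \<le> 1"
    proof -
      have "(\<integral>\<^sup>+v. ennreal (?I v * (S k v / f v)) \<partial>FL) = (\<integral>\<^sup>+v. indicator {0<..c} v * ennreal (S k v) \<partial>lborel)"
        using c s.S_nonneg by (intro nn_integral_FL_div_f) auto
      also have "\<dots> \<le> (\<integral>\<^sup>+v. indicator {0..} v * ennreal (S k v) \<partial>lborel)"
        by (intro nn_integral_mono) (auto split: split_indicator)
      also have "\<dots> \<le> 1" by (rule s.nn_integral_S_le)
      finally have "(\<integral>\<^sup>+v. ennreal (?I v * (S k v / f v)) \<partial>FL) \<le> 1" .
      then show ?thesis
        using s.S_nonneg f_nonneg by (subst integral_eq_nn_integral) (auto intro!: enn2real_leI)
    qed
    finally show ?thesis .
  qed
  have up: "(1 - a k) * (\<integral>v. ?I v * (S k v / f v) \<partial>?F) \<le> (1 - a k) + 2 * \<delta> * ?C"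
  proof -
    have e: "(\<integral>v. ?I v * (S k v / f v) \<partial>?F) = (\<integral>x. \<phi>1 x \<partial>?F) - (\<integral>x. \<phi>2 x \<partial>?F)"
      by (simp add: integral_pmf_finite[OF s.finF] sum_subtractf[symmetric] left_diff_distrib[symmetric] split)
    have "(1 - a k) * ((\<integral>x. \<phi>1 x \<partial>?F) - (\<integral>x. \<phi>2 x \<partial>?F)) = (1 - a k) * ((\<integral>x. \<phi>1 x \<partial>?F) - (\<integral>x. \<phi>1 x \<partial>FL))
       + (1 - a k) * ((\<integral>x. \<phi>2 x \<partial>FL) - (\<integral>x. \<phi>2 x \<partial>?F)) + (1 - a k) * ((\<integral>x. \<phi>1 x \<partial>FL) - (\<integral>x. \<phi>2 x \<partial>FL))"
      by (simp add: algebra_simps)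
    moreover have "(1 - a k) * ((\<integral>x. \<phi>1 x \<partial>?F) - (\<integral>x. \<phi>1 x \<partial>FL)) \<le> \<delta> * ?C"
      using d1 a1 by (smt (verit) mult_left_mono)
    moreover have "(1 - a k) * ((\<integral>x. \<phi>2 x \<partial>FL) - (\<integral>x. \<phi>2 x \<partial>?F)) \<le> \<delta> * ?C"
      using d2 a1 by (smt (verit) mult_left_mono)
    moreover have "(1 - a k) * ((\<integral>x. \<phi>1 x \<partial>FL) - (\<integral>x. \<phi>2 x \<partial>FL)) \<le> (1 - a k)"
      using mult_left_mono[OF FLle a1] by simp
    ultimately show ?thesis unfolding e by linarith
  qed
  have low: "(1 - a k) * (2 * measure ?F {0<..c}) \<ge> (1 - a k) * (2 * measure FL {0<..c}) - 2 * \<delta> * \<gamma> k"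
  proof -
    have "(1 - a k) * (measure FL {0<..c} - measure ?F {0<..c}) \<le> (1 - a k) * \<bar>measure ?F {0<..c} - measure FL {0<..c}\<bar>"
      using a1 by (intro mult_left_mono) auto
    then show ?thesis using dev[of "{0<..c}"] by (simp add: is_interval_oc algebra_simps)
  qed
  have "(LINT v:{0<..}|?F. SE k v / S k v) \<ge> (1 - \<epsilon>) * (2 * measure ?F {0<..c} - (\<integral>v. ?I v * (S k v / f v) \<partial>?F))"
  proof -
    \<comment> \<open>Beyond \<open>c\<close> the left side is 0 and the right side nonnegative.
      Below \<open>c\<close>, positivity of \<open>S k v\<close> has to be shown, since division by
      0 would give 0: \<open>SE k v > 0\<close> puts a point of the support of \<open>E k\<close> at
      or beyond \<open>v\<close>, and \<open>P k\<close> charges it.\<close>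
    have pt: "(1 - \<epsilon>) * (2 * ?I v - ?I v * (S k v / f v)) \<le> indicator {0<..} v * (SE k v / S k v)" for v
    proof (cases "v \<in> {0<..c}")
      case True
      then have v: "0 < v" "v \<le> c" by auto
      have f: "0 < f v" using fv v by auto
      have "0 < (1 - \<epsilon>) * f v" using f \<epsilon> by simp
      then have SEp: "0 < SE k v" using SE[OF v] by linarith
      have Sp: "0 < S k v"
      proof -
        have "(\<Sum>z\<in>set_pmf (E k). indicator {v..} z * (1 / z) * pmf (E k) z) \<noteq> 0" using SEp by (simp only: s.SE_eq)
        then obtain z where "z \<in> set_pmf (E k)" "indicator {v..} z * (1 / z) * pmf (E k) z \<noteq> 0"
          by (rule sum.not_neutral_contains_not_neutral)
        then have z: "z \<in> set_pmf (E k)" "v \<le> z" by (auto simp: indicator_def split: if_splits)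
        then have "0 < indicator {v..} z * (1 / z) * pmf (P k) z" using s.score_on_E(2)[OF z(1)] s.Epos[OF z(1)] by simp
        also have "\<dots> \<le> S k v" unfolding s.S_eq
          using s.Ppos z s.score_on_E(2)[OF z(1)]
          by (intro member_le_sum s.finP) (auto simp: set_pmf_iff less_imp_le)
        finally show ?thesis .
      qed
      have "0 \<le> (f v - S k v)\<^sup>2 / (f v * S k v)" using f Sp by simp
      also have "\<dots> = f v / S k v - 2 + S k v / f v" using f Sp by (simp add: field_simps power2_eq_square)
      finally have "2 - S k v / f v \<le> f v / S k v" by simp
      then have "(1 - \<epsilon>) * (2 - S k v / f v) \<le> (1 - \<epsilon>) * (f v / S k v)" using \<epsilon> by (intro mult_left_mono) auto
      also have "\<dots> \<le> SE k v / S k v" using SE[OF v] Sp by (simp add: divide_right_mono)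
      finally show ?thesis using True by simp
    next
      case False
      then show ?thesis using s.S_nonneg s.SE_nonneg by (auto split: split_indicator)
    qed
    have "(1 - \<epsilon>) * (2 * measure ?F {0<..c} - (\<integral>v. ?I v * (S k v / f v) \<partial>?F)) = (\<integral>v. (1 - \<epsilon>) * (2 * ?I v - ?I v * (S k v / f v)) \<partial>?F)"
    proof -
      have "measure ?F {0<..c} = (\<integral>v. ?I v \<partial>?F)" by simp
      then show ?thesis
        by (simp only: integral_pmf_finite[OF s.finF] sum_distrib_left sum_subtractf[symmetric]) (auto intro!: sum.cong simp: algebra_simps)
    qed
    also have "\<dots> \<le> (\<integral>v. indicator {0<..} v * (SE k v / S k v) \<partial>?F)"
      using pt by (intro integral_mono integrable_measure_pmf_finite s.finF)
    also have "\<dots> = (LINT v:{0<..}|?F. SE k v / S k v)" by (simp add: set_lebesgue_integral_def)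
    finally show ?thesis .
  qed
  then have "(1 - a k) * ((1 - \<epsilon>) * (2 * measure ?F {0<..c} - (\<integral>v. ?I v * (S k v / f v) \<partial>?F))) \<le> (1 - a k) * (LINT v:{0<..}|?F. SE k v / S k v)"
    using a1 by (rule mult_left_mono)
  moreover have "(1 - \<epsilon>) * ((1 - a k) * (2 * measure FL {0<..c} - 1) - 2 * \<delta> * \<gamma> k - 2 * \<delta> / f c)
      \<le> (1 - \<epsilon>) * ((1 - a k) * (2 * measure ?F {0<..c}) - (1 - a k) * (\<integral>v. ?I v * (S k v / f v) \<partial>?F))"
    using up low \<epsilon> by (intro mult_left_mono) (auto simp: algebra_simps)
  ultimately show ?thesis using s.averaged_score by (simp add: algebra_simps)
qed

lemma a_ge: "0 < q \<Longrightarrow> q < 1 \<Longrightarrow> \<forall>\<^sub>F k in sequentially. q * p < a k"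
  using p by (intro order_tendstoD(1)[OF a]) simp

lemma \<kappa>_tendsto:
  assumes "0 < \<rho>"
  shows "\<forall>\<^sub>F k in sequentially. score_equation.\<kappa> (E k) (P k) \<le> \<rho>"
proof -
  \<comment> \<open>The bound obtained is \<open>a k * \<kappa> \<le> 4 * e\<close>:
    \<open>3 * e\<close> from the mass of \<open>FL\<close> missed by \<open>{0<..c}\<close> and the
    relative error of \<open>SE\<close>, and \<open>e\<close> from the discrepancies, to which
    \<delta> is fitted. Since \<open>a k > p / 2\<close>, the factor \<open>p / 8\<close> yields
    \<rho>.\<close>
  define e where "e = min (1 / 2) (p * \<rho> / 8)"
  have e: "0 < e" "e \<le> 1 / 2" "e \<le> p * \<rho> / 8" using assms p by (auto simp: e_def)
  obtain c where c: "0 < c" "c < \<tau>" "1 - e < measure FL {0<..c}" using FL_exhaust[of "1 - e"] e by auto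
  have fc: "0 < f c" using c by (intro f_pos)
  define \<delta> where "\<delta> = e / (2 * (1 + 1 / f c))"
  have \<delta>: "0 < \<delta>" using e fc by (auto simp: \<delta>_def add_pos_pos)
  have \<delta>2: "2 * \<delta> + 2 * \<delta> / f c = e"
  proof -
    have "2 * \<delta> + 2 * \<delta> / f c = 2 * \<delta> * (1 + 1 / f c)" by (simp add: algebra_simps)
    also have "\<dots> = e" using fc by (simp add: \<delta>_def divide_simps)
    finally show ?thesis .
  qed
  have "\<forall>\<^sub>F k in sequentially. \<forall>y\<ge>0. \<bar>SE k y - f y\<bar> \<le> e * f c" by (rule SE_near_f) (use e fc in simp)
  moreover have "\<forall>\<^sub>F k in sequentially. \<gamma> k < 1" using \<gamma> by (rule order_tendstoD) simp
  moreover have "\<forall>\<^sub>F k in sequentially. 1 / 2 * p < a k" by (rule a_ge) auto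
  ultimately show ?thesis using score devF[OF \<delta>]
  proof eventually_elim
    case (elim k)
    interpret s: score_equation "E k" "F k" "P k" "a k" "\<gamma> k" by (rule elim(4))
    have SE: "(1 - e) * f v \<le> SE k v" if "0 < v" "v \<le> c" for v
    proof -
      have "e * f c \<le> e * f v" using f_antimono[OF that(2)] e by (intro mult_left_mono) auto
      moreover have "\<bar>SE k v - f v\<bar> \<le> e * f c" using elim(1) that by simp
      ultimately show ?thesis by (simp add: algebra_simps)
    qed
    let ?m = "measure FL {0<..c}"
    have "a k * s.\<kappa> \<le> (1 - a k) - (1 - e) * ((1 - a k) * (2 * ?m - 1) - 2 * \<delta> * \<gamma> k - 2 * \<delta> / f c)"
      using e elim(5) by (intro \<kappa>_bound[OF elim(4) c(1,2) _ _ SE]) auto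
    also have "\<dots> = (1 - a k) * (1 - (1 - e) * (2 * ?m - 1)) + (1 - e) * (2 * \<delta> * \<gamma> k + 2 * \<delta> / f c)"
      by (simp add: algebra_simps)
    also have "\<dots> \<le> 1 * (3 * e) + 1 * e"
    proof (intro add_mono mult_mono)
      have "(1 - e) * (1 - 2 * e) \<le> (1 - e) * (2 * ?m - 1)" using c(3) e by (intro mult_left_mono) auto
      moreover have "(1 - e) * (1 - 2 * e) = 1 - 3 * e + 2 * (e * e)" by (simp add: algebra_simps)
      moreover have "0 \<le> e * e" by simp
      ultimately show "1 - (1 - e) * (2 * ?m - 1) \<le> 3 * e" by linarith
      have "(1 - e) * (2 * ?m - 1) \<le> 1 * 1"
        using e(1,2) c(3) FL.prob_le_1[of "{0<..c}"] by (intro mult_mono) linarith+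
      then show "0 \<le> 1 - (1 - e) * (2 * ?m - 1)" by simp
      have "2 * \<delta> * \<gamma> k \<le> 2 * \<delta> * 1" using \<delta> elim(2) by (intro mult_left_mono) auto
      then show "2 * \<delta> * \<gamma> k + 2 * \<delta> / f c \<le> e" using \<delta>2 by simp
      show "0 \<le> 2 * \<delta> * \<gamma> k + 2 * \<delta> / f c" using \<delta> fc s.\<gamma> by simp
    qed (use e s.a in auto)
    finally have le: "a k * s.\<kappa> \<le> 4 * e" by simp
    show "s.\<kappa> \<le> \<rho>"
    proof (rule ccontr)
      assume "\<not> s.\<kappa> \<le> \<rho>"
      then have "1 / 2 * p * \<rho> < a k * s.\<kappa>" using elim(3) assms p by (intro mult_strict_mono) auto
      then show False using le e by simp
    qed
  qed
qed

text \<open>Beyond \<delta> the integrand is at most \<open>1 / \<delta>\<close>, so closeness in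
  total variation suffices; \<theta> is chosen to make \<open>2 * \<theta> / \<delta>\<close> equal
  to \<open>\<epsilon> / 2\<close>.\<close>

lemma S_near_f_away_0:
  assumes "0 < \<epsilon>" "0 < \<delta>"
  shows "\<forall>\<^sub>F k in sequentially. \<forall>y\<ge>\<delta>. \<bar>S k y - f y\<bar> \<le> \<epsilon>"
proof -
  define \<theta> where "\<theta> = \<epsilon> * \<delta> / 4"
  have \<theta>: "0 < \<theta>" using assms by (simp add: \<theta>_def)
  have "\<forall>\<^sub>F k in sequentially. score_equation.\<kappa> (E k) (P k) \<le> \<theta>\<^sup>2" by (rule \<kappa>_tendsto) (use \<theta> in simp)
  moreover have "\<forall>\<^sub>F k in sequentially. \<forall>y\<ge>0. \<bar>SE k y - f y\<bar> \<le> \<epsilon> / 2" by (rule SE_near_f) (use assms in simp)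
  ultimately show ?thesis using score
  proof eventually_elim
    case (elim k)
    interpret s: score_equation "E k" "F k" "P k" "a k" "\<gamma> k" by (rule elim(3))
    show ?case
    proof (intro allI impI)
      fix y assume y: "\<delta> \<le> y"
      have "\<bar>(\<integral>z. indicator {y..} z *\<^sub>R (1 / z) \<partial>measure_pmf (P k)) - (\<integral>z. indicator {y..} z *\<^sub>R (1 / z) \<partial>measure_pmf (E k))\<bar> \<le> 2 * \<theta> * (1 / \<delta>)"
        using \<theta> elim(1) y assms by (intro s.integral_P_near_E) (auto split: split_indicator intro!: divide_left_mono)
      also have "\<dots> = \<epsilon> / 2" using assms by (simp add: \<theta>_def)
      finally have "\<bar>S k y - SE k y\<bar> \<le> \<epsilon> / 2" by (simp add: inv_tail_def set_lebesgue_integral_def)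
      moreover have "\<bar>SE k y - f y\<bar> \<le> \<epsilon> / 2" using elim(2) y assms by simp
      ultimately show "\<bar>S k y - f y\<bar> \<le> \<epsilon>" by linarith
    qed
  qed
qed

text \<open>Near the origin, consistency in total variation does not control \<open>\<integral>z\<^sup>-\<^sup>1 dP\<close>. There the score equation
  itself bounds \<open>P\<close> by a constant multiple of \<open>E\<close>, because \<open>A t / t\<close> stays below \<open>1 - p / 2\<close>.\<close>
lemma S_near_f:
  assumes "0 < \<epsilon>"
  shows "\<forall>\<^sub>F k in sequentially. \<forall>y\<ge>0. \<bar>S k y - f y\<bar> \<le> \<epsilon>"
proof -
  have f0: "0 < f 0" using \<tau> by (rule f_pos)
  \<comment> \<open>The first bound keeps \<open>A t / t\<close> below \<open>1 - p / 2\<close> near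
    the origin, where it is used as \<open>3 * e \<le> p * f 0 / 4\<close>. The second absorbs the
    final error \<open>2 * e + 6 * e / p\<close>.\<close>
  define e where "e = min (p * f 0 / 12) (\<epsilon> * p / 8)"
  have e: "0 < e" "e \<le> p * f 0 / 12" "e \<le> \<epsilon> * p / 8" using assms p f0 by (auto simp: e_def)
  have p1: "p \<le> 1"
  proof (rule tendsto_upperbound[OF a])
    show "\<forall>\<^sub>F k in sequentially. a k \<le> 1" using score by eventually_elim (rule score_equation.a(2))
  qed simp
  have "p * f 0 \<le> f 0" using p1 f0 by simp
  then have e2: "2 * e < f 0" using e(1,2) f0 by linarith
  obtain \<delta> where \<delta>: "0 < \<delta>" "f 0 - f \<delta> < e" using f_near_0[OF e(1)] by auto
  have "\<forall>\<^sub>F k in sequentially. 3 / 4 * p < a k" by (rule a_ge) auto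
  with S_near_f_away_0[OF e(1) \<delta>(1)] SE_near_f[OF e(1)] devF[OF e(1)] score show ?thesis
  proof eventually_elim
    case (elim k)
    interpret s: score_equation "E k" "F k" "P k" "a k" "\<gamma> k" by (rule elim(4))
    have S\<delta>: "\<bar>S k \<delta> - f \<delta>\<bar> \<le> e" using elim(1) by simp
    then have S\<delta>_ge: "f 0 - 2 * e \<le> S k \<delta>" using \<delta> by linarith
    \<comment> \<open>For \<open>v \<le> t \<le> \<delta>\<close> monotonicity gives
      \<open>S k v \<ge> S k \<delta> \<ge> f 0 - 2 * e\<close>, so \<open>A t\<close> is at most
      \<open>1 - a k\<close> times the \<open>F k\<close>-mass of \<open>{0<..t}\<close> over
      \<open>f 0 - 2 * e\<close>. That mass is compared with \<open>t * f 0\<close>; the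
      discrepancy, small against \<open>\<gamma> k\<close>, is small against \<open>t\<close> as
      well.\<close>
    have Ple: "pmf (P k) t \<le> 2 / p * pmf (E k) t" if t: "t \<le> \<delta>" for t
    proof (cases "\<gamma> k \<le> t")
      case False
      then have "pmf (P k) t = 0" using s.Pge[of t] by (auto simp: set_pmf_iff)
      then show ?thesis using p by simp
    next
      case True
      then have t0: "0 < t" using s.\<gamma> by simp
      have "s.A t \<le> (1 - a k) * (\<Sum>v\<in>set_pmf (F k). indicator {0<..t} v * (1 / (f 0 - 2 * e)) * pmf (F k) v)"
        unfolding s.A_eq
      proof (rule mult_left_mono[OF sum_mono], rule mult_right_mono)
        fix v
        have "1 / S k v \<le> 1 / (f 0 - 2 * e)" if "v \<le> t"
          using s.S_antimono[of v \<delta>] S\<delta>_ge e2 that t by (intro divide_left_mono) auto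
        then show "indicator {0<..t} v * (1 / S k v) \<le> indicator {0<..t} v * (1 / (f 0 - 2 * e))"
          by (auto split: split_indicator)
      qed (use s.a in auto)
      also have "(\<Sum>v\<in>set_pmf (F k). indicator {0<..t} v * (1 / (f 0 - 2 * e)) * pmf (F k) v) = measure (measure_pmf (F k)) {0<..t} / (f 0 - 2 * e)"
      proof -
        have "measure (measure_pmf (F k)) {0<..t} = (\<integral>v. indicator {0<..t} v \<partial>measure_pmf (F k))" by simp
        then show ?thesis by (simp only: integral_pmf_finite[OF s.finF]) (simp add: sum_divide_distrib)
      qed
      also have "(1 - a k) * (measure (measure_pmf (F k)) {0<..t} / (f 0 - 2 * e)) = ((1 - a k) * measure (measure_pmf (F k)) {0<..t}) / (f 0 - 2 * e)"
        by simp
      also have "\<dots> \<le> ((1 - a k) * f 0 + e) * t / (f 0 - 2 * e)"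
      proof (rule divide_right_mono)
        let ?d = "measure (measure_pmf (F k)) {0<..t} - measure FL {0<..t}"
        have "(1 - a k) * \<bar>?d\<bar> \<le> e * \<gamma> k" using elim(3) by (simp add: is_interval_oc)
        also have "\<dots> \<le> e * t" using True e by (intro mult_left_mono) auto
        finally have "(1 - a k) * ?d \<le> e * t" using s.a by (smt (verit) mult_left_mono)
        moreover have "(1 - a k) * measure FL {0<..t} \<le> (1 - a k) * (t * f 0)"
          using FL_interval_le[of t] t0 s.a by (intro mult_left_mono) auto
        ultimately show "(1 - a k) * measure (measure_pmf (F k)) {0<..t} \<le> ((1 - a k) * f 0 + e) * t"
          by (simp add: algebra_simps)
      qed (use e2 in simp)
      finally have "s.A t / t \<le> ((1 - a k) * f 0 + e) / (f 0 - 2 * e)" using t0 by (simp add: field_simps)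
      also have "\<dots> \<le> 1 - p / 2"
      proof -
        define x y where "x = p * f 0" and "y = p * e"
        have xy: "12 * e \<le> x" "0 \<le> y" using e p by (auto simp: x_def y_def)
        have "(1 - a k) * f 0 \<le> (1 - 3 / 4 * p) * f 0" using elim(5) f0 by (intro mult_right_mono) auto
        also have "\<dots> = f 0 - 3 / 4 * x" by (simp add: x_def algebra_simps)
        finally have "(1 - a k) * f 0 + e \<le> f 0 - x / 2 - 2 * e + y" using xy by linarith
        also have "\<dots> = (1 - p / 2) * (f 0 - 2 * e)" by (simp add: x_def y_def algebra_simps)
        finally have "(1 - a k) * f 0 + e \<le> (1 - p / 2) * (f 0 - 2 * e)" .
        then show ?thesis using e2 by (simp add: pos_divide_le_eq)
      qed
      finally have A: "p / 2 \<le> 1 - s.A t / t" by simp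
      have "pmf (P k) t * (p / 2) \<le> pmf (P k) t * (1 - s.A t / t)" using A by (intro mult_left_mono) auto
      also have "\<dots> = a k * pmf (E k) t" using t0 by (rule s.score_A)
      also have "\<dots> \<le> pmf (E k) t" using s.a by (intro mult_left_le_one_le) auto
      finally show ?thesis using p by (simp add: field_simps)
    qed
    \<comment> \<open>Domination of the masses transfers smallness from the increment of
      \<open>SE k\<close> over \<open>{y..<\<delta>}\<close>, known to be close to that of
      \<open>f\<close>, to the increment of \<open>S k\<close>.\<close>
    have S_diff: "S k y - S k \<delta> \<le> 2 / p * (SE k y - SE k \<delta>)" if y: "0 \<le> y" "y \<le> \<delta>" for y
    proof -
      have subE: "set_pmf (E k) \<subseteq> set_pmf (P k)" using s.score_on_E(2) by (fastforce simp: set_pmf_iff)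
      have "SE k y - SE k \<delta> = (\<Sum>z\<in>set_pmf (E k). indicator {y..<\<delta>} z * (1 / z) * pmf (E k) z)"
        unfolding s.SE_eq sum_subtractf[symmetric] using y by (intro sum.cong) (auto split: split_indicator)
      also have "\<dots> = (\<Sum>z\<in>set_pmf (P k). indicator {y..<\<delta>} z * (1 / z) * pmf (E k) z)"
        using subE by (intro sum.mono_neutral_left s.finP) (auto simp: set_pmf_iff)
      finally have SEd: "SE k y - SE k \<delta> = (\<Sum>z\<in>set_pmf (P k). indicator {y..<\<delta>} z * (1 / z) * pmf (E k) z)" .
      have "S k y - S k \<delta> = (\<Sum>z\<in>set_pmf (P k). indicator {y..<\<delta>} z * (1 / z) * pmf (P k) z)"
        unfolding s.S_eq sum_subtractf[symmetric] using y by (intro sum.cong) (auto split: split_indicator)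
      also have "\<dots> \<le> (\<Sum>z\<in>set_pmf (P k). 2 / p * (indicator {y..<\<delta>} z * (1 / z) * pmf (E k) z))"
      proof (rule sum_mono)
        fix z assume z: "z \<in> set_pmf (P k)"
        have "(1 / z) * pmf (P k) z \<le> (1 / z) * (2 / p * pmf (E k) z)" if "z < \<delta>"
          using Ple[of z] that s.Ppos[OF z] by (intro mult_left_mono) auto
        then show "indicator {y..<\<delta>} z * (1 / z) * pmf (P k) z \<le> 2 / p * (indicator {y..<\<delta>} z * (1 / z) * pmf (E k) z)"
          by (auto split: split_indicator simp: mult_ac)
      qed
      also have "\<dots> = 2 / p * (SE k y - SE k \<delta>)" unfolding SEd by (simp add: sum_distrib_left)
      finally show ?thesis .
    qed
    show ?case
    proof (intro allI impI)
      fix y :: real assume y: "0 \<le> y"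
      have "e \<le> e / p" using p p1 e by (simp add: field_simps)
      then have small: "2 * e + 6 * e / p \<le> \<epsilon>" using e(3) p by (simp add: field_simps)
      have pe: "0 < e / p" using e p by simp
      show "\<bar>S k y - f y\<bar> \<le> \<epsilon>"
      proof (cases "\<delta> \<le> y")
        case True
        then have "\<bar>S k y - f y\<bar> \<le> e" using elim(1) by simp
        then show ?thesis using small pe e by simp
      next
        case False
        then have y\<delta>: "y \<le> \<delta>" by simp
        have fm: "f \<delta> \<le> f y" "f y \<le> f 0" using y y\<delta> by (auto intro: f_antimono)
        have SEy: "\<bar>SE k y - f y\<bar> \<le> e" "\<bar>SE k \<delta> - f \<delta>\<bar> \<le> e" using elim(2) y \<delta>(1) by auto
        have "SE k y - SE k \<delta> \<le> 3 * e" using SEy fm \<delta> by linarith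
        then have "2 / p * (SE k y - SE k \<delta>) \<le> 2 / p * (3 * e)" using p by (intro mult_left_mono) auto
        then have "S k y \<le> S k \<delta> + 6 * e / p" using S_diff[OF y y\<delta>] by simp
        moreover have "S k \<delta> \<le> S k y" using y\<delta> by (rule s.S_antimono)
        ultimately show ?thesis using S\<delta> S\<delta>_ge fm small pe e by linarith
      qed
    qed
  qed
qed

text \<open>Replacing \<open>S\<close> by \<open>f\<close> and then \<open>F\<close> by
  \<open>FL\<close> turns \<open>A t\<close> into \<open>1 - a k\<close> times the integral of
  \<open>1 / f\<close> against \<open>FL\<close> over \<open>{0<..t}\<close>, which is exactly
  \<open>t\<close>. Both errors are proportional to \<open>t\<close>: the first because
  \<open>1 / S\<close> has a small error relative to \<open>1 / f\<close>, the second because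
  \<open>\<gamma> k \<le> t\<close>.\<close>

lemma A_near:
  assumes c: "0 < c" "c < \<tau>" and "0 < \<epsilon>"
  shows "\<forall>\<^sub>F k in sequentially. \<forall>t. \<gamma> k \<le> t \<longrightarrow> t \<le> c \<longrightarrow> \<bar>score_equation.A (F k) (P k) (a k) t / t - (1 - a k)\<bar> \<le> \<epsilon>"
proof -
  have fc: "0 < f c" using c by (intro f_pos)
  define d where "d = min 1 (\<epsilon> / 3)"
  have d: "0 < d" "d \<le> 1" "3 * d \<le> \<epsilon>" using assms by (auto simp: d_def)
  have "\<forall>\<^sub>F k in sequentially. \<forall>y\<ge>0. \<bar>S k y - f y\<bar> \<le> f c * d / 2" by (rule S_near_f) (use fc d in simp)
  moreover have "\<forall>\<^sub>F k in sequentially. \<forall>I. is_interval I \<longrightarrow>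
        (1 - a k) * \<bar>measure (measure_pmf (F k)) I - measure FL I\<bar> \<le> (f c * d) * \<gamma> k"
    by (rule devF) (use fc d in simp)
  ultimately show ?thesis using score
  proof eventually_elim
    case (elim k)
    interpret s: score_equation "E k" "F k" "P k" "a k" "\<gamma> k" by (rule elim(3))
    have a1: "0 \<le> 1 - a k" using s.a by simp
    show ?case
    proof (intro allI impI)
      fix t assume t: "\<gamma> k \<le> t" "t \<le> c"
      have t0: "0 < t" using t s.\<gamma> by simp
      have fv: "f c \<le> f v" "0 < f v" if "v \<le> t" for v using that c t by (auto intro: f_antimono f_pos_le)
      let ?J = "\<integral>v. indicator {0<..t} v * (1 / f v) \<partial>measure_pmf (F k)"
      have J: "(1 - a k) * \<bar>?J - (\<integral>v. indicator {0<..t} v * (1 / f v) \<partial>FL)\<bar> \<le> (1 / f c) * ((f c * d) * \<gamma> k)"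
      proof (rule integral_diff_le_interval_discrepancy)
        show "finite_measure (measure_pmf (F k))" "finite_measure FL" by unfold_locales
        show "0 \<le> indicator {0<..t} v * (1 / f v)" for v using f_nonneg by simp
        show "indicator {0<..t} v * (1 / f v) \<le> 1 / f c" for v
          using fv[of v] fc by (auto split: split_indicator intro!: divide_left_mono)
        show "is_interval {x. u < indicator {0<..t} x * (1 / f x)}" if "0 \<le> u" for u
          using that fv f_antimono
          by (intro is_interval_superlevel_mono) (auto simp: is_interval_oc intro!: divide_left_mono)
      qed (use elim(2) a1 in auto)
      also have "(1 / f c) * ((f c * d) * \<gamma> k) = d * \<gamma> k" using fc by simp
      also have "\<dots> \<le> d * t" using t d by (intro mult_left_mono) auto
      also have "(\<integral>v. indicator {0<..t} v * (1 / f v) \<partial>FL) = t" using c t t0 by (intro integral_FL_div_f[of c]) auto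
      finally have J1: "(1 - a k) * \<bar>?J - t\<bar> \<le> d * t" .
      have J_abs: "\<bar>(1 - a k) * ?J - (1 - a k) * t\<bar> \<le> d * t"
        using J1 a1 by (simp add: right_diff_distrib[symmetric] abs_mult)
      have "\<bar>s.A t - (1 - a k) * ?J\<bar> \<le> (1 - a k) * (d * ?J)"
      proof -
        have "\<bar>(\<Sum>v\<in>set_pmf (F k). indicator {0<..t} v * (1 / S k v) * pmf (F k) v) - ?J\<bar>
           = \<bar>\<Sum>v\<in>set_pmf (F k). indicator {0<..t} v * (1 / S k v - 1 / f v) * pmf (F k) v\<bar>"
          by (simp add: integral_pmf_finite[OF s.finF] sum_subtractf[symmetric] algebra_simps)
        also have "\<dots> \<le> (\<Sum>v\<in>set_pmf (F k). \<bar>indicator {0<..t} v * (1 / S k v - 1 / f v) * pmf (F k) v\<bar>)"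
          by (rule sum_abs)
        also have "\<dots> \<le> (\<Sum>v\<in>set_pmf (F k). d * (indicator {0<..t} v * (1 / f v) * pmf (F k) v))"
        proof (rule sum_mono)
          fix v
          show "\<bar>indicator {0<..t} v * (1 / S k v - 1 / f v) * pmf (F k) v\<bar> \<le> d * (indicator {0<..t} v * (1 / f v) * pmf (F k) v)"
          proof (cases "v \<in> {0<..t}")
            case True
            then have v: "v \<le> t" "0 \<le> v" by auto
            have Sf: "\<bar>S k v - f v\<bar> \<le> f c * d / 2" using elim(1) v by simp
            have "f c * d \<le> f c" using fc d by simp
            then have S2: "f c / 2 \<le> S k v" using Sf fv(1)[OF v(1)] by linarith
            then have Sp: "0 < S k v" using fc by linarith
            have "\<bar>1 / S k v - 1 / f v\<bar> = \<bar>S k v - f v\<bar> / S k v * (1 / f v)"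
              using Sp fv(2)[OF v(1)] by (simp add: divide_simps abs_if)
            also have "\<dots> \<le> d * (1 / f v)"
            proof (rule mult_right_mono)
              have "f c * d / 2 \<le> d * S k v" using mult_left_mono[OF S2, of d] d by (simp add: mult_ac)
              then show "\<bar>S k v - f v\<bar> / S k v \<le> d" using Sf Sp by (simp add: pos_divide_le_eq)
            qed (use fv(2)[OF v(1)] in simp)
            finally have "\<bar>1 / S k v - 1 / f v\<bar> * pmf (F k) v \<le> d * (1 / f v) * pmf (F k) v"
              by (rule mult_right_mono) simp
            then show ?thesis using True by (simp add: abs_mult mult.assoc)
          qed simp
        qed
        also have "\<dots> = d * ?J" by (simp add: integral_pmf_finite[OF s.finF] sum_distrib_left)
        finally have "(1 - a k) * \<bar>(\<Sum>v\<in>set_pmf (F k). indicator {0<..t} v * (1 / S k v) * pmf (F k) v) - ?J\<bar> \<le> (1 - a k) * (d * ?J)"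
          using a1 by (rule mult_left_mono)
        then show ?thesis using a1 unfolding s.A_eq
          by (simp only: right_diff_distrib[symmetric] abs_mult abs_of_nonneg)
      qed
      also have "(1 - a k) * (d * ?J) = d * ((1 - a k) * ?J)" by simp
      also have "\<dots> \<le> d * (2 * t)"
      proof (rule mult_left_mono)
        have "(1 - a k) * t \<le> 1 * t" "d * t \<le> 1 * t" using s.a d t0 by (auto intro!: mult_right_mono)
        then show "(1 - a k) * ?J \<le> 2 * t" using J_abs by linarith
      qed (use d in simp)
      finally have "\<bar>s.A t - (1 - a k) * t\<bar> \<le> 3 * d * t" using J_abs by linarith
      then have "\<bar>s.A t - (1 - a k) * t\<bar> / t \<le> 3 * d" using t0 by (simp add: pos_divide_le_eq)
      moreover have "\<bar>s.A t - (1 - a k) * t\<bar> / t = \<bar>s.A t / t - (1 - a k)\<bar>"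
      proof -
        have "s.A t / t - (1 - a k) = (s.A t - (1 - a k) * t) / t" using t0 by (simp add: diff_divide_distrib)
        then show ?thesis using t0 by (simp add: abs_divide)
      qed
      ultimately show "\<bar>s.A t / t - (1 - a k)\<bar> \<le> \<epsilon>" using d by linarith
    qed
  qed
qed

text \<open>With \<open>x = 1 - A t / t\<close> the score equation says that the mass of
  \<open>P\<close> is \<open>a k / x\<close> times that of \<open>E\<close>, and \<open>x\<close> is
  within \<open>d\<close> of \<open>a k\<close>. The bound \<open>d \<le> p / 4\<close> keeps
  \<open>x\<close> away from 0. Below \<open>\<gamma> k\<close> both masses vanish.\<close>

theorem masses_near_empirical:
  assumes c: "0 < c" "c < \<tau>" and "0 < \<epsilon>"
  shows "\<forall>\<^sub>F k in sequentially. \<forall>t\<le>c. \<bar>pmf (P k) t - pmf (E k) t\<bar> \<le> \<epsilon> * pmf (E k) t"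
proof -
  define d where "d = min 1 \<epsilon> * (p / 4)"
  have d: "0 < d" "d \<le> p / 4" "d \<le> \<epsilon> * (p / 4)"
    using assms p by (auto simp: d_def min_def)
  have "\<forall>\<^sub>F k in sequentially. 1 / 2 * p < a k" by (rule a_ge) auto
  with A_near[OF c d(1)] score show ?thesis
  proof eventually_elim
    case (elim k)
    interpret s: score_equation "E k" "F k" "P k" "a k" "\<gamma> k" by (rule elim(2))
    show ?case
    proof (intro allI impI)
      fix t assume tc: "t \<le> c"
      show "\<bar>pmf (P k) t - pmf (E k) t\<bar> \<le> \<epsilon> * pmf (E k) t"
      proof (cases "\<gamma> k \<le> t")
        case False
        then have "pmf (P k) t = 0" "pmf (E k) t = 0"
          using s.Pge[of t] s.score_on_E(1)[of t] by (auto simp: set_pmf_iff)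
        then show ?thesis by simp
      next
        case True
        then have t0: "0 < t" using s.\<gamma> by simp
        define x where "x = 1 - s.A t / t"
        have "\<bar>s.A t / t - (1 - a k)\<bar> \<le> d" using elim(1) True tc by blast
        then have xa: "\<bar>a k - x\<bar> \<le> d" by (simp add: x_def)
        then have x: "p / 4 \<le> x" using elim(3) d by linarith
        have "x * \<bar>pmf (P k) t - pmf (E k) t\<bar> = \<bar>x * pmf (P k) t - x * pmf (E k) t\<bar>"
          using x p by (simp add: right_diff_distrib[symmetric] abs_mult)
        also have "x * pmf (P k) t = a k * pmf (E k) t" using s.score_A[OF t0] by (simp add: x_def mult.commute)
        also have "\<bar>a k * pmf (E k) t - x * pmf (E k) t\<bar> = \<bar>a k - x\<bar> * pmf (E k) t"
          by (simp add: left_diff_distrib[symmetric] abs_mult)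
        also have "\<dots> \<le> x * \<epsilon> * pmf (E k) t"
        proof (rule mult_right_mono)
          have "\<epsilon> * (p / 4) \<le> \<epsilon> * x" using x assms by (intro mult_left_mono) auto
          then show "\<bar>a k - x\<bar> \<le> x * \<epsilon>" using xa d(3) by (simp add: mult.commute)
        qed simp
        finally have "x * \<bar>pmf (P k) t - pmf (E k) t\<bar> \<le> x * (\<epsilon> * pmf (E k) t)" by (simp add: mult.assoc)
        then show ?thesis using x p by simp
      qed
    qed
  qed
qed

end

section \<open>Kernel smoothing\<close>

lemma sum_indicator_consecutive:
  fixes u :: "nat \<Rightarrow> real"
  assumes "mono u"
  shows "(\<Sum>j<n. indicator {u j..<u (Suc j)} y) = (indicator {u 0..<u n} y :: real)"
proof (induction n)
  case (Suc n)
  have "u 0 \<le> u n" "u n \<le> u (Suc n)" using assms by (auto simp: mono_def)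
  then show ?case by (auto simp: Suc split: split_indicator)
qed simp

text \<open>The general measure and the map \<psi> let one lemma serve both the estimator, with
  \<open>\<psi> s = (t - s) / h\<close>, and Lebesgue measure, with the identity. Finiteness is
  asked cell by cell for the sake of the latter.\<close>

lemma integral_near_step_sum:
  fixes \<psi> :: "'a \<Rightarrow> real" and K :: "real \<Rightarrow> real" and u :: "nat \<Rightarrow> real"
  assumes [measurable]: "\<psi> \<in> borel_measurable M" "K \<in> borel_measurable borel"
    and u: "mono u" and K0: "\<And>x. x \<notin> {u 0..<u N} \<Longrightarrow> K x = 0" and KB: "\<And>x. \<bar>K x\<bar> \<le> B"
    and osc: "\<And>j x. j < N \<Longrightarrow> u j \<le> x \<Longrightarrow> x < u (Suc j) \<Longrightarrow> \<bar>K x - K (u j)\<bar> \<le> e"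
    and fin: "\<And>j. j < N \<Longrightarrow> emeasure M {x \<in> space M. u j \<le> \<psi> x \<and> \<psi> x < u (Suc j)} < \<infinity>"
  shows "\<bar>(\<integral>x. K (\<psi> x) \<partial>M) - (\<Sum>j<N. K (u j) * measure M {x \<in> space M. u j \<le> \<psi> x \<and> \<psi> x < u (Suc j)})\<bar>
     \<le> e * (\<Sum>j<N. measure M {x \<in> space M. u j \<le> \<psi> x \<and> \<psi> x < u (Suc j)})"
proof -
  define C where "C j = {x \<in> space M. u j \<le> \<psi> x \<and> \<psi> x < u (Suc j)}" for j
  have [measurable]: "C j \<in> sets M" for j unfolding C_def by measurable
  have finC: "emeasure M (C j) < \<infinity>" if "j < N" for j using fin[OF that] by (simp add: C_def)
  have split: "K (\<psi> x) = (\<Sum>j<N. indicator (C j) x * K (\<psi> x))" if "x \<in> space M" for x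
  proof -
    have "(\<Sum>j<N. indicator (C j) x * K (\<psi> x)) = (\<Sum>j<N. indicator {u j..<u (Suc j)} (\<psi> x)) * K (\<psi> x)"
      using that by (simp only: sum_distrib_right) (auto intro!: sum.cong simp: C_def split: split_indicator)
    also have "\<dots> = K (\<psi> x)" using K0[of "\<psi> x"] by (simp add: sum_indicator_consecutive[OF u] split: split_indicator)
    finally show ?thesis ..
  qed
  have B: "0 \<le> B" using KB[of 0] by simp
  have ind: "integrable M (\<lambda>x. indicator (C j) x * c :: real)" if "j < N" for j c
    using finC[OF that] by (intro integrable_mult_left integrable_real_indicator) auto
  have intK: "integrable M (\<lambda>x. indicator (C j) x * K (\<psi> x))" if "j < N" for j
    by (rule Bochner_Integration.integrable_bound[OF ind[OF that, of B]])
       (use KB B in \<open>auto simp: abs_mult split: split_indicator intro!: AE_I2\<close>)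
  have "(\<integral>x. K (\<psi> x) \<partial>M) = (\<integral>x. (\<Sum>j<N. indicator (C j) x * K (\<psi> x)) \<partial>M)"
    by (rule Bochner_Integration.integral_cong[OF refl split])
  also have "\<dots> = (\<Sum>j<N. \<integral>x. indicator (C j) x * K (\<psi> x) \<partial>M)"
    using intK by (intro Bochner_Integration.integral_sum) auto
  finally have eq: "(\<integral>x. K (\<psi> x) \<partial>M) = (\<Sum>j<N. \<integral>x. indicator (C j) x * K (\<psi> x) \<partial>M)" .
  have cell: "\<bar>(\<integral>x. indicator (C j) x * K (\<psi> x) \<partial>M) - K (u j) * measure M (C j)\<bar> \<le> e * measure M (C j)" if j: "j < N" for j
  proof -
    have m: "(\<integral>x. indicator (C j) x * c \<partial>M) = c * measure M (C j)" for c :: real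
      using finC[OF j] by (simp add: mult.commute)
    have "(\<integral>x. indicator (C j) x * K (\<psi> x) \<partial>M) - K (u j) * measure M (C j)
      = (\<integral>x. indicator (C j) x * K (\<psi> x) - indicator (C j) x * K (u j) \<partial>M)"
      using intK[OF j] ind[OF j] by (simp add: m)
    also have "\<bar>\<dots>\<bar> \<le> (\<integral>x. norm (indicator (C j) x * K (\<psi> x) - indicator (C j) x * K (u j)) \<partial>M)"
      using integral_norm_bound[of M "\<lambda>x. indicator (C j) x * K (\<psi> x) - indicator (C j) x * K (u j)"] by simp
    also have "\<dots> \<le> (\<integral>x. indicator (C j) x * e \<partial>M)"
    proof (rule integral_mono)
      show "integrable M (\<lambda>x. norm (indicator (C j) x * K (\<psi> x) - indicator (C j) x * K (u j)))"
        using intK[OF j] ind[OF j] by (intro integrable_norm Bochner_Integration.integrable_diff)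
      show "norm (indicator (C j) x * K (\<psi> x) - indicator (C j) x * K (u j)) \<le> indicator (C j) x * e" for x
        using osc[OF j, of "\<psi> x"] by (auto simp: C_def split: split_indicator)
    qed (rule ind[OF j])
    also have "\<dots> = e * measure M (C j)" by (rule m)
    finally show ?thesis .
  qed
  have "\<bar>(\<integral>x. K (\<psi> x) \<partial>M) - (\<Sum>j<N. K (u j) * measure M (C j))\<bar> = \<bar>\<Sum>j<N. (\<integral>x. indicator (C j) x * K (\<psi> x) \<partial>M) - K (u j) * measure M (C j)\<bar>"
    by (simp add: eq sum_subtractf)
  also have "\<dots> \<le> (\<Sum>j<N. e * measure M (C j))"
    using cell by (intro order.trans[OF sum_abs] sum_mono) auto
  finally show ?thesis by (simp add: C_def sum_distrib_left)
qed

lemma compactly_supported_kernel_bounds: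
  fixes K :: "real \<Rightarrow> real"
  assumes cont: "continuous_on UNIV K" and K0: "\<And>u. u \<notin> {-1<..<1} \<Longrightarrow> K u = 0"
  obtains B where "\<And>x. \<bar>K x\<bar> \<le> B"
    and "\<And>e. 0 < e \<Longrightarrow> \<exists>N>0. \<forall>x y. \<bar>x - y\<bar> \<le> 2 / real N \<longrightarrow> -1 \<le> x \<longrightarrow> x \<le> 1 \<longrightarrow> -1 \<le> y \<longrightarrow> y \<le> 1 \<longrightarrow> \<bar>K x - K y\<bar> \<le> e"
proof -
  have c: "continuous_on {-1..1} K" using cont by (rule continuous_on_subset) auto
  have "bounded (K ` {-1..1})" by (intro compact_imp_bounded compact_continuous_image c) auto
  then obtain B where B: "\<And>x. x \<in> {-1..1} \<Longrightarrow> \<bar>K x\<bar> \<le> B"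
    unfolding bounded_iff by (metis image_eqI real_norm_def)
  have B2: "\<bar>K x\<bar> \<le> B" for x
    using B[of x] B[of 0] K0[of x] by (cases "x \<in> {-1<..<1}") auto
  have uc: "uniformly_continuous_on {-1..1} K" using c by (rule compact_uniformly_continuous) auto
  have "\<exists>N>0. \<forall>x y. \<bar>x - y\<bar> \<le> 2 / real N \<longrightarrow> -1 \<le> x \<longrightarrow> x \<le> 1 \<longrightarrow> -1 \<le> y \<longrightarrow> y \<le> 1 \<longrightarrow> \<bar>K x - K y\<bar> \<le> e" if e: "0 < e" for e
  proof -
    obtain d where d: "0 < d" "\<And>x y. x \<in> {-1..1} \<Longrightarrow> y \<in> {-1..1} \<Longrightarrow> dist y x < d \<Longrightarrow> dist (K y) (K x) < e"
      using uc e unfolding uniformly_continuous_on_def by metis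
    obtain N where N: "2 / d < real N" using reals_Archimedean2 by blast
    have N0: "0 < N" using N d by (cases N) (auto simp: divide_less_0_iff)
    have "2 / real N < d" using N N0 d by (simp add: field_simps)
    then have "\<forall>x y. \<bar>x - y\<bar> \<le> 2 / real N \<longrightarrow> -1 \<le> x \<longrightarrow> x \<le> 1 \<longrightarrow> -1 \<le> y \<longrightarrow> y \<le> 1 \<longrightarrow> \<bar>K x - K y\<bar> \<le> e"
      using d(2) by (force simp: dist_real_def)
    then show ?thesis using N0 by blast
  qed
  with B2 show ?thesis by (rule that)
qed

text \<open>The kernel integrals against \<open>P\<close> and against Lebesgue measure are compared
  with step sums over the same partition of \<open>[-1, 1]\<close>. The number \<open>N\<close> of
  cells depends on the kernel and on \<open>e\<close> only, so a fixed number of increments of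
  \<open>P\<close> over lengths \<open>2 * h / N\<close> has to be known.\<close>

lemma kernel_estimate_near:
  fixes K :: "real \<Rightarrow> real" and P :: "real pmf"
  assumes cont: "continuous_on UNIV K" and K0: "\<And>u. u \<notin> {-1<..<1} \<Longrightarrow> K u = 0"
    and K1: "(LINT u|lborel. K u) = 1" and KB: "\<And>x. \<bar>K x\<bar> \<le> B"
    and N: "0 < N" and osc: "\<And>x y. \<bar>x - y\<bar> \<le> 2 / real N \<Longrightarrow> -1 \<le> x \<Longrightarrow> x \<le> 1 \<Longrightarrow> -1 \<le> y \<Longrightarrow> y \<le> 1 \<Longrightarrow> \<bar>K x - K y\<bar> \<le> e"
    and Ppos: "\<And>s. s \<in> set_pmf P \<Longrightarrow> 0 < s" and h: "0 < h" and G: "0 \<le> G" and e: "0 \<le> e"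
    and near: "\<And>x y. t - h \<le> x \<Longrightarrow> y \<le> t + h \<Longrightarrow> y - x = 2 * h / real N \<Longrightarrow>
        \<bar>measure (measure_pmf P) {x<..y} - G * (y - x)\<bar> \<le> \<delta> * h"
  shows "\<bar>kernel_estimate K h P t - G\<bar> \<le> 4 * e * G + real N * \<delta> * (e + B)"
proof -
  define u where "u j = -1 + 2 * real j / real N" for j :: nat
  have u: "mono u" using N by (auto simp: mono_def u_def divide_right_mono)
  have u0: "u 0 = -1" "u N = 1" using N by (auto simp: u_def)
  have uS: "u (Suc j) - u j = 2 / real N" for j by (simp add: u_def add_divide_distrib[symmetric] diff_divide_distrib[symmetric])
  have ub: "-1 \<le> u j" "u (Suc j) \<le> 1" "u j \<le> 1" if "j < N" for j
    using that monoD[OF u, of 0 j] monoD[OF u, of "Suc j" N] monoD[OF u, of j N] u0 by auto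
  have [measurable]: "K \<in> borel_measurable borel" using cont by (rule borel_measurable_continuous_onI)
  have K00: "K x = 0" if "x \<notin> {u 0..<u N}" for x using that u0 by (intro K0) auto
  have oscu: "\<bar>K x - K (u j)\<bar> \<le> e" if "j < N" "u j \<le> x" "x < u (Suc j)" for j x
    using that ub[OF that(1)] uS[of j] by (intro osc) auto
  have B: "0 \<le> B" using KB[of 0] by simp
  define C where "C j = {s. u j \<le> (t - s) / h \<and> (t - s) / h < u (Suc j)}" for j
  \<comment> \<open>The map \<open>s \<mapsto> (t - s) / h\<close> reverses the order, so cells
    closed on the left become intervals closed on the right, the form in which increments are
    controlled.\<close>
  have C: "C j = {t - h * u (Suc j)<..t - h * u j}" for j
    using h by (auto simp: C_def field_simps)
  have near_C: "\<bar>measure (measure_pmf P) (C j) - G * (2 * h / real N)\<bar> \<le> \<delta> * h" if j: "j < N" for j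
  proof -
    have eq: "(t - h * u j) - (t - h * u (Suc j)) = 2 * h / real N"
    proof -
      have "(t - h * u j) - (t - h * u (Suc j)) = h * (u (Suc j) - u j)" by (simp add: algebra_simps)
      then show ?thesis by (simp add: uS)
    qed
    have "h * u (Suc j) \<le> h * 1" "h * (-1) \<le> h * u j"
      using ub[OF j] h by (intro mult_left_mono; simp)+
    then show ?thesis unfolding C using near[OF _ _ eq] eq by simp
  qed
  define I where "I = (\<integral>s. K ((t - s) / h) \<partial>measure_pmf P)"
  have ke: "kernel_estimate K h P t = I / h"
  proof -
    have "(LINT s:{0<..}|measure_pmf P. K ((t - s) / h)) = I"
      unfolding I_def set_lebesgue_integral_def
      by (rule integral_cong_AE) (auto simp: AE_measure_pmf_iff Ppos)
    then show ?thesis by (simp add: kernel_estimate_def)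
  qed
  have 1: "\<bar>I - (\<Sum>j<N. K (u j) * measure (measure_pmf P) (C j))\<bar> \<le> e * (\<Sum>j<N. measure (measure_pmf P) (C j))"
    using integral_near_step_sum[of "\<lambda>s. (t - s) / h" "measure_pmf P" K u N B e, OF _ _ u K00 KB oscu]
    unfolding I_def C_def by (simp add: measure_pmf.emeasure_eq_measure)
  have 2: "\<bar>1 - (\<Sum>j<N. K (u j) * (2 / real N))\<bar> \<le> e * 2"
  proof -
    have m: "{x \<in> space lborel. u j \<le> x \<and> x < u (Suc j)} = {u j..<u (Suc j)}" for j by auto
    have le: "u j \<le> u (Suc j)" for j using u by (auto simp: mono_def)
    have "\<bar>(\<integral>x. K x \<partial>lborel) - (\<Sum>j<N. K (u j) * measure lborel {x \<in> space lborel. u j \<le> x \<and> x < u (Suc j)})\<bar>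
      \<le> e * (\<Sum>j<N. measure lborel {x \<in> space lborel. u j \<le> x \<and> x < u (Suc j)})"
      by (rule integral_near_step_sum[of "\<lambda>x. x" lborel K u N B e, OF _ _ u K00 KB oscu]) (auto simp: m[simplified] le)
    then show ?thesis unfolding m using le N by (simp add: uS K1)
  qed
  have 3: "(\<Sum>j<N. measure (measure_pmf P) (C j)) \<le> h * (2 * G + real N * \<delta>)"
  proof -
    have "(\<Sum>j<N. measure (measure_pmf P) (C j)) \<le> (\<Sum>j<N. G * (2 * h / real N) + \<delta> * h)"
    proof (rule sum_mono)
      fix j assume "j \<in> {..<N}"
      then have "\<bar>measure (measure_pmf P) (C j) - G * (2 * h / real N)\<bar> \<le> \<delta> * h" by (intro near_C) simp
      then show "measure (measure_pmf P) (C j) \<le> G * (2 * h / real N) + \<delta> * h" by linarith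
    qed
    also have "\<dots> = h * (2 * G + real N * \<delta>)" using N by (simp add: field_simps)
    finally show ?thesis .
  qed
  have 4: "\<bar>(\<Sum>j<N. K (u j) * measure (measure_pmf P) (C j)) - G * h * (\<Sum>j<N. K (u j) * (2 / real N))\<bar> \<le> h * (real N * B * \<delta>)"
  proof -
    have "(\<Sum>j<N. K (u j) * measure (measure_pmf P) (C j)) - G * h * (\<Sum>j<N. K (u j) * (2 / real N))
       = (\<Sum>j<N. K (u j) * (measure (measure_pmf P) (C j) - G * (2 * h / real N)))"
      by (simp add: sum_distrib_left sum_subtractf[symmetric] algebra_simps)
    also have "\<bar>\<dots>\<bar> \<le> (\<Sum>j<N. B * (\<delta> * h))"
      using near_C KB B by (intro order.trans[OF sum_abs] sum_mono) (auto simp: abs_mult intro!: mult_mono)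
    finally show ?thesis by (simp add: mult_ac)
  qed
  have 5: "\<bar>G * h * (\<Sum>j<N. K (u j) * (2 / real N)) - G * h\<bar> \<le> h * (2 * e * G)"
  proof -
    have "\<bar>G * h * (\<Sum>j<N. K (u j) * (2 / real N)) - G * h\<bar> = G * h * \<bar>1 - (\<Sum>j<N. K (u j) * (2 / real N))\<bar>"
    proof -
      have "G * h * s - G * h = G * h * (s - 1)" for s by (simp add: algebra_simps)
      then show ?thesis using G h by (simp only: abs_mult abs_minus_commute[of 1])
    qed
    also have "\<dots> \<le> G * h * (e * 2)" using 2 G h by (intro mult_left_mono) auto
    finally show ?thesis by (simp add: mult_ac)
  qed
  have "e * (\<Sum>j<N. measure (measure_pmf P) (C j)) \<le> e * (h * (2 * G + real N * \<delta>))"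
    using 3 e by (rule mult_left_mono)
  then have "\<bar>I - G * h\<bar> \<le> e * (h * (2 * G + real N * \<delta>)) + h * (real N * B * \<delta>) + h * (2 * e * G)"
    using 1 4 5 by linarith
  also have "\<dots> = h * (4 * e * G + real N * \<delta> * (e + B))" by (simp add: algebra_simps)
  finally have "\<bar>I - G * h\<bar> / h \<le> 4 * e * G + real N * \<delta> * (e + B)" using h by (simp add: pos_divide_le_eq mult.commute)
  moreover have "\<bar>I - G * h\<bar> / h = \<bar>I / h - G\<bar>"
  proof -
    have "I / h - G = (I - G * h) / h" using h by (simp add: diff_divide_distrib)
    then show ?thesis using h by (simp add: abs_divide)
  qed
  ultimately show ?thesis by (simp add: ke)
qed

lemma measure_pmf_diff_le:
  fixes P E :: "real pmf"
  assumes fin: "finite (set_pmf P)" "finite (set_pmf E)"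
    and near: "\<And>t. t \<in> I \<Longrightarrow> \<bar>pmf P t - pmf E t\<bar> \<le> \<epsilon> * pmf E t"
  shows "\<bar>measure (measure_pmf P) I - measure (measure_pmf E) I\<bar> \<le> \<epsilon> * measure (measure_pmf E) I"
proof -
  define T where "T = (set_pmf P \<union> set_pmf E) \<inter> I"
  have T: "finite T" using fin by (simp add: T_def)
  have P: "measure (measure_pmf P) I = sum (pmf P) T"
    unfolding measure_measure_pmf_finite[OF T, symmetric]
    by (rule measure_eq_AE) (auto simp: T_def AE_measure_pmf_iff)
  have E: "measure (measure_pmf E) I = sum (pmf E) T"
    unfolding measure_measure_pmf_finite[OF T, symmetric]
    by (rule measure_eq_AE) (auto simp: T_def AE_measure_pmf_iff)
  have "\<bar>sum (pmf P) T - sum (pmf E) T\<bar> = \<bar>\<Sum>t\<in>T. pmf P t - pmf E t\<bar>" by (simp add: sum_subtractf)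
  also have "\<dots> \<le> (\<Sum>t\<in>T. \<epsilon> * pmf E t)"
    using near by (intro order.trans[OF sum_abs] sum_mono) (auto simp: T_def)
  finally show ?thesis by (simp add: P E sum_distrib_left)
qed

text \<open>An increment of \<open>P\<close> is compared with that of \<open>E\<close>, then of
  \<open>Q\<close>, then with \<open>g t\<close> times the length. The relative closeness of masses
  is decisive in the first comparison: the \<open>E\<close>-mass of a window is itself of order
  \<open>h\<close>.\<close>

theorem (in censoring_limit) kernel_estimate_uniform:
  fixes g K :: "real \<Rightarrow> real" and h :: "nat \<Rightarrow> real"
  assumes b: "0 < b" "b < \<tau>" and g: "\<And>t. 0 \<le> t \<Longrightarrow> t \<le> b \<Longrightarrow> 0 \<le> g t \<and> g t \<le> gm"
    and gloc: "\<And>\<epsilon>. 0 < \<epsilon> \<Longrightarrow> \<exists>d>0. \<forall>t\<in>{0..b}. \<forall>x y. x \<le> y \<longrightarrow> t - d \<le> x \<longrightarrow> y \<le> t + d \<longrightarrow>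
        \<bar>measure Q {x<..y} - g t * (y - x)\<bar> \<le> \<epsilon> * (y - x)"
    and h: "\<And>k. 0 < h k" "h \<longlonglongrightarrow> 0"
    and devh: "\<And>C \<delta>. 0 < \<delta> \<Longrightarrow> \<forall>\<^sub>F k in sequentially. \<forall>I. is_interval I \<longrightarrow> measure Q I \<le> C * h k \<longrightarrow>
        \<bar>measure (measure_pmf (E k)) I - measure Q I\<bar> \<le> \<delta> * h k"
    and cont: "continuous_on UNIV K" and K0: "\<And>u. u \<notin> {-1<..<1} \<Longrightarrow> K u = 0"
    and K1: "(LINT u|lborel. K u) = 1" and \<epsilon>: "0 < \<epsilon>"
  shows "\<forall>\<^sub>F k in sequentially. \<forall>t\<in>{0..b}. \<bar>kernel_estimate K (h k) (P k) t - g t\<bar> \<le> \<epsilon>"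
proof -
  have gm: "0 \<le> gm" using g[of 0] b by simp
  obtain B where KB: "\<And>x. \<bar>K x\<bar> \<le> B"
    and uc: "\<And>e. 0 < e \<Longrightarrow> \<exists>N>0. \<forall>x y. \<bar>x - y\<bar> \<le> 2 / real N \<longrightarrow> -1 \<le> x \<longrightarrow> x \<le> 1 \<longrightarrow> -1 \<le> y \<longrightarrow> y \<le> 1 \<longrightarrow> \<bar>K x - K y\<bar> \<le> e"
    using compactly_supported_kernel_bounds[OF cont K0] by blast
  have B: "0 \<le> B" using KB[of 0] by simp
  define e where "e = \<epsilon> / (8 * (gm + 1))"
  have e: "0 < e" using \<epsilon> gm by (simp add: e_def)
  have e2: "4 * e * gm \<le> \<epsilon> / 2" using \<epsilon> gm by (simp add: e_def field_simps)
  obtain N where N: "0 < N" and osc: "\<And>x y. \<bar>x - y\<bar> \<le> 2 / real N \<Longrightarrow> -1 \<le> x \<Longrightarrow> x \<le> 1 \<Longrightarrow> -1 \<le> y \<Longrightarrow> y \<le> 1 \<Longrightarrow> \<bar>K x - K y\<bar> \<le> e"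
    using uc[OF e] by blast
  have N1: "2 / real N \<le> 2" using N by (simp add: field_simps)
  define \<delta> where "\<delta> = \<epsilon> / (2 * (real N * (e + B)))"
  have eB: "0 < real N * (e + B)" using N e B by simp
  have \<delta>: "0 < \<delta>" using \<epsilon> eB by (simp add: \<delta>_def)
  have \<delta>2: "real N * \<delta> * (e + B) = \<epsilon> / 2"
  proof -
    have "real N * \<delta> * (e + B) = \<delta> * (real N * (e + B))" by (simp add: mult_ac)
    also have "\<dots> = \<epsilon> / 2" using eB unfolding \<delta>_def by (simp add: field_simps)
    finally show ?thesis .
  qed
  \<comment> \<open>\<open>e1\<close>, \<open>e3\<close> and \<open>e4\<close> give each of the
    three comparisons an error of at most \<open>\<delta> / 3 * h k\<close>. A window has length at
    most \<open>2 * h k\<close>, hence \<open>Q\<close>-mass at most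
    \<open>2 * (gm + 1) * h k\<close> and \<open>E\<close>-mass at most
    \<open>(2 * gm + 3) * h k\<close>.\<close>
  define e1 where "e1 = \<delta> / (3 * (2 * gm + 3))"
  have e1: "0 < e1" using \<delta> gm by (simp add: e1_def)
  define e3 where "e3 = min 1 (\<delta> / 6)"
  have e3: "0 < e3" "e3 \<le> 1" "e3 \<le> \<delta> / 6" using \<delta> by (auto simp: e3_def)
  define e4 where "e4 = min 1 (\<delta> / 3)"
  have e4: "0 < e4" "e4 \<le> 1" "e4 \<le> \<delta> / 3" using \<delta> by (auto simp: e4_def)
  obtain d where d: "0 < d" "\<And>t x y. t \<in> {0..b} \<Longrightarrow> x \<le> y \<Longrightarrow> t - d \<le> x \<Longrightarrow> y \<le> t + d \<Longrightarrow>
        \<bar>measure Q {x<..y} - g t * (y - x)\<bar> \<le> e3 * (y - x)"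
    using gloc[OF e3(1)] by metis
  \<comment> \<open>Windows around \<open>t \<le> b\<close> extend beyond \<open>b\<close> by at
    most \<open>h k\<close>, so the masses must be compared up to some point strictly between
    \<open>b\<close> and \<tau>.\<close>
  define c where "c = (b + \<tau>) / 2"
  have c: "0 < c" "c < \<tau>" "b < c" using b by (auto simp: c_def)
  have "\<forall>\<^sub>F k in sequentially. h k < min d (c - b)"
    using d c by (intro order_tendstoD(2)[OF h(2)]) auto
  with devh[OF e4(1), of "2 * (gm + 1)"] masses_near_empirical[OF c(1,2) e1] score show ?thesis
  proof eventually_elim
    case (elim k)
    interpret s: score_equation "E k" "F k" "P k" "a k" "\<gamma> k" by (rule elim(3))
    have hk: "0 < h k" "h k < d" "h k < c - b" using h elim(4) by auto
    show ?case
    proof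
      fix t assume t: "t \<in> {0..b}"
      have gt: "0 \<le> g t" "g t \<le> gm" using g t by auto
      have "\<bar>kernel_estimate K (h k) (P k) t - g t\<bar> \<le> 4 * e * g t + real N * \<delta> * (e + B)"
      proof (rule kernel_estimate_near[OF cont K0 K1 KB N osc s.Ppos hk(1) gt(1)])
        fix x y assume xy: "t - h k \<le> x" "y \<le> t + h k" "y - x = 2 * h k / real N"
        let ?I = "{x<..y}"
        have len: "0 \<le> y - x" "y - x \<le> 2 * h k"
          using xy(3) N1 hk mult_right_mono[OF N1, of "h k"] by auto
        have q: "\<bar>measure Q ?I - g t * (y - x)\<bar> \<le> e3 * (y - x)"
          using xy(1,2) len hk t by (intro d(2)) auto
        have e3l: "e3 * (y - x) \<le> e3 * (2 * h k)" "g t * (y - x) \<le> gm * (2 * h k)"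
          using len e3 gt gm hk by (auto intro!: mult_left_mono mult_mono)
        have e3m: "e3 * (2 * h k) \<le> 1 * (2 * h k)" "e3 * (2 * h k) \<le> \<delta> / 6 * (2 * h k)"
          using e3 hk by (auto intro!: mult_right_mono)
        have Qle: "measure Q ?I \<le> 2 * (gm + 1) * h k" using q e3l e3m by (simp add: algebra_simps)
        have Eq: "\<bar>measure (measure_pmf (E k)) ?I - measure Q ?I\<bar> \<le> e4 * h k"
          using elim(1) Qle by (simp add: is_interval_oc)
        have e4m: "e4 * h k \<le> 1 * h k" "e4 * h k \<le> \<delta> / 3 * h k"
          using e4 hk by (auto intro!: mult_right_mono)
        have Ele: "measure (measure_pmf (E k)) ?I \<le> (2 * gm + 3) * h k" using Eq Qle e4m by (simp add: algebra_simps)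
        have "\<bar>measure (measure_pmf (P k)) ?I - measure (measure_pmf (E k)) ?I\<bar> \<le> e1 * measure (measure_pmf (E k)) ?I"
          using elim(2) xy t hk by (intro measure_pmf_diff_le s.finP s.finE) auto
        also have "\<dots> \<le> e1 * ((2 * gm + 3) * h k)" using Ele e1 by (intro mult_left_mono) auto
        also have "\<dots> = \<delta> / 3 * h k" using gm by (simp add: e1_def field_simps)
        finally have "\<bar>measure (measure_pmf (P k)) ?I - measure (measure_pmf (E k)) ?I\<bar> \<le> \<delta> / 3 * h k" .
        then show "\<bar>measure (measure_pmf (P k)) ?I - g t * (y - x)\<bar> \<le> \<delta> * h k"
          using Eq q e3l e3m e4m by linarith
      qed (use e in auto)
      also have "\<dots> \<le> 4 * e * gm + \<epsilon> / 2" using gt e unfolding \<delta>2 by simp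
      also have "\<dots> \<le> \<epsilon>" using e2 by simp
      finally show "\<bar>kernel_estimate K (h k) (P k) t - g t\<bar> \<le> \<epsilon>" .
    qed
  qed
qed

section \<open>The limiting laws\<close>

lemma measure_empirical:
  assumes "0 < N"
  shows "measure (measure_pmf (empirical N x)) I = (\<Sum>i<N. indicator I (x i)) / real N"
proof -
  have "measure (measure_pmf (empirical N x)) I = measure (measure_pmf (pmf_of_set {..<N})) (x -` I)"
    by (simp add: empirical_def)
  also have "\<dots> = real (card ({..<N} \<inter> x -` I)) / real N"
    using assms by (subst measure_pmf_of_set) auto
  also have "real (card ({..<N} \<inter> x -` I)) = (\<Sum>i<N. indicator (x -` I) i)"
    by (simp add: indicator_def of_bool_def sum.If_cases Int_def)
  finally show ?thesis by (simp add: indicator_vimage)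
qed

lemma set_pmf_empirical: "0 < N \<Longrightarrow> set_pmf (empirical N x) = x ` {..<N}"
  by (subst empirical_def, subst set_map_pmf, subst set_pmf_of_set) auto

lemma score_solution_imp_score_equation:
  assumes sol: "score_solution m n x y \<gamma> P" and mn: "0 < m" "0 < n" and x: "\<And>i. 0 < x i" and \<gamma>: "0 < \<gamma>"
  shows "score_equation (empirical m x) (empirical n y) P (real m / real (m + n)) \<gamma>"
proof
  have sub: "set_pmf P \<subseteq> x ` {..<m} \<union> y ` {..<n}" and cdf0: "\<And>u. u < \<gamma> \<Longrightarrow> cdf (measure_pmf P) u = 0"
    using sol by (auto simp: score_solution_def Let_def)
  show "finite (set_pmf (empirical m x))" "finite (set_pmf (empirical n y))"
    using mn by (auto simp: set_pmf_empirical)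
  show "finite (set_pmf P)" using sub by (rule finite_subset) auto
  show "0 < t" if "t \<in> set_pmf (empirical m x)" for t using that mn x by (auto simp: set_pmf_empirical)
  show "0 < real m / real (m + n)" "real m / real (m + n) \<le> 1" "0 < \<gamma>" using mn \<gamma> by auto
  show "\<gamma> \<le> t" if "t \<in> set_pmf P" for t
  proof (rule ccontr)
    assume "\<not> \<gamma> \<le> t"
    then have "measure (measure_pmf P) {..t} = 0" using cdf0[of t] by (simp add: cdf_def)
    then have "measure (measure_pmf P) {t} \<le> 0"
      using measure_pmf.finite_measure_mono[of "{t}" "{..t}" P] by simp
    then show False using that pmf_positive[of t P] by (simp add: measure_pmf_single)
  qed
  show "pmf P t = real m / real (m + n) * pmf (empirical m x) t
      + (1 - real m / real (m + n)) * (LINT v:{0<..t}|measure_pmf (empirical n y). 1 / inv_tail (measure_pmf P) v) * (1 / t) * pmf P t"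
    if "0 \<le> t" for t
    using sol that unfolding score_solution_def Let_def inv_tail_def by blast
qed

lemma AE_positive_of_cdf:
  assumes "real_distribution Q" and Q0: "cdf Q 0 = 0"
  shows "AE z in Q. 0 < z"
proof -
  interpret Q: real_distribution Q by fact
  have "AE z in Q. z \<notin> {..0}" using Q0 by (intro AE_not_in null_setsI) (auto simp: cdf_def Q.emeasure_eq_measure)
  then show ?thesis by eventually_elim auto
qed

context
  fixes Q :: "real measure" and \<tau> :: real
  assumes Q: "real_distribution Q" and Q0: "cdf Q 0 = 0" and intQ: "integrable Q (\<lambda>z. 1 / z)"
    and bdd: "bdd_above {t. cdf Q t < 1}" and \<tau>: "\<tau> = Sup {t. cdf Q t < 1}" and \<tau>0: "0 < \<tau>"
begin

interpretation Q: real_distribution Q by (rule Q)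

lemmas posQ = AE_positive_of_cdf[OF Q Q0]

lemma cdf_less_1_below: "c < \<tau> \<Longrightarrow> cdf Q c < 1"
proof -
  assume c: "c < \<tau>"
  have "{t. cdf Q t < 1} \<noteq> {}" using Q0 by (auto intro!: exI[of _ 0])
  then obtain t where "cdf Q t < 1" "c < t" using c bdd less_cSup_iff[of "{t. cdf Q t < 1}" c] by (auto simp: \<tau>)
  then show "cdf Q c < 1" using Q.cdf_nondecreasing[of c t] by simp
qed

text \<open>If the integral vanished, \<open>Q\<close> would be carried by \<open>{..c}\<close>, so
  its distribution function would reach 1 at a point below \<tau>.\<close>

lemma inv_tail_pos:
  assumes c: "c < \<tau>"
  shows "0 < inv_tail Q c"
proof (rule ccontr)
  assume "\<not> 0 < inv_tail Q c"
  then have "(\<integral>z. indicator {c..} z *\<^sub>R (1 / z) \<partial>Q) = 0"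
    using inv_tail_nonneg[OF posQ, of c] by (simp add: inv_tail_def set_lebesgue_integral_def)
  moreover have "integrable Q (\<lambda>z. indicator {c..} z *\<^sub>R (1 / z))" using inv_tail_integrable[OF _ intQ, of c] by simp
  moreover have "AE z in Q. 0 \<le> indicator {c..} z *\<^sub>R (1 / z)"
    using posQ by eventually_elim (auto split: split_indicator)
  ultimately have "AE z in Q. indicator {c..} z *\<^sub>R (1 / z) = 0" by (simp add: integral_nonneg_eq_0_iff_AE)
  with posQ have "AE z in Q. z \<in> {..c}"
    by eventually_elim (auto split: split_indicator_asm)
  then have "measure Q {..c} = 1" by (subst (asm) Q.AE_in_set_eq_1) auto
  then show False using cdf_less_1_below[OF c] by (simp add: cdf_def)
qed

lemma inv_tail_eq_0:
  assumes y: "\<tau> < y"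
  shows "inv_tail Q y = 0"
proof -
  \<comment> \<open>Above \<tau> the distribution function is 1 at \<open>u\<close>, and
    \<open>u < y\<close> keeps \<open>{..u}\<close> disjoint from the closed tail
    \<open>{y..}\<close>.\<close>
  define u where "u = (\<tau> + y) / 2"
  have u: "\<tau> < u" "u < y" using y by (auto simp: u_def)
  have "\<not> cdf Q u < 1" using u cSup_upper[OF _ bdd, of u] by (auto simp: \<tau>)
  then have "measure Q {..u} = 1" using Q.prob_le_1[of "{..u}"] by (simp add: cdf_def)
  then have "AE z in Q. z \<in> {..u}" by (subst Q.AE_in_set_eq_1) auto
  then have "AE z in Q. indicator {y..} z *\<^sub>R (1 / z) = 0"
    by eventually_elim (use u in \<open>auto split: split_indicator\<close>)
  then show ?thesis unfolding inv_tail_def set_lebesgue_integral_def by (rule integral_eq_zero_AE)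
qed

context
  fixes FL :: "real measure"
  assumes FL: "FL = density lborel (\<lambda>y. ennreal (indicator {0..} y * inv_tail Q y))"
    and FLprob: "prob_space FL"
begin

interpretation FL: real_distribution FL
  using FLprob by (auto simp: real_distribution_def real_distribution_axioms_def FL)

lemma inv_tail_Q_measurable: "inv_tail Q \<in> borel_measurable borel"
  using borel_measurable_mono[of "\<lambda>u. - inv_tail Q u"] inv_tail_antimono[OF _ intQ posQ] by (simp add: monotone_def)

lemma censored_cdf_continuous: "continuous_on UNIV (cdf FL)"
proof -
  note [measurable] = inv_tail_Q_measurable
  have "emeasure FL {x} = 0" for x
  proof -
    have "AE s in lborel. ennreal (indicator {0..} s * inv_tail Q s) * indicator {x} s = 0"
      using AE_lborel_singleton[of x] by eventually_elim simp
    then show ?thesis unfolding FL by (subst emeasure_density) (auto simp: nn_integral_0_iff_AE)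
  qed
  then have "isCont (cdf FL) x" for x by (simp add: FL.isCont_cdf measure_def)
  then show ?thesis by (simp add: continuous_on_eq_continuous_within)
qed

text \<open>\<open>FL\<close> has no mass outside the interval from 0 to \<tau> and no atoms, so the
  mass of \<open>{0<..c}\<close> tends to 1 as \<open>c\<close> increases to \<tau>.\<close>

lemma censored_exhaust:
  assumes "\<rho> < 1"
  shows "\<exists>c. 0 < c \<and> c < \<tau> \<and> \<rho> < measure FL {0<..c}"
proof -
  note [measurable] = inv_tail_Q_measurable
  have "AE s in lborel. ennreal (indicator {0..} s * inv_tail Q s) * indicator {..0} s = 0"
    using AE_lborel_singleton[of 0] by eventually_elim (auto split: split_indicator)
  then have "emeasure FL {..0} = 0" unfolding FL by (subst emeasure_density) (auto simp: nn_integral_0_iff_AE)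
  then have z: "cdf FL 0 = 0" by (simp add: cdf_def measure_def)
  have "AE s in lborel. ennreal (indicator {0..} s * inv_tail Q s) * indicator {\<tau><..} s = 0"
    by (rule AE_I2) (auto simp: inv_tail_eq_0 split: split_indicator)
  then have "emeasure FL {\<tau><..} = 0" unfolding FL by (subst emeasure_density) (auto simp: nn_integral_0_iff_AE)
  moreover have "{..\<tau>} = space FL - {\<tau><..}" by auto
  ultimately have "cdf FL \<tau> = 1" using FL.prob_compl[of "{\<tau><..}"] by (simp add: cdf_def measure_def)
  moreover have "isCont (cdf FL) \<tau>" using censored_cdf_continuous by (simp add: continuous_on_eq_continuous_at)
  ultimately have "(cdf FL \<longlongrightarrow> 1) (at_left \<tau>)" by (metis continuous_within filterlim_at_split isContD)
  then have "\<forall>\<^sub>F c in at_left \<tau>. \<rho> < cdf FL c" using assms by (rule order_tendstoD)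
  moreover have "\<forall>\<^sub>F c in at_left \<tau>. c \<in> {0<..<\<tau>}" using \<tau>0 by (rule eventually_at_left_real)
  ultimately have "\<forall>\<^sub>F c in at_left \<tau>. \<rho> < cdf FL c \<and> c \<in> {0<..<\<tau>}" by eventually_elim auto
  then obtain c where "\<rho> < cdf FL c" "c \<in> {0<..<\<tau>}"
    using eventually_happens[of _ "at_left \<tau>"] by (auto simp: trivial_limit_at_left_real)
  moreover from this have "measure FL {0<..c} = cdf FL c - cdf FL 0" by (intro FL.cdf_diff_eq[symmetric]) auto
  ultimately show ?thesis using z by auto
qed

end

end

text \<open>A positive \<open>g 0\<close> would make \<open>cdf Q x\<close> at least
  \<open>x * g 0 / 2\<close> near 0, contradicting the decay of order
  \<open>x powr \<alpha>0\<close>. Hence \<open>g 0 = 0\<close>, the extension of \<open>g\<close>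
  by 0 is continuous across the origin, and uniform continuity on \<open>{-1..c}\<close> also covers
  windows that straddle 0.\<close>

lemma density_interval_near:
  fixes Q :: "real measure" and g :: "real \<Rightarrow> real"
  assumes Q: "real_distribution Q" and Q0: "cdf Q 0 = 0"
    and gm[measurable]: "g \<in> borel_measurable borel" and g0: "\<And>x. 0 \<le> g x" and dens: "Q = density lborel (\<lambda>x. ennreal (g x))"
    and cont: "continuous_on {0..<\<tau>} g" and \<tau>: "0 < \<tau>"
    and \<alpha>: "2 < \<alpha>0" and lim: "((\<lambda>x. cdf Q x / x powr \<alpha>0) \<longlongrightarrow> L) (at_right 0)"
    and b: "0 < b" "b < \<tau>" and \<epsilon>: "0 < \<epsilon>"
  shows "\<exists>d>0. \<forall>t\<in>{0..b}. \<forall>x y. x \<le> y \<longrightarrow> t - d \<le> x \<longrightarrow> y \<le> t + d \<longrightarrow>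
        \<bar>measure Q {x<..y} - g t * (y - x)\<bar> \<le> \<epsilon> * (y - x)"
proof -
  interpret Q: real_distribution Q by (rule Q)
  define g' where "g' x = indicator {0<..} x * g x" for x
  have [measurable]: "g' \<in> borel_measurable borel" unfolding g'_def by measurable
  have g'0: "0 \<le> g' x" for x using g0 by (simp add: g'_def)
  have Qm: "emeasure Q {x<..y} = (\<integral>\<^sup>+s. ennreal (g' s) * indicator {x<..y} s \<partial>lborel)" for x y
  proof -
    have "emeasure Q {x<..y} = emeasure Q ({x<..y} \<inter> {0<..})"
    proof (rule emeasure_eq_AE)
      have "AE z in Q. 0 < z" by (rule AE_positive_of_cdf[OF Q Q0])
      then show "AE s in Q. s \<in> {x<..y} \<longleftrightarrow> s \<in> {x<..y} \<inter> {0<..}" by eventually_elim auto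
    qed auto
    also have "\<dots> = (\<integral>\<^sup>+s. ennreal (g s) * indicator ({x<..y} \<inter> {0<..}) s \<partial>lborel)"
      unfolding dens by (subst emeasure_density) auto
    also have "\<dots> = (\<integral>\<^sup>+s. ennreal (g' s) * indicator {x<..y} s \<partial>lborel)"
      by (intro nn_integral_cong) (auto simp: g'_def split: split_indicator)
    finally show ?thesis .
  qed
  have upper: "measure Q {x<..y} \<le> c * (y - x)" if "x \<le> y" "0 \<le> c" "\<And>s. x < s \<Longrightarrow> s \<le> y \<Longrightarrow> g' s \<le> c" for x y c
  proof -
    have "emeasure Q {x<..y} \<le> (\<integral>\<^sup>+s. ennreal c * indicator {x<..y} s \<partial>lborel)"
      unfolding Qm using that by (intro nn_integral_mono) (auto split: split_indicator intro!: ennreal_leI)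
    also have "\<dots> = ennreal (c * (y - x))" using that by (simp add: nn_integral_cmult_indicator ennreal_mult)
    finally show ?thesis using that by (simp add: Q.emeasure_eq_measure)
  qed
  have lower: "c * (y - x) \<le> measure Q {x<..y}" if "x \<le> y" "\<And>s. x < s \<Longrightarrow> s \<le> y \<Longrightarrow> c \<le> g' s" for x y c
  proof (cases "0 \<le> c")
    case True
    have "ennreal (c * (y - x)) = (\<integral>\<^sup>+s. ennreal c * indicator {x<..y} s \<partial>lborel)"
      using that True by (simp add: nn_integral_cmult_indicator ennreal_mult)
    also have "\<dots> \<le> emeasure Q {x<..y}"
      unfolding Qm using that by (intro nn_integral_mono) (auto split: split_indicator intro!: ennreal_leI)
    finally show ?thesis by (simp add: Q.emeasure_eq_measure)
  next
    case False
    then have "c * (y - x) \<le> 0" using that by (simp add: mult_nonpos_nonneg)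
    then show ?thesis using measure_nonneg[of Q "{x<..y}"] by linarith
  qed
  have "g 0 = 0"
  proof (rule ccontr)
    assume "g 0 \<noteq> 0"
    then have g00: "0 < g 0" using g0[of 0] by simp
    have "continuous (at 0 within {0..<\<tau>}) g" using cont \<tau> by (simp add: continuous_on_eq_continuous_within)
    then have "\<exists>d>0. \<forall>s\<in>{0..<\<tau>}. dist s 0 < d \<longrightarrow> dist (g s) (g 0) < g 0 / 2"
      using g00 unfolding continuous_within_eps_delta by (auto dest!: spec[of _ "g 0 / 2"])
    then obtain d where d: "0 < d" "\<And>s. s \<in> {0..<\<tau>} \<Longrightarrow> s < d \<Longrightarrow> \<bar>g s - g 0\<bar> < g 0 / 2"
      by (auto simp: dist_real_def)
    have "g 0 / 2 \<le> cdf Q x / x powr \<alpha>0 * x powr (\<alpha>0 - 1)" if x: "0 < x" "x < min d \<tau>" for x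
    proof -
      have "g 0 / 2 * (x - 0) \<le> measure Q {0<..x}"
      proof (rule lower)
        fix s assume s: "0 < s" "s \<le> x"
        have "\<bar>g s - g 0\<bar> < g 0 / 2" using s x by (intro d(2)) auto
        then show "g 0 / 2 \<le> g' s" using s unfolding g'_def by (simp add: abs_if split: if_splits)
      qed (use x in simp)
      also have "\<dots> = cdf Q x" using Q.cdf_diff_eq[of 0 x] x Q0 by simp
      finally have "g 0 / 2 * x \<le> cdf Q x" by simp
      then have "g 0 / 2 \<le> cdf Q x / x" using x by (simp add: pos_le_divide_eq)
      also have "\<dots> = cdf Q x / x powr \<alpha>0 * x powr (\<alpha>0 - 1)" using x by (simp add: powr_diff)
      finally show ?thesis .
    qed
    then have "\<forall>\<^sub>F x in at_right 0. g 0 / 2 \<le> cdf Q x / x powr \<alpha>0 * x powr (\<alpha>0 - 1)"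
      using d(1) \<tau> by (intro eventually_at_rightI[of 0 "min d \<tau>"]) auto
    moreover have "((\<lambda>x. cdf Q x / x powr \<alpha>0 * x powr (\<alpha>0 - 1)) \<longlongrightarrow> L * 0) (at_right 0)"
    proof (intro tendsto_mult lim)
      have "((\<lambda>x. x powr (\<alpha>0 - 1)) \<longlongrightarrow> 0 powr (\<alpha>0 - 1)) (at_right (0::real))"
        using \<alpha> by (intro tendsto_powr' tendsto_intros) (auto simp: eventually_at_filter)
      then show "((\<lambda>x. x powr (\<alpha>0 - 1)) \<longlongrightarrow> 0) (at_right (0::real))" by simp
    qed
    ultimately have "g 0 / 2 \<le> L * 0" by (intro tendsto_lowerbound) auto
    then show False using g00 by simp
  qed
  define c where "c = (b + \<tau>) / 2"
  have c: "b < c" "c < \<tau>" "0 < c" using b by (auto simp: c_def)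
  have "continuous_on ({-1..0} \<union> {0..c}) (\<lambda>x. if x \<le> 0 then 0 else g x)"
  proof (rule continuous_on_cases)
    show "continuous_on {0..c} g" using cont by (rule continuous_on_subset) (use c in auto)
  qed (use \<open>g 0 = 0\<close> in auto)
  then have "continuous_on {-1..c} g'"
    by (rule continuous_on_cong[THEN iffD1, rotated 2]) (use c in \<open>auto simp: g'_def\<close>)
  then have "uniformly_continuous_on {-1..c} g'" by (rule compact_uniformly_continuous) simp
  then have "\<exists>d>0. \<forall>x\<in>{-1..c}. \<forall>x'\<in>{-1..c}. dist x' x < d \<longrightarrow> dist (g' x') (g' x) < \<epsilon>"
    using \<epsilon> unfolding uniformly_continuous_on_def by blast
  then obtain d where d: "0 < d" "\<And>x x'. x \<in> {-1..c} \<Longrightarrow> x' \<in> {-1..c} \<Longrightarrow> \<bar>x' - x\<bar> < d \<Longrightarrow> \<bar>g' x' - g' x\<bar> < \<epsilon>"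
    by (auto simp: dist_real_def)
  define d' where "d' = min (d / 2) (min 1 (c - b))"
  have d': "0 < d'" "d' < d" "d' \<le> 1" "d' \<le> c - b" using d(1) c by (auto simp: d'_def)
  show ?thesis
  proof (intro exI[of _ d'] conjI ballI allI impI)
    fix t x y assume t: "t \<in> {0..b}" and xy: "x \<le> y" "t - d' \<le> x" "y \<le> t + d'"
    have gt: "g' t = g t" using t \<open>g 0 = 0\<close> by (cases "t = 0") (auto simp: g'_def)
    have near: "\<bar>g' s - g t\<bar> < \<epsilon>" if s: "x < s" "s \<le> y" for s
      unfolding gt[symmetric] using s t xy d' c by (intro d(2)) auto
    have "(g t - \<epsilon>) * (y - x) \<le> measure Q {x<..y}"
      by (rule lower[OF xy(1)]) (use near in fastforce)
    moreover have "measure Q {x<..y} \<le> (g t + \<epsilon>) * (y - x)"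
      by (rule upper[OF xy(1)]) (use near g0[of t] \<epsilon> in fastforce)+
    ultimately show "\<bar>measure Q {x<..y} - g t * (y - x)\<bar> \<le> \<epsilon> * (y - x)"
      by (simp add: algebra_simps abs_le_iff)
  qed (use d' in simp)
qed

lemma sup_norm_tendsto_0:
  assumes "B \<noteq> {}" and ev: "\<And>\<epsilon>. 0 < \<epsilon> \<Longrightarrow> \<forall>\<^sub>F k in sequentially. \<forall>t\<in>B. \<bar>u k t\<bar> \<le> \<epsilon>"
  shows "(\<lambda>k. sup_norm_on B (u k)) \<longlonglongrightarrow> 0"
proof (rule order_tendstoI)
  fix a :: ereal assume a: "a < 0"
  obtain t where t: "t \<in> B" using assms(1) by blast
  have "0 \<le> sup_norm_on B (u k)" for k
    unfolding sup_norm_on_def by (rule SUP_upper2[OF t]) simp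
  then show "\<forall>\<^sub>F k in sequentially. a < sup_norm_on B (u k)" using a by (simp add: less_le_trans)
next
  fix a :: ereal assume a: "0 < a"
  then obtain \<epsilon> where \<epsilon>: "0 < ereal \<epsilon>" "ereal \<epsilon> < a" using ereal_dense2 by blast
  have "\<forall>\<^sub>F k in sequentially. \<forall>t\<in>B. \<bar>u k t\<bar> \<le> \<epsilon>" by (rule ev) (use \<epsilon> in simp)
  then show "\<forall>\<^sub>F k in sequentially. sup_norm_on B (u k) < a"
  proof eventually_elim
    case (elim k)
    have "sup_norm_on B (u k) \<le> ereal \<epsilon>" unfolding sup_norm_on_def by (rule SUP_least) (use elim in auto)
    then show ?case using \<epsilon> by simp
  qed
qed

text \<open>Measurable functions of disjoint blocks of an independent family are independent; the
  blocks are \<open>{Inl i}\<close> for \<open>X\<close> and the pair belonging to \<open>j\<close>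
  for the products.\<close>

lemma (in prob_space) indep_vars_components:
  fixes X Z U :: "nat \<Rightarrow> 'a \<Rightarrow> real"
  assumes ind: "indep_vars (\<lambda>_. borel) (case_sum X (case_sum Z U)) (UNIV :: (nat + nat + nat) set)"
  shows "indep_vars (\<lambda>_. borel) X UNIV"
    and "indep_vars (\<lambda>_. borel) (\<lambda>j \<omega>. U j \<omega> * Z j \<omega>) UNIV"
    and "indep_var borel (U j) borel (Z j)"
proof -
  let ?V = "case_sum X (case_sum Z U)"
  have "indep_vars (\<lambda>i. PiM {Inl i} (\<lambda>_. borel)) (\<lambda>i \<omega>. restrict (\<lambda>l. ?V l \<omega>) {Inl i}) UNIV"
    by (rule indep_vars_restrict[OF ind]) (auto simp: disjoint_family_on_def)
  then have "indep_vars (\<lambda>_. borel) (\<lambda>i \<omega>. (\<lambda>v. v (Inl i)) (restrict (\<lambda>l. ?V l \<omega>) {Inl i})) UNIV"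
    by (rule indep_vars_compose2) (auto intro!: measurable_component_singleton)
  then show "indep_vars (\<lambda>_. borel) X UNIV" by simp
  have "indep_vars (\<lambda>j. PiM {Inr (Inl j), Inr (Inr j)} (\<lambda>_. borel)) (\<lambda>j \<omega>. restrict (\<lambda>l. ?V l \<omega>) {Inr (Inl j), Inr (Inr j)}) UNIV"
    by (rule indep_vars_restrict[OF ind]) (auto simp: disjoint_family_on_def)
  then have "indep_vars (\<lambda>_. borel) (\<lambda>j \<omega>. (\<lambda>v. v (Inr (Inr j)) * v (Inr (Inl j))) (restrict (\<lambda>l. ?V l \<omega>) {Inr (Inl j), Inr (Inr j)})) UNIV"
    by (rule indep_vars_compose2) (auto intro!: borel_measurable_times measurable_component_singleton)
  then show "indep_vars (\<lambda>_. borel) (\<lambda>j \<omega>. U j \<omega> * Z j \<omega>) UNIV" by simp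
  have "indep_var (PiM {Inr (Inr j)} (\<lambda>_. borel)) (\<lambda>\<omega>. restrict (\<lambda>l. ?V l \<omega>) {Inr (Inr j)})
      (PiM {Inr (Inl j)} (\<lambda>_. borel)) (\<lambda>\<omega>. restrict (\<lambda>l. ?V l \<omega>) {Inr (Inl j)})"
    by (rule indep_var_restrict[OF ind]) auto
  then have "indep_var borel ((\<lambda>v. v (Inr (Inr j))) \<circ> (\<lambda>\<omega>. restrict (\<lambda>l. ?V l \<omega>) {Inr (Inr j)}))
      borel ((\<lambda>v. v (Inr (Inl j))) \<circ> (\<lambda>\<omega>. restrict (\<lambda>l. ?V l \<omega>) {Inr (Inl j)}))"
    by (rule indep_var_compose) (auto intro!: measurable_component_singleton)
  then show "indep_var borel (U j) borel (Z j)" by (simp add: comp_def)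
qed

section \<open>Growth of the truncation point and of the bandwidths\<close>

lemma eventually_ln_le_powr:
  fixes e c C :: real
  assumes "0 < e" "0 < c"
  shows "\<forall>\<^sub>F k in sequentially. C * ln (real k) \<le> c * real k powr e"
proof -
  have "(\<lambda>k. C * (ln (real k) / real k powr e)) \<longlonglongrightarrow> C * 0"
    using assms by (intro tendsto_mult tendsto_const lim_ln_over_power)
  then have "\<forall>\<^sub>F k in sequentially. C * (ln (real k) / real k powr e) < c"
    using assms by (intro order_tendstoD(2)) auto
  then show ?thesis using eventually_gt_at_top[of 0]
    by eventually_elim (simp add: pos_divide_less_eq)
qed

lemma eventually_truncation_growth:
  fixes \<alpha> s :: real and \<gamma> :: "nat \<Rightarrow> real"
  assumes \<alpha>: "1 < \<alpha>" and \<gamma>: "\<And>k. \<gamma> k = real k powr (- 1 / (2 * \<alpha>))" and s: "0 < s"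
  shows "\<forall>\<^sub>F k in sequentially. 20 * ln (real k) * (1 + 2 * (s * \<gamma> k)) \<le> real k * (s * \<gamma> k)\<^sup>2"
proof -
  have "\<forall>\<^sub>F k in sequentially. (20 * (1 + 2 * s)) * ln (real k) \<le> s\<^sup>2 * real k powr (1 - 1 / \<alpha>)"
    using \<alpha> s by (intro eventually_ln_le_powr) auto
  then show ?thesis using eventually_ge_at_top[of 1]
  proof eventually_elim
    case (elim k)
    have k: "1 \<le> real k" using elim by simp
    have "\<gamma> k \<le> real k powr 0" unfolding \<gamma> using k \<alpha> by (intro powr_mono) auto
    then have "\<gamma> k \<le> 1" using k by simp
    then have "s * \<gamma> k \<le> s" using s by simp
    then have "20 * ln (real k) * (1 + 2 * (s * \<gamma> k)) \<le> 20 * ln (real k) * (1 + 2 * s)"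
      using k by (intro mult_left_mono) auto
    also have "\<dots> \<le> s\<^sup>2 * real k powr (1 - 1 / \<alpha>)" using elim by (simp add: mult_ac)
    also have "real k powr (1 - 1 / \<alpha>) = real k * (\<gamma> k)\<^sup>2"
    proof -
      have "(\<gamma> k)\<^sup>2 = real k powr (- 1 / (2 * \<alpha>) + - 1 / (2 * \<alpha>))" unfolding \<gamma> power2_eq_square by (rule powr_add[symmetric])
      also have "- 1 / (2 * \<alpha>) + - 1 / (2 * \<alpha>) = - 1 / \<alpha>" using \<alpha> by (simp add: field_simps)
      finally have "real k * (\<gamma> k)\<^sup>2 = real k powr 1 * real k powr (- 1 / \<alpha>)" using k by simp
      also have "\<dots> = real k powr (1 - 1 / \<alpha>)" unfolding powr_add[symmetric] by simp
      finally show ?thesis ..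
    qed
    finally show ?case by (simp add: power_mult_distrib mult_ac)
  qed
qed

text \<open>The logarithmic factors in the limit condition are eventually at least 1, so
  \<open>sqrt k * h k\<close> eventually exceeds \<open>\<epsilon> k\<close>, which is at least
  \<open>k powr (- 1 / 4)\<close> because \<open>r / (\<beta> + 1) \<le> 1 / 4\<close>. A further
  factor \<open>sqrt k\<close> gives the claim.\<close>

lemma eventually_bandwidth_ge:
  fixes h \<epsilon> :: "nat \<Rightarrow> real"
  assumes \<epsilon>: "\<And>k. \<epsilon> k = real k powr (- r / (\<beta> + 1))" and r: "r \<le> 1 / 4" and \<beta>: "0 < \<beta>" and h: "\<And>k. 0 < h k"
    and lim: "(\<lambda>k. \<epsilon> k * ln (real k) powr (3 / 2) * sqrt (ln (ln (real k))) / (sqrt (real k) * h k)) \<longlonglongrightarrow> 0"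
  shows "\<forall>\<^sub>F k in sequentially. real k powr (1 / 4) \<le> real k * h k"
proof -
  have "\<forall>\<^sub>F k in sequentially. \<epsilon> k * ln (real k) powr (3 / 2) * sqrt (ln (ln (real k))) / (sqrt (real k) * h k) < 1"
    using lim by (rule order_tendstoD) simp
  moreover have "\<forall>\<^sub>F k in sequentially. 1 \<le> ln (real k) powr (3 / 2) * sqrt (ln (ln (real k)))"
    by real_asymp
  ultimately show ?thesis using eventually_ge_at_top[of 1]
  proof eventually_elim
    case (elim k)
    have k: "1 \<le> real k" using elim by simp
    have \<epsilon>0: "0 \<le> \<epsilon> k" by (simp add: \<epsilon>)
    have sh: "0 < sqrt (real k) * h k" using k h[of k] by simp
    have "r / (\<beta> + 1) \<le> 1 / 4"
    proof (cases "0 \<le> r")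
      case True
      have "r / (\<beta> + 1) \<le> r / 1" using True \<beta> by (intro divide_left_mono) auto
      then show ?thesis using r by linarith
    next
      case False
      then have "r / (\<beta> + 1) \<le> 0" using \<beta> by (simp add: divide_nonpos_pos)
      then show ?thesis by linarith
    qed
    then have "real k powr (- (1 / 4)) \<le> \<epsilon> k" unfolding \<epsilon> using k by (intro powr_mono) auto
    also have "\<epsilon> k \<le> \<epsilon> k * (ln (real k) powr (3 / 2) * sqrt (ln (ln (real k))))"
      using mult_left_mono[OF elim(2) \<epsilon>0] by simp
    also have "\<dots> \<le> sqrt (real k) * h k" using elim(1) sh by (simp add: pos_divide_less_eq mult.assoc)
    finally have "sqrt (real k) * real k powr (- (1 / 4)) \<le> sqrt (real k) * (sqrt (real k) * h k)"
      by (intro mult_left_mono) auto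
    moreover have "sqrt (real k) * real k powr (- (1 / 4)) = real k powr (1 / 4)"
      using k by (simp add: powr_half_sqrt[symmetric] powr_add[symmetric])
    moreover have "sqrt (real k) * (sqrt (real k) * h k) = real k * h k" by (simp add: mult.assoc[symmetric])
    ultimately show ?case by simp
  qed
qed

text \<open>Because the mass cap is itself of order \<open>h k\<close>, one factor
  \<open>h k\<close> cancels, and only \<open>ln k\<close> against \<open>k * h k\<close> has to be
  compared.\<close>

lemma eventually_bandwidth_growth:
  fixes h :: "nat \<Rightarrow> real" and C s :: real
  assumes ge: "\<forall>\<^sub>F k in sequentially. real k powr (1 / 4) \<le> real k * h k" and h: "\<And>k. 0 < h k"
    and s: "0 < s"
  shows "\<forall>\<^sub>F k in sequentially. 20 * ln (real k) * (C * h k + 2 * (s * h k)) \<le> real k * (s * h k)\<^sup>2"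
proof -
  have "\<forall>\<^sub>F k in sequentially. (20 * (C + 2 * s)) * ln (real k) \<le> s\<^sup>2 * real k powr (1 / 4)"
    using s by (intro eventually_ln_le_powr) auto
  then show ?thesis using ge
  proof eventually_elim
    case (elim k)
    have "s\<^sup>2 * real k powr (1 / 4) \<le> s\<^sup>2 * (real k * h k)" using elim(2) by (intro mult_left_mono) auto
    then have "(20 * (C + 2 * s)) * ln (real k) * h k \<le> s\<^sup>2 * (real k * h k) * h k"
      using elim(1) h[of k] by (intro mult_right_mono) auto
    then show ?case by (simp add: power2_eq_square algebra_simps)
  qed
qed

section \<open>Almost sure discrepancy bounds and the conclusion\<close>

lemma empirical_near_of_count:
  assumes "0 < N" "\<bar>(\<Sum>i<N. indicator I (x i)) - real N * q\<bar> \<le> e"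
  shows "\<bar>measure (measure_pmf (empirical N x)) I - q\<bar> \<le> e / real N"
proof -
  have "measure (measure_pmf (empirical N x)) I - q = ((\<Sum>i<N. indicator I (x i)) - real N * q) / real N"
    using assms(1) by (simp add: measure_empirical diff_divide_distrib)
  then show ?thesis using assms by (simp add: abs_divide divide_right_mono)
qed

text \<open>One null set must serve every tolerance \<delta>. Countably many tolerances suffice
  because the bound weakens as \<delta> grows.\<close>

lemma (in prob_space) AE_uniform_interval_count_all_scales:
  fixes V :: "nat \<Rightarrow> 'a \<Rightarrow> real" and N :: "nat \<Rightarrow> nat" and b v :: "nat \<Rightarrow> real"
  assumes indep: "indep_vars (\<lambda>_. borel) V UNIV" and law: "\<And>i. distr M borel (V i) = \<mu>"
    and mu: "real_distribution \<mu>" "continuous_on UNIV (cdf \<mu>)" and N: "\<And>k. N k \<le> k"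
    and b: "\<forall>\<^sub>F k in sequentially. 0 < b k" and v: "\<And>k. 0 \<le> v k"
    and large: "\<And>s. 0 < s \<Longrightarrow> \<forall>\<^sub>F k in sequentially. 20 * ln (real k) * (v k + 2 * (s * b k)) \<le> real k * (s * b k)\<^sup>2"
  shows "AE \<omega> in M. \<forall>\<delta>>0. \<forall>\<^sub>F k in sequentially. \<forall>I. is_interval I \<longrightarrow> measure \<mu> I \<le> v k \<longrightarrow>
    \<bar>(\<Sum>i<N k. indicator I (V i \<omega>)) - real (N k) * measure \<mu> I\<bar> \<le> real k * (\<delta> * b k)"
proof -
  have "AE \<omega> in M. \<forall>j. \<forall>\<^sub>F k in sequentially. \<forall>I. is_interval I \<longrightarrow> measure \<mu> I \<le> v k \<longrightarrow>
    \<bar>(\<Sum>i<N k. indicator I (V i \<omega>)) - real (N k) * measure \<mu> I\<bar> \<le> 3 * real k * (inverse (real (Suc j)) * b k)"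
    unfolding AE_all_countable
  proof
    fix j
    have "\<forall>\<^sub>F k in sequentially. 0 < inverse (real (Suc j)) * b k" using b by eventually_elim simp
    then show "AE \<omega> in M. \<forall>\<^sub>F k in sequentially. \<forall>I. is_interval I \<longrightarrow> measure \<mu> I \<le> v k \<longrightarrow>
      \<bar>(\<Sum>i<N k. indicator I (V i \<omega>)) - real (N k) * measure \<mu> I\<bar> \<le> 3 * real k * (inverse (real (Suc j)) * b k)"
      by (rule AE_uniform_interval_count[OF indep law mu N _ v large]) simp
  qed
  then show ?thesis
  proof (rule AE_mp, intro AE_I2 impI allI)
    fix \<omega> and \<delta> :: real assume \<delta>: "0 < \<delta>"
      and all: "\<forall>j. \<forall>\<^sub>F k in sequentially. \<forall>I. is_interval I \<longrightarrow> measure \<mu> I \<le> v k \<longrightarrow>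
      \<bar>(\<Sum>i<N k. indicator I (V i \<omega>)) - real (N k) * measure \<mu> I\<bar> \<le> 3 * real k * (inverse (real (Suc j)) * b k)"
    obtain j where j: "inverse (real (Suc j)) < \<delta> / 3" using reals_Archimedean[of "\<delta> / 3"] \<delta> by auto
    show "\<forall>\<^sub>F k in sequentially. \<forall>I. is_interval I \<longrightarrow> measure \<mu> I \<le> v k \<longrightarrow>
      \<bar>(\<Sum>i<N k. indicator I (V i \<omega>)) - real (N k) * measure \<mu> I\<bar> \<le> real k * (\<delta> * b k)"
      using all[rule_format, of j] b
    proof eventually_elim
      case (elim k)
      have "3 * real k * (inverse (real (Suc j)) * b k) \<le> 3 * real k * (\<delta> / 3 * b k)"
        using j elim(2) by (intro mult_left_mono mult_right_mono) auto
      then have "3 * real k * (inverse (real (Suc j)) * b k) \<le> real k * (\<delta> * b k)" by simp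
      then show ?case using elim(1) order.trans by blast
    qed
  qed
qed

theorem theorem3:
  fixes M :: "'a measure" and Q :: "real measure"
    and X Z U Y :: "nat \<Rightarrow> 'a \<Rightarrow> real"
    and m n :: "nat \<Rightarrow> nat"
    and G g K :: "real \<Rightarrow> real"
    and h \<gamma> \<epsilon> phat :: "nat \<Rightarrow> real"
    and p \<tau> \<alpha>0 \<alpha> \<beta> r \<eta> :: real
    and Ghat :: "nat \<Rightarrow> 'a \<Rightarrow> real pmf"
  \<comment> \<open>the multiplicative censoring model\<close>
  assumes "prob_space M"
    and "real_distribution Q"
    and G_def: "G = cdf Q"
    and "G 0 = 0"
    and "integrable Q (\<lambda>z. 1 / z)"
    and "prob_space.indep_vars M (\<lambda>_. borel) (case_sum X (case_sum Z U)) (UNIV :: (nat + nat + nat) set)"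
    and "\<And>i. distr M borel (X i) = Q"
    and "\<And>j. distr M borel (Z j) = Q"
    and "\<And>j. distr M borel (U j) = uniform_measure lborel {0..1}"
    and Y_def: "\<And>j \<omega>. Y j \<omega> = U j \<omega> * Z j \<omega>"
  \<comment> \<open>the sequence of sample sizes, indexed by their sum\<close>
    and "\<And>k. m k + n k = k"
    and "filterlim m at_top sequentially"
    and "filterlim n at_top sequentially"
    and phat_def: "\<And>k. phat k = real (m k) / real k"
    and "phat \<longlonglongrightarrow> p"
  \<comment> \<open>(i)\<close>
    and "0 < p" "p \<le> 1"
    and "(\<lambda>k. sqrt (real k) * (phat k - p)) \<in> O(\<lambda>k. sqrt (ln (ln (real k))))"
  \<comment> \<open>(ii)\<close>
    and "continuous_on UNIV G"
    and "bdd_above {t. G t < 1}"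
    and \<tau>_def: "\<tau> = Sup {t. G t < 1}"
  \<comment> \<open>(iii)\<close>
    and "\<alpha>0 > 2"
    and "\<exists>L. ((\<lambda>x. G x / x powr \<alpha>0) \<longlongrightarrow> L) (at_right 0)"
  \<comment> \<open>(iv)\<close>
    and "\<beta> > 0"
    and "\<exists>L>0. ((\<lambda>x. (1 - G (\<tau> - x)) / x powr \<beta>) \<longlongrightarrow> L) (at_right 0)"
  \<comment> \<open>(v)\<close>
    and "g \<in> borel_measurable borel"
    and "\<And>x. 0 \<le> g x"
    and "Q = density lborel (\<lambda>x. ennreal (g x))"
    and "g differentiable_on {0..<\<tau>}"
  \<comment> \<open>tuning parameters\<close>
    and "1 < \<alpha>" "\<alpha> < \<alpha>0 / 2"
    and \<gamma>_def: "\<And>k. \<gamma> k = real k powr (- 1 / (2 * \<alpha>))"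
    and r_def: "r = min (1 / 4) ((\<alpha> - 1) / (2 * \<alpha>))"
    and \<epsilon>_def: "\<And>k. \<epsilon> k = real k powr (- r / (\<beta> + 1))"
  \<comment> \<open>the bandwidths\<close>
    and "\<And>k. 0 < h k"
    and "h \<longlonglongrightarrow> 0"
    and "filterlim (\<lambda>k. real (m k) * h k) at_top sequentially"
    and "filterlim (\<lambda>k. ln (h k) / ln (ln (real (m k)))) at_bot sequentially"
    and "(\<lambda>k. sqrt (ln (real (n k))) * h k) \<longlonglongrightarrow> 0"
    and "(\<lambda>k. sqrt (ln (real (m k))) * h k) \<longlonglongrightarrow> 0"
    and "(\<lambda>k. \<epsilon> k * ln (real k) powr (3 / 2) * sqrt (ln (ln (real k)))
              / (sqrt (real k) * h k)) \<longlonglongrightarrow> 0"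
  \<comment> \<open>the kernel\<close>
    and "total_variation K < \<infinity>"
    and "\<And>u. u \<notin> {-1<..<1} \<Longrightarrow> K u = 0"
    and "continuous_on UNIV K"
    and "(LINT u|lborel. K u) = 1"
  \<comment> \<open>the estimator: any solution of the score equation\<close>
    and "AE \<omega> in M. \<forall>\<^sub>F k in sequentially.
           score_solution (m k) (n k) (\<lambda>i. X i \<omega>) (\<lambda>j. Y j \<omega>) (\<gamma> k) (Ghat k \<omega>)"
    and "0 < \<eta>" "\<eta> < \<tau>"
  shows "AE \<omega> in M.
    (\<lambda>k. sup_norm_on {0..\<tau> - \<eta>} (\<lambda>t. kernel_estimate K (h k) (Ghat k \<omega>) t - g t)) \<longlonglongrightarrow> 0"
proof -
  interpret prob_space M by fact
  interpret Q: real_distribution Q by fact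
  have \<tau>0: "0 < \<tau>" using assms(47,48) by simp
  have Q0: "cdf Q 0 = 0" and Qcont: "continuous_on UNIV (cdf Q)" using assms(4,19) by (simp_all add: G_def)
  have \<tau>Q: "bdd_above {t. cdf Q t < 1}" "\<tau> = Sup {t. cdf Q t < 1}" using assms(20,21) by (simp_all add: G_def)
  note posQ = AE_positive_of_cdf[OF assms(2) Q0]
  have Yfun: "Y = (\<lambda>j \<omega>. U j \<omega> * Z j \<omega>)" using Y_def by blast
  note ind = indep_vars_components[OF assms(6)]
  have Yind: "indep_vars (\<lambda>_. borel) Y UNIV" using ind(2) by (simp add: Yfun)
  have rvX[measurable]: "X i \<in> borel_measurable M" for i using ind(1) by (auto simp: indep_vars_def)
  have rvY[measurable]: "Y i \<in> borel_measurable M" for i using Yind by (auto simp: indep_vars_def)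
  define FL where "FL = density lborel (\<lambda>y. ennreal (indicator {0..} y * inv_tail Q y))"
  have Ylaw: "distr M borel (Y j) = FL" for j
    unfolding FL_def Yfun by (rule distr_uniform_times[OF ind(3) assms(9) assms(8) assms(5) posQ])
  have FLprob: "prob_space FL" unfolding Ylaw[symmetric, of 0] by (rule prob_space_distr) simp
  interpret F: prob_space FL by (rule FLprob)
  have FLreal: "real_distribution FL"
    using FLprob by (auto simp: real_distribution_def real_distribution_axioms_def FL_def)
  have FLcont: "continuous_on UNIV (cdf FL)"
    by (rule censored_cdf_continuous[OF assms(2) Q0 assms(5) \<tau>Q \<tau>0 FL_def FLprob])
  have \<gamma>0: "\<forall>\<^sub>F k in sequentially. 0 < \<gamma> k"
    using eventually_gt_at_top[of 0] by eventually_elim (simp add: \<gamma>_def)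
  have \<gamma>lim: "\<gamma> \<longlonglongrightarrow> 0"
  proof -
    have "((\<lambda>k. real k powr (- (1 / (2 * \<alpha>)))) \<longlongrightarrow> 0) sequentially"
      using assms(30) by (intro tendsto_neg_powr filterlim_real_sequentially) auto
    then show ?thesis by (simp add: \<gamma>_def[abs_def])
  qed
  have mle: "m k \<le> k" and nle: "n k \<le> k" for k using assms(11)[of k] by auto
  have \<gamma>gr: "\<forall>\<^sub>F k in sequentially. 20 * ln (real k) * (1 + 2 * (s * \<gamma> k)) \<le> real k * (s * \<gamma> k)\<^sup>2" if "0 < s" for s
    by (rule eventually_truncation_growth[OF assms(30) \<gamma>_def that])
  have r4: "r \<le> 1 / 4" by (simp add: r_def)
  note hge = eventually_bandwidth_ge[OF \<epsilon>_def r4 assms(24) assms(35) assms(41)]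
  have AEX: "AE \<omega> in M. \<forall>\<delta>>0. \<forall>\<^sub>F k in sequentially. \<forall>I. is_interval I \<longrightarrow> measure Q I \<le> 1 \<longrightarrow>
      \<bar>(\<Sum>i<m k. indicator I (X i \<omega>)) - real (m k) * measure Q I\<bar> \<le> real k * (\<delta> * \<gamma> k)"
    by (rule AE_uniform_interval_count_all_scales[OF ind(1) assms(7) assms(2) Qcont mle \<gamma>0 _ \<gamma>gr]) auto
  have AEY: "AE \<omega> in M. \<forall>\<delta>>0. \<forall>\<^sub>F k in sequentially. \<forall>I. is_interval I \<longrightarrow> measure FL I \<le> 1 \<longrightarrow>
      \<bar>(\<Sum>i<n k. indicator I (Y i \<omega>)) - real (n k) * measure FL I\<bar> \<le> real k * (\<delta> * \<gamma> k)"
    by (rule AE_uniform_interval_count_all_scales[OF Yind Ylaw FLreal FLcont nle \<gamma>0 _ \<gamma>gr]) auto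
  \<comment> \<open>The constant runs through the naturals so that a single null set serves all of
    them; a real constant is rounded up when the bound is applied.\<close>
  have AEh: "AE \<omega> in M. \<forall>C::nat. \<forall>\<delta>>0. \<forall>\<^sub>F k in sequentially. \<forall>I. is_interval I \<longrightarrow> measure Q I \<le> real C * h k \<longrightarrow>
      \<bar>(\<Sum>i<m k. indicator I (X i \<omega>)) - real (m k) * measure Q I\<bar> \<le> real k * (\<delta> * h k)"
    unfolding AE_all_countable
  proof
    fix C :: nat
    show "AE \<omega> in M. \<forall>\<delta>>0. \<forall>\<^sub>F k in sequentially. \<forall>I. is_interval I \<longrightarrow> measure Q I \<le> real C * h k \<longrightarrow>
      \<bar>(\<Sum>i<m k. indicator I (X i \<omega>)) - real (m k) * measure Q I\<bar> \<le> real k * (\<delta> * h k)"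
      using assms(35) less_imp_le[OF assms(35)]
      by (intro AE_uniform_interval_count_all_scales[OF ind(1) assms(7) assms(2) Qcont mle]
          eventually_bandwidth_growth[OF hge]) auto
  qed
  have AEpos: "AE \<omega> in M. \<forall>i. 0 < X i \<omega>"
    unfolding AE_all_countable
  proof
    fix i
    have "AE x in distr M borel (X i). 0 < x" using posQ by (simp only: assms(7))
    then show "AE \<omega> in M. 0 < X i \<omega>" by (subst (asm) AE_distr_iff) auto
  qed
  define b where "b = \<tau> - \<eta>"
  have b: "0 < b" "b < \<tau>" using assms(47,48) by (auto simp: b_def)
  have gcont: "continuous_on {0..<\<tau>} g" using assms(29) by (rule differentiable_imp_continuous_on)
  obtain gm where gm: "\<And>t. 0 \<le> t \<Longrightarrow> t \<le> b \<Longrightarrow> g t \<le> gm"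
  proof -
    have "continuous_on {0..b} g" using gcont by (rule continuous_on_subset) (use b in auto)
    then have "bdd_above (g ` {0..b})" by (intro compact_imp_bounded bounded_imp_bdd_above compact_continuous_image) auto
    then obtain u where "\<forall>t\<in>{0..b}. g t \<le> u" by (auto simp: bdd_above_def)
    then show ?thesis by (intro that[of u]) simp
  qed
  obtain L where L: "((\<lambda>x. cdf Q x / x powr \<alpha>0) \<longlongrightarrow> L) (at_right 0)" using assms(23) by (auto simp: G_def)
  note gloc = density_interval_near[OF assms(2) Q0 assms(26,27,28) gcont \<tau>0 assms(22) L b]
  have mlarge: "\<forall>\<^sub>F k in sequentially. 0 < m k" "\<forall>\<^sub>F k in sequentially. 0 < n k"
    using eventually_compose_filterlim[OF eventually_gt_at_top assms(12)]
      eventually_compose_filterlim[OF eventually_gt_at_top assms(13)] by blast+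
  have mhalf: "\<forall>\<^sub>F k in sequentially. p / 2 < phat k"
    using assms(16) by (intro order_tendstoD(1)[OF assms(15)]) simp
  \<comment> \<open>Counts are controlled in units of \<open>k\<close>. Eventually
    \<open>m k\<close> exceeds \<open>p / 2 * k\<close>, so normalising by \<open>m k\<close> costs
    a factor \<open>2 / p\<close>, which the smaller tolerance pays for.\<close>
  have scale: "real k * (\<delta> * p / 2 * c) / real (m k) \<le> \<delta> * c"
    if "0 < m k" "p / 2 < phat k" "0 < \<delta>" "0 \<le> c" for k \<delta> c
  proof -
    have k: "0 < real k" using mle[of k] that(1) by linarith
    have "p / 2 * real k \<le> real (m k)" using that(2) k by (simp add: phat_def pos_less_divide_eq)
    then have "p / 2 * real k * (\<delta> * c) \<le> real (m k) * (\<delta> * c)" using that by (intro mult_right_mono) auto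
    then show ?thesis using that(1) by (simp add: pos_divide_le_eq mult_ac)
  qed
  show ?thesis
    using AEX AEY AEh AEpos assms(46)
  proof eventually_elim
    case (elim \<omega>)
    define E F where "E k = empirical (m k) (\<lambda>i. X i \<omega>)" and "F k = empirical (n k) (\<lambda>j. Y j \<omega>)" for k
    have devX: "\<forall>\<^sub>F k in sequentially. \<forall>I. is_interval I \<longrightarrow> measure Q I \<le> v k \<longrightarrow>
        \<bar>measure (measure_pmf (E k)) I - measure Q I\<bar> \<le> \<delta> * c k"
      if \<delta>: "0 < \<delta>" and c: "\<forall>\<^sub>F k in sequentially. 0 \<le> c k"
        and cnt: "\<forall>\<^sub>F k in sequentially. \<forall>I. is_interval I \<longrightarrow> measure Q I \<le> v k \<longrightarrow>
          \<bar>(\<Sum>i<m k. indicator I (X i \<omega>)) - real (m k) * measure Q I\<bar> \<le> real k * (\<delta> * p / 2 * c k)" for \<delta> c v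
      using cnt mlarge(1) mhalf c
    proof eventually_elim
      case (elim k)
      show ?case
      proof (intro allI impI)
        fix I :: "real set" assume I: "is_interval I" "measure Q I \<le> v k"
        have "\<bar>measure (measure_pmf (E k)) I - measure Q I\<bar> \<le> real k * (\<delta> * p / 2 * c k) / real (m k)"
          unfolding E_def by (rule empirical_near_of_count[OF elim(2)]) (use elim(1) I in blast)
        also have "\<dots> \<le> \<delta> * c k" using elim \<delta> by (intro scale) auto
        finally show "\<bar>measure (measure_pmf (E k)) I - measure Q I\<bar> \<le> \<delta> * c k" .
      qed
    qed
    interpret censoring_limit Q FL \<tau> p E F "\<lambda>k. Ghat k \<omega>" phat \<gamma>
    proof
      show "0 < \<tau>" "phat \<longlonglongrightarrow> p" "0 < p" "\<gamma> \<longlonglongrightarrow> 0" by (fact \<tau>0 assms(15) assms(16) \<gamma>lim)+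
      show "integrable Q (\<lambda>z. 1 / z)" by (rule assms(5))
      show "AE z in Q. 0 < z" by (rule posQ)
      show "FL = density lborel (\<lambda>y. ennreal (indicator {0..} y * inv_tail Q y))" by (rule FL_def)
      show "0 < inv_tail Q c" if "c < \<tau>" for c by (rule inv_tail_pos[OF assms(2) Q0 assms(5) \<tau>Q \<tau>0 that])
      show "\<exists>c>0. c < \<tau> \<and> \<rho> < measure FL {0<..c}" if "\<rho> < 1" for \<rho>
        using censored_exhaust[OF assms(2) Q0 assms(5) \<tau>Q \<tau>0 FL_def FLprob that] by blast
      show "\<forall>\<^sub>F k in sequentially. score_equation (E k) (F k) (Ghat k \<omega>) (phat k) (\<gamma> k)"
        using elim(5) mlarge \<gamma>0
      proof eventually_elim
        case k: (elim k)
        have "score_equation (E k) (F k) (Ghat k \<omega>) (real (m k) / real (m k + n k)) (\<gamma> k)"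
          unfolding E_def F_def
          by (rule score_solution_imp_score_equation[OF k(1,2,3) _ k(4)]) (use elim(4) in blast)
        then show ?case by (simp only: assms(11) phat_def)
      qed
      show "\<forall>\<^sub>F k in sequentially. \<forall>I. is_interval I \<longrightarrow> \<bar>measure (measure_pmf (E k)) I - measure Q I\<bar> \<le> \<delta> * \<gamma> k"
        if \<delta>: "0 < \<delta>" for \<delta>
      proof -
        have \<delta>p: "0 < \<delta> * p / 2" using \<delta> assms(16) by simp
        have \<gamma>nn: "\<forall>\<^sub>F k in sequentially. 0 \<le> \<gamma> k" using \<gamma>0 by eventually_elim simp
        have "\<forall>\<^sub>F k in sequentially. \<forall>I. is_interval I \<longrightarrow> measure Q I \<le> 1 \<longrightarrow> \<bar>measure (measure_pmf (E k)) I - measure Q I\<bar> \<le> \<delta> * \<gamma> k"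
          by (rule devX[OF \<delta> \<gamma>nn elim(1)[THEN spec, THEN mp, OF \<delta>p]])
        then show ?thesis by eventually_elim (use Q.prob_le_1 in blast)
      qed
      show "\<forall>\<^sub>F k in sequentially. \<forall>I. is_interval I \<longrightarrow> (1 - phat k) * \<bar>measure (measure_pmf (F k)) I - measure FL I\<bar> \<le> \<delta> * \<gamma> k"
        if \<delta>: "0 < \<delta>" for \<delta>
        using elim(2)[rule_format, OF \<delta>] mlarge
      proof eventually_elim
        case (elim k)
        have k: "0 < real k" using nle[of k] elim by linarith
        have "real (m k) + real (n k) = real k" using assms(11)[of k] by (metis of_nat_add)
        \<comment> \<open>This weight cancels the normalisation of the empirical law by
          \<open>n k\<close>, so the bound in units of \<open>k\<close> carries over even when the
          censored share tends to 0.\<close>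
        then have ph: "1 - phat k = real (n k) / real k" using k by (simp add: phat_def field_simps)
        show ?case
        proof (intro allI impI)
          fix I :: "real set" assume I: "is_interval I"
          have "\<bar>measure (measure_pmf (F k)) I - measure FL I\<bar> \<le> real k * (\<delta> * \<gamma> k) / real (n k)"
            unfolding F_def by (rule empirical_near_of_count[OF elim(3)])
              (use elim(1) I F.prob_le_1 in blast)
          then have "(1 - phat k) * \<bar>measure (measure_pmf (F k)) I - measure FL I\<bar> \<le> real (n k) / real k * (real k * (\<delta> * \<gamma> k) / real (n k))"
            unfolding ph by (intro mult_left_mono) auto
          also have "\<dots> = \<delta> * \<gamma> k" using k elim by simp
          finally show "(1 - phat k) * \<bar>measure (measure_pmf (F k)) I - measure FL I\<bar> \<le> \<delta> * \<gamma> k" .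
        qed
      qed
    qed
    have devh: "\<forall>\<^sub>F k in sequentially. \<forall>I. is_interval I \<longrightarrow> measure Q I \<le> C * h k \<longrightarrow>
        \<bar>measure (measure_pmf (E k)) I - measure Q I\<bar> \<le> \<delta> * h k" if \<delta>: "0 < \<delta>" for C \<delta>
    proof -
      define C' where "C' = nat \<lceil>C\<rceil>"
      have C': "C \<le> real C'" unfolding C'_def by linarith
      have \<delta>p: "0 < \<delta> * p / 2" using \<delta> assms(16) by simp
      have hnn: "\<forall>\<^sub>F k in sequentially. 0 \<le> h k" using less_imp_le[OF assms(35)] by simp
      have "\<forall>\<^sub>F k in sequentially. \<forall>I. is_interval I \<longrightarrow> measure Q I \<le> real C' * h k \<longrightarrow> \<bar>measure (measure_pmf (E k)) I - measure Q I\<bar> \<le> \<delta> * h k"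
        by (rule devX[OF \<delta> hnn elim(3)[THEN spec, THEN spec, THEN mp, OF \<delta>p]])
      then show ?thesis
      proof eventually_elim
        case (elim k)
        have "C * h k \<le> real C' * h k" using C' less_imp_le[OF assms(35)] by (intro mult_right_mono)
        then show ?case using elim by (meson order.trans)
      qed
    qed
    have "\<forall>\<^sub>F k in sequentially. \<forall>t\<in>{0..b}. \<bar>kernel_estimate K (h k) (Ghat k \<omega>) t - g t\<bar> \<le> e" if "0 < e" for e
      by (rule kernel_estimate_uniform[OF b _ gloc assms(35,36) devh assms(44,43,45) that])
         (use gm assms(27) in auto)
    then show ?case using b unfolding b_def by (intro sup_norm_tendsto_0) auto
  qed
qed

end
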